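(* Let $L\in\mathcal{L}$ be such that $L$ and $L^*$ have order continuous norms. Let $\Psi_1,\dots,\Psi_m$ be bounded sets of nonnegative matrices that define operators on $L$, and put $\Phi_j=\Psi_j\cdots\Psi_m\Psi_1\cdots\Psi_{j-1}$ for $j=1,\dots,m$ (so $\Phi_1=\Psi_1\cdots\Psi_m$). Let $\alpha\ge\frac1m$, $n\in\mathbb{N}$, $r\in\{\rho_{ess},\hat\rho_{ess}\}$, and put $\Sigma_j=\Psi_j^{(\alpha m)}\cdots\Psi_m^{(\alpha m)}\Psi_1^{(\alpha m)}\cdots\Psi_{j-1}^{(\alpha m)}$ for $j=1,\dots,m$. Then $$r(\Psi_1^{(\alpha)}\circ\cdots\circ\Psi_m^{(\alpha)})\le r(\Phi_1^{(\alpha)}\circ\cdots\circ\Phi_m^{(\alpha)})^{1/m}\le r((\Phi_1^n)^{(\alpha)}\circ\cdots\circ(\Phi_m^n)^{(\alpha)})^{1/(mn)}\le r(\Psi_1\cdots\Psi_m)^\alpha,$$ $$r(\Psi_1^{(\alpha)}\circ\cdots\circ\Psi_m^{(\alpha)})\le r(\Psi_1^{(\alpha m)}\cdots\Psi_m^{(\alpha m)})^{1/m}\le r((\Psi_1\cdots\Psi_m)^{(\alpha m)})^{1/m}\le r(((\Psi_1\cdots\Psi_m)^n)^{(\alpha m)})^{1/(nm)}\le r(\Psi_1\cdots\Psi_m)^\alpha.$$ If in addition $\alpha\ge1$, then $$r(\Psi_1^{(\alpha)}\circ\cdots\circ\Psi_m^{(\alpha)})\le r(\Phi_1^{(\alpha)}\circ\cdots\circ\Phi_m^{(\alpha)})^{1/m}\le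 r((\Phi_1^n)^{(\alpha)}\circ\cdots\circ(\Phi_m^n)^{(\alpha)})^{1/(mn)}\le\left(r((\Phi_1^n)^{(m)})\cdots r((\Phi_m^n)^{(m)})\right)^{\alpha/(m^2n)}\le r(\Psi_1\cdots\Psi_m)^\alpha,$$ and $$r(\Psi_1^{(\alpha)}\circ\cdots\circ\Psi_m^{(\alpha)})\le r(\Sigma_1^{(1/m)}\circ\cdots\circ\Sigma_m^{(1/m)})^{1/m}\le r((\Sigma_1^n)^{(1/m)}\circ\cdots\circ(\Sigma_m^n)^{(1/m)})^{1/(mn)}\le r(\Psi_1^{(\alpha m)}\cdots\Psi_m^{(\alpha m)})^{1/m}$$ $$\le r((\Psi_1\cdots\Psi_m)^{(\alpha m)})^{1/m}\le r(((\Psi_1\cdots\Psi_m)^n)^{(\alpha m)})^{1/(nm)}\le r(\Psi_1\cdots\Psi_m)^\alpha.$$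
   Context: Let $R=\mathbb{N}$ or $R=\{1,\dots,N\}$. A Banach sequence space is a Banach space $L$ of complex sequences indexed by $R$ such that if $x$ is a complex sequence, $y\in L$ and $|x|\le|y|$ entrywise, then $x\in L$ and $\|x\|_L\le\|y\|_L$. $\mathcal{L}$ is the class of Banach sequence spaces containing every standard unit vector $e_n$ with $\|e_n\|_L=1$. A Banach lattice has order continuous norm if every decreasing net $0\le f_\alpha\downarrow0$ satisfies $\|f_\alpha\|\to0$; $L^*$ is the Banach dual. A nonnegative matrix $A=[a_{ij}]$ defines an operator on $L$ if $(Ax)_i=\sum_j a_{ij}x_j$ converges absolutely and $Ax\in L$ for all $x\in L$. Hadamard power $A^{(t)}=[a_{ij}^t]$, Hadamard product $A\circ B=[a_{ij}b_{ij}]$. For sets: $\Psi\Sigma=\{AB\}$, $\Psi^n=\{A_1\cdots A_n:A_i\in\Psi\}$, $\Psi^{(t)}=\{A^{(t)}:A\in\Psi\}$, $\Psi_1^{(\alpha_1)}\circ\cdots\circ\Psi_m^{(\alpha_m)}=\{A_1^{(\alpha_1)}\circ\cdots\circ A_m^{(\alpha_m)}:A_j\in\Psi_j\}$; in products, $\Psi_{j-1}$ with $j=1$ means the factor is absent. $\gamma$ is the Hausdorff measure of noncompactness, $\rho_{ess}$ the essential spectral radius; for a bounded set $\Sigma$, $\rho_{ess}(\Sigma)=\sup_m[\sup_{A\in\Sigma^m}\rho_{ess}(A)]^{1/m}$ and $\hat\rho_{ess}(\Sigma)=\lim_{m\to\infty}[\sup_{A\in\Sigma^m}\gamma(A)]^{1/m}$.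 *)

theory Defs
  imports "HOL-Analysis.Analysis" "HOL-Library.Function_Algebras"
begin

type_synonym seq = "nat \<Rightarrow> complex"
type_synonym mat = "nat \<Rightarrow> nat \<Rightarrow> real"

text \<open>The index set R is either all of nat (playing the role of N) or {1..N}.
  A sequence space is a set L of complex sequences (vanishing outside R)
  together with a norm nrm on L.\<close>

definition index_set :: "nat set \<Rightarrow> bool" where
  "index_set R \<longleftrightarrow> R = UNIV \<or> (\<exists>N\<ge>1. R = {1..N})"

definition banach_seq_space :: "nat set \<Rightarrow> seq set \<Rightarrow> (seq \<Rightarrow> real) \<Rightarrow> bool" where
  "banach_seq_space R L nrm \<longleftrightarrow>
     index_set R \<and>
     (\<forall>x\<in>L. \<forall>j. j \<notin> R \<longrightarrow> x j = 0) \<and>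
     \<comment> \<open>complex vector space\<close>
     0 \<in> L \<and> (\<forall>x\<in>L. \<forall>y\<in>L. x + y \<in> L) \<and> (\<forall>c::complex. \<forall>x\<in>L. (\<lambda>j. c * x j) \<in> L) \<and>
     \<comment> \<open>norm\<close>
     (\<forall>x\<in>L. nrm x \<ge> 0 \<and> (nrm x = 0 \<longleftrightarrow> x = 0)) \<and>
     (\<forall>c::complex. \<forall>x\<in>L. nrm (\<lambda>j. c * x j) = cmod c * nrm x) \<and>
     (\<forall>x\<in>L. \<forall>y\<in>L. nrm (x + y) \<le> nrm x + nrm y) \<and>
     \<comment> \<open>completeness\<close>
     (\<forall>s. (\<forall>k. s k \<in> L) \<and> (\<forall>e>0. \<exists>K. \<forall>p\<ge>K. \<forall>q\<ge>K. nrm (s p - s q) < e)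
          \<longrightarrow> (\<exists>y\<in>L. (\<lambda>k. nrm (s k - y)) \<longlonglongrightarrow> 0)) \<and>
     \<comment> \<open>ideal (solid) property\<close>
     (\<forall>x y. y \<in> L \<and> (\<forall>j. cmod (x j) \<le> cmod (y j)) \<longrightarrow> x \<in> L \<and> nrm x \<le> nrm y)"

definition unit_vec :: "nat \<Rightarrow> seq" where
  "unit_vec n = (\<lambda>j. if j = n then 1 else 0)"

definition class_L :: "nat set \<Rightarrow> seq set \<Rightarrow> (seq \<Rightarrow> real) \<Rightarrow> bool" where
  "class_L R L nrm \<longleftrightarrow> banach_seq_space R L nrm \<and>
     (\<forall>n\<in>R. unit_vec n \<in> L \<and> nrm (unit_vec n) = 1)"

definition seq_pos :: "seq \<Rightarrow> bool" where
  "seq_pos x \<longleftrightarrow> (\<forall>j. Im (x j) = 0 \<and> Re (x j) \<ge> 0)"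

definition dual :: "seq set \<Rightarrow> (seq \<Rightarrow> real) \<Rightarrow> (seq \<Rightarrow> complex) set" where
  "dual L nrm = {\<phi>.
     (\<forall>x\<in>L. \<forall>y\<in>L. \<phi> (x + y) = \<phi> x + \<phi> y) \<and>
     (\<forall>c::complex. \<forall>x\<in>L. \<phi> (\<lambda>j. c * x j) = c * \<phi> x) \<and>
     (\<exists>M. \<forall>x\<in>L. cmod (\<phi> x) \<le> M * nrm x) \<and>
     (\<forall>x. x \<notin> L \<longrightarrow> \<phi> x = 0)}"

definition dual_norm :: "seq set \<Rightarrow> (seq \<Rightarrow> real) \<Rightarrow> (seq \<Rightarrow> complex) \<Rightarrow> real" where
  "dual_norm L nrm \<phi> = Sup {cmod (\<phi> x) | x. x \<in> L \<and> nrm x \<le> 1}"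

definition dual_pos :: "seq set \<Rightarrow> (seq \<Rightarrow> complex) \<Rightarrow> bool" where
  "dual_pos L \<phi> \<longleftrightarrow> (\<forall>x\<in>L. seq_pos x \<longrightarrow> Im (\<phi> x) = 0 \<and> Re (\<phi> x) \<ge> 0)"

text \<open>Order continuous norm on a (complex) Banach lattice V with positive cone pos
  (f \<le> g iff pos (g - f)): every decreasing net of positive elements with
  infimum 0 converges to 0 in norm.  Decreasing nets are represented by their
  ranges, i.e. nonempty downward directed sets D (a decreasing net converges to 0
  in norm iff the infimum of the norms over its range is 0).\<close>
definition order_continuous ::
  "'v::{minus,zero} set \<Rightarrow> ('v \<Rightarrow> bool) \<Rightarrow> ('v \<Rightarrow> real) \<Rightarrow> bool" where
  "order_continuous V pos nm \<longleftrightarrow>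
     (\<forall>D. D \<subseteq> V \<and> D \<noteq> {} \<and> (\<forall>f\<in>D. pos f) \<and>
          (\<forall>f\<in>D. \<forall>g\<in>D. \<exists>h\<in>D. pos (f - h) \<and> pos (g - h)) \<and>
          (\<forall>h\<in>V. (\<forall>f\<in>D. pos (f - h)) \<longrightarrow> pos (0 - h))
        \<longrightarrow> (INF f\<in>D. nm f) = 0)"

definition nonneg_mat :: "nat set \<Rightarrow> mat \<Rightarrow> bool" where
  "nonneg_mat R A \<longleftrightarrow> (\<forall>i\<in>R. \<forall>j\<in>R. A i j \<ge> 0)"

definition mat_apply :: "nat set \<Rightarrow> mat \<Rightarrow> seq \<Rightarrow> seq" where
  "mat_apply R A x = (\<lambda>i. if i \<in> R then (\<Sum>\<^sub>\<infinity>j\<in>R. complex_of_real (A i j) * x j) else 0)"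

definition defines_op :: "nat set \<Rightarrow> seq set \<Rightarrow> mat \<Rightarrow> bool" where
  "defines_op R L A \<longleftrightarrow>
     (\<forall>x\<in>L. (\<forall>i\<in>R. (\<lambda>j. A i j * cmod (x j)) summable_on R) \<and> mat_apply R A x \<in> L)"

definition bounded_mat_set :: "nat set \<Rightarrow> seq set \<Rightarrow> (seq \<Rightarrow> real) \<Rightarrow> mat set \<Rightarrow> bool" where
  "bounded_mat_set R L nrm S \<longleftrightarrow>
     (\<exists>M. \<forall>A\<in>S. \<forall>x\<in>L. nrm (mat_apply R A x) \<le> M * nrm x)"

definition mat_mult :: "nat set \<Rightarrow> mat \<Rightarrow> mat \<Rightarrow> mat" where
  "mat_mult R A B = (\<lambda>i j. \<Sum>\<^sub>\<infinity>k\<in>R. A i k * B k j)"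

definition ident_mat :: "nat set \<Rightarrow> mat" where
  "ident_mat R = (\<lambda>i j. if i = j \<and> i \<in> R then 1 else 0)"

definition set_mult :: "nat set \<Rightarrow> mat set \<Rightarrow> mat set \<Rightarrow> mat set" where
  "set_mult R S T = {mat_mult R A B | A B. A \<in> S \<and> B \<in> T}"

fun set_pow :: "nat set \<Rightarrow> mat set \<Rightarrow> nat \<Rightarrow> mat set" where
  "set_pow R S 0 = {ident_mat R}"
| "set_pow R S (Suc k) = set_mult R S (set_pow R S k)"

fun list_prod :: "nat set \<Rightarrow> mat set list \<Rightarrow> mat set" where
  "list_prod R [] = {ident_mat R}"
| "list_prod R (S # Ss) = set_mult R S (list_prod R Ss)"

definition hpow :: "real \<Rightarrow> mat \<Rightarrow> mat" where
  "hpow t A = (\<lambda>i j. A i j powr t)"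

definition hpow_set :: "real \<Rightarrow> mat set \<Rightarrow> mat set" where
  "hpow_set t S = hpow t ` S"

definition hadamard_set :: "nat \<Rightarrow> (nat \<Rightarrow> mat set) \<Rightarrow> mat set" where
  "hadamard_set m S = {(\<lambda>i j. \<Prod>k=1..m. A k i j) | A. \<forall>k\<in>{1..m}. A k \<in> S k}"

definition cyc_prod :: "nat set \<Rightarrow> (nat \<Rightarrow> mat set) \<Rightarrow> nat \<Rightarrow> nat \<Rightarrow> mat set" where
  "cyc_prod R Psi m j = list_prod R (map Psi ([j..<m+1] @ [1..<j]))"

definition hausdorff_mnc :: "seq set \<Rightarrow> (seq \<Rightarrow> real) \<Rightarrow> seq set \<Rightarrow> real" where
  "hausdorff_mnc L nrm S = Inf {e. e > 0 \<and>
      (\<exists>F. finite F \<and> F \<subseteq> L \<and> S \<subseteq> (\<Union>c\<in>F. {x. nrm (x - c) \<le> e}))}"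

definition gamma_op :: "nat set \<Rightarrow> seq set \<Rightarrow> (seq \<Rightarrow> real) \<Rightarrow> mat \<Rightarrow> real" where
  "gamma_op R L nrm A = hausdorff_mnc L nrm (mat_apply R A ` {x\<in>L. nrm x \<le> 1})"

definition cspan :: "seq set \<Rightarrow> seq set" where
  "cspan F = {(\<Sum>f\<in>F. (\<lambda>j. c f * f j)) | c. True}"

definition fredholm :: "seq set \<Rightarrow> (seq \<Rightarrow> real) \<Rightarrow> (seq \<Rightarrow> seq) \<Rightarrow> bool" where
  "fredholm L nrm T \<longleftrightarrow>
     (\<exists>F. finite F \<and> F \<subseteq> L \<and> {x\<in>L. T x = 0} \<subseteq> cspan F) \<and>
     (\<forall>s y. (\<forall>k. s k \<in> T ` L) \<and> y \<in> L \<and> (\<lambda>k. nrm (s k - y)) \<longlonglongrightarrow> 0 \<longrightarrow> y \<in> T ` L) \<and>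
     (\<exists>F. finite F \<and> F \<subseteq> L \<and> L \<subseteq> {u + v | u v. u \<in> T ` L \<and> v \<in> cspan F})"

definition ess_spectrum :: "nat set \<Rightarrow> seq set \<Rightarrow> (seq \<Rightarrow> real) \<Rightarrow> mat \<Rightarrow> complex set" where
  "ess_spectrum R L nrm A =
     {z. \<not> fredholm L nrm (\<lambda>x. (\<lambda>j. z * x j) - mat_apply R A x)}"

definition rho_ess :: "nat set \<Rightarrow> seq set \<Rightarrow> (seq \<Rightarrow> real) \<Rightarrow> mat \<Rightarrow> real" where
  "rho_ess R L nrm A = Sup (insert 0 (cmod ` ess_spectrum R L nrm A))"

definition rho_ess_set :: "nat set \<Rightarrow> seq set \<Rightarrow> (seq \<Rightarrow> real) \<Rightarrow> mat set \<Rightarrow> real" where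
  "rho_ess_set R L nrm S =
     (SUP k\<in>{1..}. Sup (insert 0 (rho_ess R L nrm ` set_pow R S k)) powr (1 / real k))"

definition rho_hat_ess_set :: "nat set \<Rightarrow> seq set \<Rightarrow> (seq \<Rightarrow> real) \<Rightarrow> mat set \<Rightarrow> real" where
  "rho_hat_ess_set R L nrm S =
     lim (\<lambda>k. Sup (insert 0 (gamma_op R L nrm ` set_pow R S (Suc k))) powr (1 / real (Suc k)))"

end

theory Submission
  imports Defs
begin

text \<open>For a nonnegative matrix \<open>A\<close>, order continuity of the norm makes \<open>\<gamma>(A)\<close> the limit of the norms of the
  row tails of \<open>A\<close>. Hence \<open>\<gamma>\<close> is submultiplicative, monotone in \<open>A\<close>, and inherits from the operator norm
  the inequality \<open>\<gamma>(A\<^sub>1\<^sup>\<alpha> \<circ> \<dots> \<circ> A\<^sub>m\<^sup>\<alpha>) \<le> \<gamma>(A\<^sub>1)\<^sup>\<alpha> \<dots> \<gamma>(A\<^sub>m)\<^sup>\<alpha>\<close>, which for the norm follows from the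
  arithmetic-geometric mean inequality applied to the entries.

  Let \<open>\<rho>\<close> be the limit of \<open>\<gamma>(A\<^sup>k)\<close> to the power \<open>1/k\<close>. It equals the essential spectral radius: if
  \<open>\<gamma>(A\<^sup>k) < \<bar>z\<bar>\<^sup>k\<close>, then \<open>z\<^sup>k - A\<^sup>k\<close>, and with it \<open>z - A\<close>, is invertible up to finite rank. Conversely
  \<open>\<rho> - A\<close> is not Fredholm when \<open>\<rho> > 0\<close>: otherwise the open mapping theorem would give
  \<open>\<gamma>(X) \<le> C \<gamma>((\<rho> - A) X)\<close>, so the truncated Neumann series of the resolvent and of its square at
  points \<open>r > \<rho>\<close> would have \<open>\<gamma>\<close> bounded as \<open>r\<close> tends to \<open>\<rho>\<close>; but the latter series dominates
  entrywise its terms \<open>(k + 1) A\<^sup>k / r\<^sup>k\<^sup>+\<^sup>2\<close>, so that \<open>(k + 1) \<rho>\<^sup>k\<close> would be at most a constant times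
  \<open>\<rho>\<^sup>k\<^sup>+\<^sup>2\<close> for every \<open>k\<close>.

  All inequalities then result from Hoelder's inequality
  \<open>(A\<^sub>1\<^sup>\<alpha> \<circ> \<dots> \<circ> A\<^sub>m\<^sup>\<alpha>) (B\<^sub>1\<^sup>\<alpha> \<circ> \<dots> \<circ> B\<^sub>m\<^sup>\<alpha>) \<le> (A\<^sub>1 B\<^sub>1)\<^sup>\<alpha> \<circ> \<dots> \<circ> (A\<^sub>m B\<^sub>m)\<^sup>\<alpha>\<close> and from five properties of
  \<open>r\<close>: nonnegativity, entrywise monotonicity, \<open>r(\<Psi>\<^sup>n) = r(\<Psi>)\<^sup>n\<close>, \<open>r(\<Psi>\<Sigma>) = r(\<Sigma>\<Psi>)\<close>, and the Hadamard
  inequality.\<close>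

subsection \<open>Banach sequence spaces\<close>

no_notation Infinite_Set_Sum.abs_summable_on (infix \<open>abs'_summable'_on\<close> 50)

text \<open>The obstacle is the lower bound for the essential spectral radius.
  \<open>\<gamma>\<close> is monotone on nonnegative matrices, but from below a sum of matrices is
  only known to dominate each single term. The Neumann series at r would thus give rho^k / r^(k+1)
  <= const, which is no contradiction when r tends to rho. In the series of the squared resolvent
  the factor k + 1 sits on one single term, so letting r tend to rho and then k grow does
  contradict. Truncating the series avoids limits of operators; the remainders are harmless because
  \<open>\<gamma>\<close> of A^N is eventually at most e^N for any e strictly between rho and r.
  Hypotheses on a matrix concern its entries on R x R, whereas products are functions on all pairs
  of indices. Algebraic identities for products therefore hold only entrywise on R x R, and sets of
  matrices are compared by mutual domination instead of equality. For a set S, the radius built from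
  essential spectra is determined by the numbers \<open>rh {X}\<close> with X in a power of S, so
  each of its properties reduces to the one already shown for the other radius.\<close>

definition tail :: "nat \<Rightarrow> seq \<Rightarrow> seq" where
  "tail l x = (\<lambda>j. if j < l then 0 else x j)"

definition modulus :: "seq \<Rightarrow> seq" where
  "modulus x = (\<lambda>j. complex_of_real (cmod (x j)))"

text \<open>Summability need not be assumed: if \<open>f\<close> is not summable, neither is its
  complex version, and both sums take the default value 0.\<close>

lemma infsum_of_real:
  "(\<Sum>\<^sub>\<infinity>x\<in>A. complex_of_real (f x)) = complex_of_real (\<Sum>\<^sub>\<infinity>x\<in>A. f x)"
proof (cases "f summable_on A")
  case True
  show ?thesis by (rule infsumI[OF has_sum_of_real[OF has_sum_infsum[OF True]]])
next
  case False
  then show ?thesis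
    using summable_on_def has_sum_of_real_iff
    by (smt (verit) Re_complex_of_real infsum_not_exists of_real_0 summable_on_Re summable_on_cong)
qed

lemma tail_add: "tail l (x + y) = tail l x + tail l y"
  and tail_diff: "tail l (x - y) = tail l x - tail l y"
  and tail_scale: "tail l (\<lambda>j. c * x j) = (\<lambda>j. c * tail l x j)"
  by (auto simp: tail_def fun_eq_iff)

lemma modulus_apply [simp]: "modulus x j = complex_of_real (cmod (x j))"
  by (simp add: modulus_def)

lemma sum_seq_apply: "(\<Sum>i\<in>I. (g i :: seq)) j = (\<Sum>i\<in>I. g i j)"
  by (induction I rule: infinite_finite_induct) auto

locale seq_space =
  fixes R :: "nat set" and L :: "seq set" and nrm :: "seq \<Rightarrow> real"
  assumes class_L: "class_L R L nrm"
begin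

lemmas banach = class_L[unfolded class_L_def, THEN conjunct1, unfolded banach_seq_space_def]

lemma vanish: "x \<in> L \<Longrightarrow> j \<notin> R \<Longrightarrow> x j = 0"
  using banach[THEN conjunct2, THEN conjunct1] by simp

lemma zero_in: "0 \<in> L"
  using banach[THEN conjunct2, THEN conjunct2, THEN conjunct1] by simp

lemma add_in: "x \<in> L \<Longrightarrow> y \<in> L \<Longrightarrow> x + y \<in> L"
  using banach[THEN conjunct2, THEN conjunct2, THEN conjunct2, THEN conjunct1] by simp

lemma scale_in: "x \<in> L \<Longrightarrow> (\<lambda>j. c * x j) \<in> L"
  using banach[THEN conjunct2, THEN conjunct2, THEN conjunct2, THEN conjunct2, THEN conjunct1] by simp

lemma nrm_nonneg_eq_0: "x \<in> L \<Longrightarrow> nrm x \<ge> 0 \<and> (nrm x = 0 \<longleftrightarrow> x = 0)"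
  using banach[THEN conjunct2, THEN conjunct2, THEN conjunct2, THEN conjunct2, THEN conjunct2, THEN conjunct1] by simp

lemma nrm_scale: "x \<in> L \<Longrightarrow> nrm (\<lambda>j. c * x j) = cmod c * nrm x"
  using banach[THEN conjunct2, THEN conjunct2, THEN conjunct2, THEN conjunct2, THEN conjunct2, THEN conjunct2, THEN conjunct1] by simp

lemma nrm_add: "x \<in> L \<Longrightarrow> y \<in> L \<Longrightarrow> nrm (x + y) \<le> nrm x + nrm y"
  using banach[THEN conjunct2, THEN conjunct2, THEN conjunct2, THEN conjunct2, THEN conjunct2, THEN conjunct2, THEN conjunct2, THEN conjunct1] by simp

lemma complete: "(\<And>k. s k \<in> L) \<Longrightarrow> (\<And>e. e > 0 \<Longrightarrow> \<exists>K. \<forall>p\<ge>K. \<forall>q\<ge>K. nrm (s p - s q) < e)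
    \<Longrightarrow> \<exists>y\<in>L. (\<lambda>k. nrm (s k - y)) \<longlonglongrightarrow> 0"
  using banach[THEN conjunct2, THEN conjunct2, THEN conjunct2, THEN conjunct2, THEN conjunct2, THEN conjunct2, THEN conjunct2, THEN conjunct2, THEN conjunct1] by simp

lemma solid: "y \<in> L \<Longrightarrow> (\<And>j. cmod (x j) \<le> cmod (y j)) \<Longrightarrow> x \<in> L \<and> nrm x \<le> nrm y"
  using banach[THEN conjunct2, THEN conjunct2, THEN conjunct2, THEN conjunct2, THEN conjunct2, THEN conjunct2, THEN conjunct2, THEN conjunct2, THEN conjunct2] by blast

lemma nrm_nonneg: "x \<in> L \<Longrightarrow> nrm x \<ge> 0" and nrm_eq_0: "x \<in> L \<Longrightarrow> nrm x = 0 \<longleftrightarrow> x = 0"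
  using nrm_nonneg_eq_0 by auto

lemma unit_in: "n \<in> R \<Longrightarrow> unit_vec n \<in> L"
  and nrm_unit: "n \<in> R \<Longrightarrow> nrm (unit_vec n) = 1"
  using class_L by (auto simp: class_L_def)

lemma uminus_in: "x \<in> L \<Longrightarrow> - x \<in> L"
  using scale_in[of x "-1"] by (simp add: fun_Compl_def)

lemma nrm_uminus: "x \<in> L \<Longrightarrow> nrm (- x) = nrm x"
  using nrm_scale[of x "-1"] by (simp add: fun_Compl_def)

lemma diff_in: "x \<in> L \<Longrightarrow> y \<in> L \<Longrightarrow> x - y \<in> L"
  using add_in[of x "-y"] uminus_in[of y] by simp

lemma nrm_diff: "x \<in> L \<Longrightarrow> y \<in> L \<Longrightarrow> nrm (x - y) \<le> nrm x + nrm y"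
  using nrm_add[of x "-y"] uminus_in[of y] nrm_uminus[of y] by simp

lemma nrm_diff_commute: "x \<in> L \<Longrightarrow> y \<in> L \<Longrightarrow> nrm (x - y) = nrm (y - x)"
  using nrm_uminus[of "x - y"] diff_in[of x y] by simp

lemma nrm_triangle: "x \<in> L \<Longrightarrow> y \<in> L \<Longrightarrow> z \<in> L \<Longrightarrow> nrm (x - z) \<le> nrm (x - y) + nrm (y - z)"
  using nrm_add[of "x - y" "y - z"] diff_in[of x y] diff_in[of y z] by simp

lemma nrm_zero [simp]: "nrm 0 = 0"
  using nrm_eq_0 zero_in by blast

lemma sum_in: "(\<And>i. i \<in> I \<Longrightarrow> g i \<in> L) \<Longrightarrow> sum g I \<in> L"
  by (induction I rule: infinite_finite_induct) (auto intro: add_in zero_in)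

lemma nrm_sum: "(\<And>i. i \<in> I \<Longrightarrow> g i \<in> L) \<Longrightarrow> nrm (sum g I) \<le> (\<Sum>i\<in>I. nrm (g i))"
proof (induction I rule: infinite_finite_induct)
  case (insert i I)
  then have "nrm (g i + sum g I) \<le> nrm (g i) + nrm (sum g I)"
    by (intro nrm_add sum_in) auto
  also have "\<dots> \<le> nrm (g i) + (\<Sum>i\<in>I. nrm (g i))"
    using insert by simp
  finally show ?case unfolding sum.insert[OF insert.hyps] .
qed auto

lemma solid_in: "y \<in> L \<Longrightarrow> (\<And>j. cmod (x j) \<le> cmod (y j)) \<Longrightarrow> x \<in> L"
  by (rule solid[THEN conjunct1])

lemma nrm_mono: "y \<in> L \<Longrightarrow> (\<And>j. cmod (x j) \<le> cmod (y j)) \<Longrightarrow> nrm x \<le> nrm y"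
  by (rule solid[THEN conjunct2])

lemma modulus_in: "x \<in> L \<Longrightarrow> modulus x \<in> L"
  by (rule solid_in) auto

lemma nrm_modulus: "x \<in> L \<Longrightarrow> nrm (modulus x) = nrm x"
  by (rule antisym; rule nrm_mono) (auto intro: modulus_in)

lemma tail_in: "x \<in> L \<Longrightarrow> tail l x \<in> L"
  by (rule solid_in) (auto simp: tail_def)

lemma nrm_tail_le: "x \<in> L \<Longrightarrow> nrm (tail l x) \<le> nrm x"
  by (rule nrm_mono) (auto simp: tail_def)

lemma nrm_tail_antimono: "x \<in> L \<Longrightarrow> k \<le> l \<Longrightarrow> nrm (tail l x) \<le> nrm (tail k x)"
  by (rule nrm_mono[OF tail_in]) (auto simp: tail_def)

text \<open>By solidity the vector with the single coordinate \<open>x j\<close> has norm at most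
  that of \<open>x\<close>, and unit vectors have norm one. Norm convergence thus implies
  coordinatewise convergence.\<close>

lemma coord_le: assumes x: "x \<in> L" shows "cmod (x j) \<le> nrm x"
proof (cases "j \<in> R")
  case True
  have "nrm (\<lambda>i. x j * unit_vec j i) \<le> nrm x"
    by (rule nrm_mono[OF x]) (auto simp: unit_vec_def)
  then show ?thesis using nrm_scale[OF unit_in[OF True]] nrm_unit[OF True] by simp
next
  case False
  then show ?thesis using nrm_nonneg[OF x] vanish[OF x] by simp
qed

lemma nrm_tendsto_coord:
  assumes "\<And>k. s k \<in> L" "y \<in> L" "(\<lambda>k. nrm (s k - y)) \<longlonglongrightarrow> 0"
  shows "(\<lambda>k. s k j) \<longlonglongrightarrow> y j"
proof -
  have "(\<lambda>k. s k j - y j) \<longlonglongrightarrow> 0"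
    by (rule Lim_null_comparison[OF _ assms(3)])
      (use coord_le[OF diff_in[OF assms(1,2)], of _ j] in auto)
  then show ?thesis by (simp add: LIM_zero_iff)
qed

lemma head_expansion: assumes "x \<in> L"
  shows "x - tail l x = (\<Sum>j\<in>{..<l} \<inter> R. (\<lambda>i. x j * unit_vec j i))"
proof
  fix i
  have "(\<Sum>j\<in>{..<l} \<inter> R. (\<lambda>i. x j * unit_vec j i)) i = (\<Sum>j\<in>{..<l} \<inter> R. if j = i then x j else 0)"
    unfolding sum_seq_apply by (rule sum.cong) (auto simp: unit_vec_def)
  also have "\<dots> = (if i \<in> {..<l} \<inter> R then x i else 0)"
    by (rule sum.delta) simp
  finally show "(x - tail l x) i = (\<Sum>j\<in>{..<l} \<inter> R. (\<lambda>i. x j * unit_vec j i)) i"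
    using vanish[OF assms] by (auto simp: tail_def)
qed

subsection \<open>Operators defined by nonnegative matrices\<close>

abbreviation ap :: "mat \<Rightarrow> seq \<Rightarrow> seq" where "ap \<equiv> mat_apply R"

text \<open>The constant is part of the notion because sets of matrices need a common bound;
  automatic continuity of positive operators never has to be invoked.\<close>

definition op_bound :: "real \<Rightarrow> mat \<Rightarrow> bool" where
  "op_bound M A \<longleftrightarrow> nonneg_mat R A \<and> defines_op R L A \<and> 0 \<le> M \<and> (\<forall>x\<in>L. nrm (ap A x) \<le> M * nrm x)"

definition pos_op :: "mat \<Rightarrow> bool" where
  "pos_op A \<longleftrightarrow> (\<exists>M. op_bound M A)"

lemma pos_opE: assumes "pos_op A" obtains M where "op_bound M A" "0 \<le> M"
  using assms unfolding pos_op_def op_bound_def by blast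

lemma pos_op_nonneg: "pos_op A \<Longrightarrow> i \<in> R \<Longrightarrow> j \<in> R \<Longrightarrow> 0 \<le> A i j"
  by (auto simp: pos_op_def op_bound_def nonneg_mat_def)

lemma pos_op_summable: "pos_op A \<Longrightarrow> x \<in> L \<Longrightarrow> i \<in> R \<Longrightarrow> (\<lambda>j. A i j * cmod (x j)) summable_on R"
  by (auto simp: pos_op_def op_bound_def defines_op_def)

lemma pos_op_abs_summable:
  assumes "pos_op A" "x \<in> L" "i \<in> R"
  shows "(\<lambda>j. complex_of_real (A i j) * x j) abs_summable_on R"
proof -
  have "(\<lambda>j. norm (complex_of_real (A i j) * x j)) summable_on R \<longleftrightarrow> (\<lambda>j. A i j * cmod (x j)) summable_on R"
    by (rule summable_on_cong) (use assms pos_op_nonneg in \<open>auto simp: norm_mult\<close>)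
  then show ?thesis using pos_op_summable[OF assms] by simp
qed

lemma pos_op_csummable:
  assumes "pos_op A" "x \<in> L" "i \<in> R"
  shows "(\<lambda>j. complex_of_real (A i j) * x j) summable_on R"
  by (rule abs_summable_summable[OF pos_op_abs_summable[OF assms]])

lemma ap_in: "pos_op A \<Longrightarrow> x \<in> L \<Longrightarrow> ap A x \<in> L"
  by (auto simp: pos_op_def op_bound_def defines_op_def)

lemma op_boundD: "op_bound M A \<Longrightarrow> x \<in> L \<Longrightarrow> nrm (ap A x) \<le> M * nrm x"
  by (auto simp: op_bound_def)

lemma op_bound_pos_op: "op_bound M A \<Longrightarrow> pos_op A"
  by (auto simp: pos_op_def)

lemma ap_add: assumes "pos_op A" "x \<in> L" "y \<in> L" shows "ap A (x + y) = ap A x + ap A y"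
proof
  fix i show "ap A (x + y) i = (ap A x + ap A y) i"
    using infsum_add[OF pos_op_csummable[OF assms(1,2), of i] pos_op_csummable[OF assms(1,3), of i]]
    by (auto simp: mat_apply_def distrib_left)
qed

lemma ap_scale: "ap A (\<lambda>j. c * x j) = (\<lambda>j. c * ap A x j)"
proof
  fix i show "ap A (\<lambda>j. c * x j) i = c * ap A x i"
    using infsum_cmult_right'[of c "\<lambda>j. complex_of_real (A i j) * x j" R]
    by (auto simp: mat_apply_def mult.left_commute)
qed

lemma ap_zero [simp]: "ap A 0 = 0"
  by (auto simp: mat_apply_def fun_eq_iff)

lemma ap_diff: assumes "pos_op A" "x \<in> L" "y \<in> L" shows "ap A (x - y) = ap A x - ap A y"
proof -
  have "ap A (x - y) + ap A y = ap A x"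
    using ap_add[OF assms(1) diff_in[OF assms(2,3)] assms(3)] by simp
  then show ?thesis by (simp add: algebra_simps)
qed

lemma ap_sum:
  assumes "pos_op A" "\<And>i. i \<in> I \<Longrightarrow> g i \<in> L"
  shows "ap A (sum g I) = (\<Sum>i\<in>I. ap A (g i))"
  using assms(2)
proof (induction I rule: infinite_finite_induct)
  case (insert i I)
  have "ap A (g i + sum g I) = ap A (g i) + ap A (sum g I)"
    using insert.prems by (intro ap_add assms(1) sum_in) auto
  moreover have "ap A (sum g I) = (\<Sum>i\<in>I. ap A (g i))"
    using insert.prems by (intro insert.IH) auto
  ultimately show ?case
    by (simp only: sum.insert[OF insert.hyps])
qed auto

lemma ap_modulus:
  assumes "pos_op A" "x \<in> L" "i \<in> R"
  shows "ap A (modulus x) i = complex_of_real (\<Sum>\<^sub>\<infinity>j\<in>R. A i j * cmod (x j))"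
proof -
  have "(\<Sum>\<^sub>\<infinity>j\<in>R. complex_of_real (A i j * cmod (x j))) = complex_of_real (\<Sum>\<^sub>\<infinity>j\<in>R. A i j * cmod (x j))"
    by (rule infsum_of_real)
  then show ?thesis using assms(3) by (simp add: mat_apply_def)
qed

lemma infsum_entry_nonneg:
  "pos_op A \<Longrightarrow> i \<in> R \<Longrightarrow> 0 \<le> (\<Sum>\<^sub>\<infinity>j\<in>R. A i j * cmod (x j))"
  by (rule infsum_nonneg) (use pos_op_nonneg in auto)

text \<open>Restricted to \<open>R\<close> because nothing is known about entries elsewhere and
  \<open>ap\<close> does not read them.\<close>

definition mat_le :: "mat \<Rightarrow> mat \<Rightarrow> bool" (infix "\<sqsubseteq>" 50) where
  "A \<sqsubseteq> B \<longleftrightarrow> (\<forall>i\<in>R. \<forall>j\<in>R. A i j \<le> B i j)"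

lemma mat_le_trans: "A \<sqsubseteq> B \<Longrightarrow> B \<sqsubseteq> C \<Longrightarrow> A \<sqsubseteq> C"
  unfolding mat_le_def by (meson order_trans)

lemma mat_le_refl [simp]: "A \<sqsubseteq> A"
  by (simp add: mat_le_def)

lemma mat_le_summable:
  assumes "nonneg_mat R A" "A \<sqsubseteq> B" "pos_op B" "x \<in> L" "i \<in> R"
  shows "(\<lambda>j. A i j * cmod (x j)) summable_on R"
  by (rule summable_on_comparison_test[OF pos_op_summable[OF assms(3-5)]])
    (use assms in \<open>auto simp: mat_le_def nonneg_mat_def intro: mult_right_mono\<close>)

lemma cmod_ap_le_of_mat_le:
  assumes "nonneg_mat R A" "A \<sqsubseteq> B" "pos_op B" "x \<in> L"
  shows "cmod (ap A x i) \<le> cmod (ap B (modulus x) i)"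
proof (cases "i \<in> R")
  case True
  have s: "(\<lambda>j. A i j * cmod (x j)) summable_on R" using mat_le_summable[OF assms True] .
  have eq: "\<And>j. j \<in> R \<Longrightarrow> cmod (complex_of_real (A i j) * x j) = A i j * cmod (x j)"
    using assms(1) True by (auto simp: norm_mult nonneg_mat_def)
  have abs: "(\<lambda>j. complex_of_real (A i j) * x j) abs_summable_on R"
    using s eq by (subst summable_on_cong) auto
  have "cmod (ap A x i) \<le> (\<Sum>\<^sub>\<infinity>j\<in>R. cmod (complex_of_real (A i j) * x j))"
    using norm_infsum_bound[OF abs] True by (simp add: mat_apply_def)
  also have "\<dots> = (\<Sum>\<^sub>\<infinity>j\<in>R. A i j * cmod (x j))"
    by (rule infsum_cong) (use eq in auto)
  also have "\<dots> \<le> (\<Sum>\<^sub>\<infinity>j\<in>R. B i j * cmod (x j))"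
    by (rule infsum_mono[OF s pos_op_summable[OF assms(3,4) True]])
      (use assms True in \<open>auto simp: mat_le_def intro: mult_right_mono\<close>)
  finally show ?thesis using ap_modulus[OF assms(3,4) True] infsum_entry_nonneg[OF assms(3) True] by simp
qed (simp add: mat_apply_def)

lemma op_bound_mat_le:
  assumes "nonneg_mat R A" "A \<sqsubseteq> B" "op_bound M B"
  shows "op_bound M A"
proof -
  have B: "pos_op B" using assms(3) by (rule op_bound_pos_op)
  have le: "ap A x \<in> L \<and> nrm (ap A x) \<le> nrm (ap B (modulus x))" if "x \<in> L" for x
    using solid[OF ap_in[OF B modulus_in[OF that]] cmod_ap_le_of_mat_le[OF assms(1,2) B that]] .
  have "nrm (ap A x) \<le> M * nrm x" if "x \<in> L" for x
    using le[OF that] op_boundD[OF assms(3) modulus_in[OF that]] nrm_modulus[OF that] by simp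
  then show ?thesis unfolding op_bound_def
    using assms le mat_le_summable[OF assms(1,2) B] by (auto simp: defines_op_def op_bound_def)
qed

lemma pos_op_mat_le: "nonneg_mat R A \<Longrightarrow> A \<sqsubseteq> B \<Longrightarrow> pos_op B \<Longrightarrow> pos_op A"
  unfolding pos_op_def using op_bound_mat_le by blast

lemma ap_unit: assumes "j \<in> R" "i \<in> R" shows "ap A (unit_vec j) i = complex_of_real (A i j)"
proof -
  have "(\<Sum>\<^sub>\<infinity>k\<in>R. complex_of_real (A i k) * unit_vec j k) = (\<Sum>\<^sub>\<infinity>k\<in>{j}. complex_of_real (A i k) * unit_vec j k)"
    by (rule infsum_cong_neutral) (use assms in \<open>auto simp: unit_vec_def\<close>)
  then show ?thesis using assms by (simp add: mat_apply_def unit_vec_def)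
qed

text \<open>Apply the matrix to a unit vector, of norm one, and read off one coordinate. This is
  what allows matrices to be scaled so that all their entries lie in the unit interval.\<close>

lemma entry_le: assumes "op_bound M A" "i \<in> R" "j \<in> R" shows "A i j \<le> M"
proof -
  have "cmod (ap A (unit_vec j) i) \<le> M"
    using coord_le[OF ap_in[OF op_bound_pos_op[OF assms(1)] unit_in[OF assms(3)]], of i]
      op_boundD[OF assms(1) unit_in[OF assms(3)]] nrm_unit[OF assms(3)] by simp
  then show ?thesis by (simp add: ap_unit[OF assms(3,2)])
qed

section \<open>Products of matrices as compositions of operators\<close>

lemma mat_mult_summable:
  assumes "pos_op A" "pos_op B" "i \<in> R" "j \<in> R"
  shows "(\<lambda>k. A i k * B k j) summable_on R"
proof -
  have "(\<lambda>k. A i k * cmod (ap B (unit_vec j) k)) summable_on R \<longleftrightarrow> (\<lambda>k. A i k * B k j) summable_on R"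
    by (rule summable_on_cong) (use assms pos_op_nonneg[OF assms(2)] in \<open>auto simp: ap_unit\<close>)
  then show ?thesis
    using pos_op_summable[OF assms(1) ap_in[OF assms(2) unit_in[OF assms(4)]] assms(3)] by simp
qed

lemma mat_mult_nonneg: "pos_op A \<Longrightarrow> pos_op B \<Longrightarrow> i \<in> R \<Longrightarrow> j \<in> R \<Longrightarrow> 0 \<le> mat_mult R A B i j"
  unfolding mat_mult_def by (rule infsum_nonneg) (auto intro!: mult_nonneg_nonneg pos_op_nonneg)

text \<open>Fubini. The double family is absolutely summable because applying \<open>B\<close> and
  then \<open>A\<close> to \<open>modulus x\<close> stays inside the space. Summing the same
  absolute values in the other order gives summability of the rows of the product.\<close>

lemma mult_apply:
  assumes A: "pos_op A" and B: "pos_op B" and x: "x \<in> L"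
  shows "ap (mat_mult R A B) x = ap A (ap B x)"
    and "i \<in> R \<Longrightarrow> (\<lambda>j. mat_mult R A B i j * cmod (x j)) summable_on R"
proof -
  have main: "(\<Sum>\<^sub>\<infinity>j\<in>R. complex_of_real (mat_mult R A B i j) * x j) = (\<Sum>\<^sub>\<infinity>k\<in>R. complex_of_real (A i k) * ap B x k)
     \<and> (\<lambda>j. mat_mult R A B i j * cmod (x j)) summable_on R"
    if i: "i \<in> R" for i
  proof -
    let ?f = "\<lambda>(k, j). complex_of_real (A i k * B k j) * x j"
    have nf: "norm (?f (k, j)) = A i k * (B k j * cmod (x j))" if "k \<in> R" "j \<in> R" for k j
      using that i pos_op_nonneg[OF A] pos_op_nonneg[OF B] by (auto simp: norm_mult)
    have inner: "(\<Sum>\<^sub>\<infinity>j\<in>R. norm (?f (k, j))) = A i k * cmod (ap B (modulus x) k)" if k: "k \<in> R" for k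
    proof -
      have "(\<Sum>\<^sub>\<infinity>j\<in>R. norm (?f (k, j))) = (\<Sum>\<^sub>\<infinity>j\<in>R. A i k * (B k j * cmod (x j)))"
        by (rule infsum_cong) (use nf k in auto)
      also have "\<dots> = A i k * (\<Sum>\<^sub>\<infinity>j\<in>R. B k j * cmod (x j))"
        by (rule infsum_cmult_right')
      finally show ?thesis
        using ap_modulus[OF B x k] infsum_entry_nonneg[OF B k, of x] by simp
    qed
    have abs: "?f abs_summable_on R \<times> R"
    proof (rule Infinite_Sum.abs_summable_on_Sigma_iff[THEN iffD2], intro conjI ballI)
      fix k assume k: "k \<in> R"
      have "(\<lambda>j. norm (?f (k, j))) summable_on R \<longleftrightarrow> (\<lambda>j. A i k * (B k j * cmod (x j))) summable_on R"
        by (rule summable_on_cong) (use nf k in auto)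
      then show "(\<lambda>j. ?f (k, j)) abs_summable_on R"
        using summable_on_cmult_right[OF pos_op_summable[OF B x k]] by simp
    next
      have "(\<lambda>k. norm (\<Sum>\<^sub>\<infinity>j\<in>R. norm (?f (k, j)))) summable_on R \<longleftrightarrow> (\<lambda>k. A i k * cmod (ap B (modulus x) k)) summable_on R"
        by (rule summable_on_cong) (use inner i pos_op_nonneg[OF A] in auto)
      then show "(\<lambda>k. \<Sum>\<^sub>\<infinity>j\<in>R. norm (?f (k, j))) abs_summable_on R"
        using pos_op_summable[OF A ap_in[OF B modulus_in[OF x]] i] by simp
    qed
    have sw: "(\<Sum>\<^sub>\<infinity>k\<in>R. \<Sum>\<^sub>\<infinity>j\<in>R. ?f (k, j)) = (\<Sum>\<^sub>\<infinity>j\<in>R. \<Sum>\<^sub>\<infinity>k\<in>R. ?f (k, j))"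
      using infsum_swap_banach[of "\<lambda>k j. ?f (k, j)" R R] abs_summable_summable[OF abs] by simp
    have l: "(\<Sum>\<^sub>\<infinity>j\<in>R. ?f (k, j)) = complex_of_real (A i k) * ap B x k" if "k \<in> R" for k
      using that infsum_cmult_right'[of "complex_of_real (A i k)" "\<lambda>j. complex_of_real (B k j) * x j" R]
      by (simp add: mat_apply_def mult.assoc)
    have r: "(\<Sum>\<^sub>\<infinity>k\<in>R. ?f (k, j)) = complex_of_real (mat_mult R A B i j) * x j" for j
    proof -
      have "(\<Sum>\<^sub>\<infinity>k\<in>R. ?f (k, j)) = (\<Sum>\<^sub>\<infinity>k\<in>R. complex_of_real (A i k * B k j)) * x j"
        using infsum_cmult_left'[of "\<lambda>k. complex_of_real (A i k * B k j)" "x j" R] by simp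
      then show ?thesis
        using infsum_of_real[of "\<lambda>k. A i k * B k j" R] by (simp add: mat_mult_def)
    qed
    have abs': "(\<lambda>(j, k). ?f (k, j)) abs_summable_on R \<times> R"
      using abs by (subst (asm) product_swap[symmetric], subst (asm) summable_on_reindex)
        (auto simp: o_def case_prod_unfold inj_on_def)
    have "(\<lambda>j. \<Sum>\<^sub>\<infinity>k\<in>R. norm (?f (k, j))) abs_summable_on R"
      using abs' unfolding Infinite_Sum.abs_summable_on_Sigma_iff by simp
    moreover have "(\<Sum>\<^sub>\<infinity>k\<in>R. norm (?f (k, j))) = mat_mult R A B i j * cmod (x j)" if j: "j \<in> R" for j
    proof -
      have "(\<Sum>\<^sub>\<infinity>k\<in>R. norm (?f (k, j))) = (\<Sum>\<^sub>\<infinity>k\<in>R. (A i k * B k j) * cmod (x j))"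
        by (rule infsum_cong) (use nf j in auto)
      then show ?thesis unfolding mat_mult_def
        using infsum_cmult_left'[of "\<lambda>k. A i k * B k j" "cmod (x j)" R] by simp
    qed
    ultimately have "(\<lambda>j. mat_mult R A B i j * cmod (x j)) abs_summable_on R"
      by (subst (asm) summable_on_cong) auto
    then have "(\<lambda>j. mat_mult R A B i j * cmod (x j)) summable_on R"
      by (rule abs_summable_summable)
    moreover have "(\<Sum>\<^sub>\<infinity>k\<in>R. \<Sum>\<^sub>\<infinity>j\<in>R. ?f (k, j)) = (\<Sum>\<^sub>\<infinity>k\<in>R. complex_of_real (A i k) * ap B x k)"
      by (rule infsum_cong) (rule l)
    ultimately show ?thesis using sw r by (metis (no_types, lifting) infsum_cong)
  qed
  show "ap (mat_mult R A B) x = ap A (ap B x)"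
  proof
    fix i show "ap (mat_mult R A B) x i = ap A (ap B x) i"
      using main[of i] by (cases "i \<in> R") (simp_all add: mat_apply_def[of R A] mat_apply_def[of R "mat_mult R A B"])
  qed
  show "i \<in> R \<Longrightarrow> (\<lambda>j. mat_mult R A B i j * cmod (x j)) summable_on R" using main by blast
qed

lemma op_bound_mult:
  assumes "op_bound M A" "op_bound N B"
  shows "op_bound (M * N) (mat_mult R A B)"
proof -
  have A: "pos_op A" and B: "pos_op B" using assms op_bound_pos_op by auto
  have "nrm (ap A (ap B x)) \<le> M * N * nrm x" if "x \<in> L" for x
  proof -
    have "nrm (ap A (ap B x)) \<le> M * nrm (ap B x)" by (rule op_boundD[OF assms(1) ap_in[OF B that]])
    also have "\<dots> \<le> M * (N * nrm x)"
      using assms by (intro mult_left_mono op_boundD that) (auto simp: op_bound_def)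
    finally show ?thesis by (simp add: mult.assoc)
  qed
  then show ?thesis unfolding op_bound_def
    using mult_apply[OF A B] ap_in[OF A ap_in[OF B]] mat_mult_nonneg[OF A B] assms
    by (auto simp: defines_op_def nonneg_mat_def op_bound_def)
qed

lemma pos_op_mult: "pos_op A \<Longrightarrow> pos_op B \<Longrightarrow> pos_op (mat_mult R A B)"
  unfolding pos_op_def using op_bound_mult by blast

lemma mat_mult_mono:
  assumes "pos_op A" "pos_op B" "pos_op C" "pos_op D" "A \<sqsubseteq> C" "B \<sqsubseteq> D"
  shows "mat_mult R A B \<sqsubseteq> mat_mult R C D"
  unfolding mat_le_def mat_mult_def
  by (intro ballI infsum_mono mat_mult_summable mult_mono)
    (use assms pos_op_nonneg in \<open>auto simp: mat_le_def\<close>)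

text \<open>Both products act on a unit vector as the same composition of operators, so no further
  interchange of sums is needed.\<close>

lemma mat_mult_assoc:
  assumes "pos_op A" "pos_op B" "pos_op C" "i \<in> R" "j \<in> R"
  shows "mat_mult R (mat_mult R A B) C i j = mat_mult R A (mat_mult R B C) i j"
proof -
  have u: "unit_vec j \<in> L" using assms unit_in by blast
  have "ap (mat_mult R (mat_mult R A B) C) (unit_vec j) = ap (mat_mult R A (mat_mult R B C)) (unit_vec j)"
    using u by (simp add: mult_apply assms pos_op_mult ap_in)
  then show ?thesis using ap_unit[OF assms(5,4)] by (metis of_real_eq_iff)
qed

lemma ident_apply: assumes "x \<in> L" shows "ap (ident_mat R) x = x"
proof
  fix i
  show "ap (ident_mat R) x i = x i"
  proof (cases "i \<in> R")
    case True
    have "(\<Sum>\<^sub>\<infinity>k\<in>R. complex_of_real (ident_mat R i k) * x k) = (\<Sum>\<^sub>\<infinity>k\<in>{i}. complex_of_real (ident_mat R i k) * x k)"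
      by (rule infsum_cong_neutral) (use True in \<open>auto simp: ident_mat_def\<close>)
    then show ?thesis using True by (simp add: mat_apply_def ident_mat_def)
  qed (use vanish assms in \<open>auto simp: mat_apply_def\<close>)
qed

lemma op_bound_ident: "op_bound 1 (ident_mat R)"
proof -
  have "(\<lambda>j. ident_mat R i j * cmod (x j)) summable_on R" if "i \<in> R" for i x
  proof -
    have "(\<lambda>j. ident_mat R i j * cmod (x j)) summable_on R \<longleftrightarrow> (\<lambda>j. ident_mat R i j * cmod (x j)) summable_on {i}"
      by (rule summable_on_cong_neutral) (use that in \<open>auto simp: ident_mat_def\<close>)
    then show ?thesis by simp
  qed
  then show ?thesis unfolding op_bound_def using ident_apply
    by (auto simp: nonneg_mat_def ident_mat_def defines_op_def)
qed

lemma pos_op_ident: "pos_op (ident_mat R)"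
  using op_bound_ident op_bound_pos_op by blast

lemma mat_mult_ident:
  assumes "i \<in> R" "j \<in> R"
  shows "mat_mult R A (ident_mat R) i j = A i j" "mat_mult R (ident_mat R) A i j = A i j"
proof -
  have "mat_mult R A (ident_mat R) i j = (\<Sum>\<^sub>\<infinity>k\<in>{j}. A i k * ident_mat R k j)"
    unfolding mat_mult_def by (rule infsum_cong_neutral) (use assms in \<open>auto simp: ident_mat_def\<close>)
  then show "mat_mult R A (ident_mat R) i j = A i j" using assms by (simp add: ident_mat_def)
  have "mat_mult R (ident_mat R) A i j = (\<Sum>\<^sub>\<infinity>k\<in>{i}. ident_mat R i k * A k j)"
    unfolding mat_mult_def by (rule infsum_cong_neutral) (use assms in \<open>auto simp: ident_mat_def\<close>)
  then show "mat_mult R (ident_mat R) A i j = A i j" using assms by (simp add: ident_mat_def)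
qed

end

subsection \<open>The measure of noncompactness\<close>

text \<open>Order continuity of the norm is used in this sequential form;
  \<open>oc_seq_space_intro\<close> derives it.\<close>

locale oc_seq_space = seq_space +
  assumes tail_tendsto: "x \<in> L \<Longrightarrow> (\<lambda>l. nrm (tail l x)) \<longlonglongrightarrow> 0"
begin

text \<open>The finitely many centres have uniformly small tails for large \<open>l\<close>, and
  cutting off a head does not increase the distance to a centre.\<close>

lemma cover_imp_tail:
  assumes F: "finite F" "F \<subseteq> L" and B: "B \<subseteq> L" "B \<subseteq> (\<Union>c\<in>F. {x. nrm (x - c) \<le> e})" and \<epsilon>: "\<epsilon> > 0"
  shows "\<forall>\<^sub>F l in sequentially. \<forall>x\<in>B. nrm (tail l x) \<le> e + \<epsilon>"
proof -
  have "\<forall>\<^sub>F l in sequentially. \<forall>c\<in>F. nrm (tail l c) < \<epsilon>"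
    using F tail_tendsto \<epsilon> by (intro eventually_ball_finite ballI order_tendstoD(2)) auto
  then show ?thesis
  proof (rule eventually_mono, intro ballI)
    fix l x assume l: "\<forall>c\<in>F. nrm (tail l c) < \<epsilon>" and x: "x \<in> B"
    obtain c where c: "c \<in> F" "nrm (x - c) \<le> e" using B x by blast
    have xL: "x \<in> L" and cL: "c \<in> L" using B F x c by auto
    have "tail l x = tail l (x - c) + tail l c" by (simp add: tail_diff)
    then have "nrm (tail l x) \<le> nrm (tail l (x - c)) + nrm (tail l c)"
      using nrm_add tail_in diff_in xL cL by metis
    also have "\<dots> \<le> e + \<epsilon>"
      using nrm_tail_le[OF diff_in[OF xL cL], of l] c l by fastforce
    finally show "nrm (tail l x) \<le> e + \<epsilon>" .
  qed
qed

lemma nrm_unit_sum_le: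
  assumes "J \<subseteq> R"
  shows "nrm (\<Sum>j\<in>J. (\<lambda>i. c j * unit_vec j i)) \<le> (\<Sum>j\<in>J. cmod (c j))"
proof -
  have "nrm (\<Sum>j\<in>J. (\<lambda>i. c j * unit_vec j i)) \<le> (\<Sum>j\<in>J. nrm (\<lambda>i. c j * unit_vec j i))"
    using assms by (intro nrm_sum scale_in unit_in) auto
  also have "\<dots> = (\<Sum>j\<in>J. cmod (c j))"
    using assms by (intro sum.cong) (auto simp: nrm_scale unit_in nrm_unit subset_iff)
  finally show ?thesis .
qed

text \<open>Converse of \<open>cover_imp_tail\<close>: the heads form a bounded set in a
  finite-dimensional space, so a finite net of the disc of radius \<open>K\<close>, used in each
  head coordinate, yields the centres.\<close>

lemma tail_imp_cover:
  assumes B: "B \<subseteq> L" "\<And>x. x \<in> B \<Longrightarrow> nrm x \<le> K" "\<And>x. x \<in> B \<Longrightarrow> nrm (tail l x) \<le> e" and \<epsilon>: "\<epsilon> > 0"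
  shows "\<exists>F. finite F \<and> F \<subseteq> L \<and> B \<subseteq> (\<Union>c\<in>F. {x. nrm (x - c) \<le> e + \<epsilon>})"
proof -
  define J where "J = {..<l} \<inter> R"
  have J: "finite J" "J \<subseteq> R" by (auto simp: J_def)
  \<comment> \<open>The errors in the \<open>card J\<close> head coordinates add up to at most
    \<open>\<epsilon>\<close>; the \<open>+ 1\<close> avoids division by zero when \<open>J\<close>
    is empty.\<close>
  define \<delta> where "\<delta> = \<epsilon> / (real (card J) + 1)"
  have \<delta>: "\<delta> > 0" using \<epsilon> by (simp add: \<delta>_def)
  obtain G where G: "finite G" "cball (0::complex) K \<subseteq> (\<Union>g\<in>G. ball g \<delta>)"
    using compactE_image[of "cball (0::complex) K" "cball 0 K" "\<lambda>g. ball g \<delta>"] \<delta>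
    by (metis UN_I centre_in_ball compact_cball open_ball subsetI)
  define E where "E c = (\<Sum>j\<in>J. (\<lambda>i. c j * unit_vec j i))" for c :: seq
  have EL: "E c \<in> L" for c unfolding E_def using J by (intro sum_in scale_in unit_in) auto
  show ?thesis
  proof (intro exI[of _ "E ` PiE J (\<lambda>_. G)"] conjI subsetI)
    show "finite (E ` PiE J (\<lambda>_. G))" using J G by (intro finite_imageI finite_PiE) auto
    show "x \<in> L" if "x \<in> E ` PiE J (\<lambda>_. G)" for x using that EL by auto
    fix x assume x: "x \<in> B"
    then have xL: "x \<in> L" using B by blast
    have "\<exists>g\<in>G. x j \<in> ball g \<delta>" for j
      using G(2) coord_le[OF xL, of j] B(2)[OF x] by (auto simp: subset_iff)
    then obtain g where g: "\<And>j. g j \<in> G" "\<And>j. x j \<in> ball (g j) \<delta>" by metis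
    define c where "c = restrict g J"
    have cG: "c \<in> PiE J (\<lambda>_. G)" using g by (auto simp: c_def)
    have eq: "x - E c = tail l x + (\<Sum>j\<in>J. (\<lambda>i. (x j - c j) * unit_vec j i))"
    proof -
      have "x - tail l x = (\<Sum>j\<in>J. (\<lambda>i. x j * unit_vec j i))"
        unfolding J_def by (rule head_expansion[OF xL])
      moreover have "(\<Sum>j\<in>J. (\<lambda>i. x j * unit_vec j i)) - E c = (\<Sum>j\<in>J. (\<lambda>i. (x j - c j) * unit_vec j i))"
        by (rule ext) (simp add: E_def sum_seq_apply sum_subtractf left_diff_distrib)
      ultimately show ?thesis by (metis add_diff_cancel_left' add_diff_eq diff_add_cancel)
    qed
    have "nrm (x - E c) \<le> nrm (tail l x) + nrm (\<Sum>j\<in>J. (\<lambda>i. (x j - c j) * unit_vec j i))"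
      unfolding eq using J by (intro nrm_add tail_in xL sum_in scale_in unit_in) auto
    also have "\<dots> \<le> e + (\<Sum>j\<in>J. cmod (x j - c j))"
      by (intro add_mono B(3)[OF x] nrm_unit_sum_le J)
    also have "(\<Sum>j\<in>J. cmod (x j - c j)) \<le> real (card J) * \<delta>"
      using g by (intro sum_bounded_above) (auto simp: c_def dist_norm norm_minus_commute less_imp_le)
    also have "real (card J) * \<delta> \<le> \<epsilon>" using \<epsilon> by (simp add: \<delta>_def field_simps)
    finally show "x \<in> (\<Union>c\<in>E ` PiE J (\<lambda>_. G). {x. nrm (x - c) \<le> e + \<epsilon>})"
      using cG by auto
  qed
qed

abbreviation \<gamma> :: "mat \<Rightarrow> real" where "\<gamma> \<equiv> gamma_op R L nrm"

text \<open>Says that the part of the matrix in the rows from \<open>l\<close> on has norm at most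
  \<open>e\<close>. By \<open>gamma_le\<close> and \<open>gamma_less_tail_bound\<close>,
  \<open>\<gamma> A\<close> is the infimum of such \<open>e\<close>, and later arguments about
  \<open>\<gamma>\<close> go through these two facts.\<close>

definition tail_bound :: "nat \<Rightarrow> real \<Rightarrow> mat \<Rightarrow> bool" where
  "tail_bound l e A \<longleftrightarrow> (\<forall>x\<in>L. nrm (tail l (ap A x)) \<le> e * nrm x)"

lemma tail_boundD: "tail_bound l e A \<Longrightarrow> x \<in> L \<Longrightarrow> nrm (tail l (ap A x)) \<le> e * nrm x"
  by (simp add: tail_bound_def)

text \<open>Makes the infimum defining \<open>\<gamma>\<close> meaningful: one ball around 0 covers
  the image. The \<open>+ 1\<close> is there because radii must be positive while \<open>M\<close>
  may be 0.\<close>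

lemma gamma_nonempty:
  assumes "op_bound M A"
  shows "M + 1 \<in> {e. e > 0 \<and> (\<exists>F. finite F \<and> F \<subseteq> L \<and> ap A ` {x\<in>L. nrm x \<le> 1} \<subseteq> (\<Union>c\<in>F. {x. nrm (x - c) \<le> e}))}"
proof -
  have M: "M \<ge> 0" using assms by (simp add: op_bound_def)
  have "nrm (ap A x) \<le> M + 1" if "x \<in> L" "nrm x \<le> 1" for x
    using op_boundD[OF assms that(1)] mult_left_mono[OF that(2) M] by simp
  then show ?thesis using M zero_in by (intro CollectI conjI exI[of _ "{0}"]) auto
qed

lemma gamma_nonneg: assumes "pos_op A" shows "0 \<le> \<gamma> A"
proof -
  obtain M where "op_bound M A" using assms by (auto simp: pos_op_def)
  from gamma_nonempty[OF this] show ?thesis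
    unfolding gamma_op_def hausdorff_mnc_def by (intro cInf_greatest) auto
qed

lemma gamma_le:
  assumes A: "pos_op A" and t: "tail_bound l e A" and e: "0 \<le> e"
  shows "\<gamma> A \<le> e"
proof (rule field_le_epsilon)
  fix \<epsilon> :: real assume \<epsilon>: "\<epsilon> > 0"
  obtain M where M: "op_bound M A" "0 \<le> M" using A by (rule pos_opE)
  have "\<exists>F. finite F \<and> F \<subseteq> L \<and> ap A ` {x\<in>L. nrm x \<le> 1} \<subseteq> (\<Union>c\<in>F. {x. nrm (x - c) \<le> e + \<epsilon>})"
  proof (rule tail_imp_cover[OF _ _ _ \<epsilon>])
    show "ap A ` {x\<in>L. nrm x \<le> 1} \<subseteq> L" using ap_in[OF A] by auto
    show "nrm y \<le> M" if "y \<in> ap A ` {x\<in>L. nrm x \<le> 1}" for y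
      using that op_boundD[OF M(1)] mult_left_mono[OF _ M(2)] by fastforce
    show "nrm (tail l y) \<le> e" if "y \<in> ap A ` {x\<in>L. nrm x \<le> 1}" for y
      using that tail_boundD[OF t] mult_left_mono[OF _ e] by fastforce
  qed
  then show "\<gamma> A \<le> e + \<epsilon>"
    unfolding gamma_op_def hausdorff_mnc_def using e \<epsilon>
    by (intro cInf_lower) (auto intro!: bdd_belowI[of _ 0])
qed

lemma tail_boundI:
  assumes A: "pos_op A" and l: "\<And>x. x \<in> L \<Longrightarrow> nrm x \<le> 1 \<Longrightarrow> nrm (tail l (ap A x)) \<le> e"
  shows "tail_bound l e A"
  unfolding tail_bound_def
proof
  fix x assume x: "x \<in> L"
  show "nrm (tail l (ap A x)) \<le> e * nrm x"
  proof (cases "nrm x = 0")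
    case True
    then have "x = 0" using nrm_eq_0 x by simp
    moreover have "tail l 0 = 0" by (auto simp: tail_def)
    ultimately show ?thesis by simp
  next
    case False
    then have pos: "nrm x > 0" using nrm_nonneg[OF x] by simp
    let ?c = "complex_of_real (1 / nrm x)"
    have "nrm (\<lambda>j. ?c * x j) \<le> 1" unfolding nrm_scale[OF x] using pos by (simp add: norm_divide)
    then have "nrm (tail l (ap A (\<lambda>j. ?c * x j))) \<le> e" by (rule l[OF scale_in[OF x]])
    moreover have "nrm (tail l (ap A (\<lambda>j. ?c * x j))) = cmod ?c * nrm (tail l (ap A x))"
      unfolding ap_scale tail_scale by (rule nrm_scale[OF tail_in[OF ap_in[OF A x]]])
    ultimately have "cmod ?c * nrm (tail l (ap A x)) \<le> e" by (simp only:)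
    then have "nrm (tail l (ap A x)) / nrm x \<le> e" using pos by (simp add: norm_divide)
    then show ?thesis using pos by (simp add: field_simps)
  qed
qed

lemma gamma_less_tail_bound:
  assumes A: "pos_op A" and g: "\<gamma> A < e"
  shows "\<forall>\<^sub>F l in sequentially. tail_bound l e A"
proof -
  obtain M where M: "op_bound M A" "0 \<le> M" using A by (rule pos_opE)
  obtain e' F where e': "e' < e" and F: "finite F" "F \<subseteq> L"
      "ap A ` {x\<in>L. nrm x \<le> 1} \<subseteq> (\<Union>c\<in>F. {x. nrm (x - c) \<le> e'})"
    using g cInf_lessD[of _ e] gamma_nonempty[OF M(1)]
    unfolding gamma_op_def hausdorff_mnc_def by (smt (verit) empty_iff mem_Collect_eq)
  have sub: "ap A ` {x\<in>L. nrm x \<le> 1} \<subseteq> L" using ap_in[OF A] by auto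
  have "\<forall>\<^sub>F l in sequentially. \<forall>y\<in>ap A ` {x\<in>L. nrm x \<le> 1}. nrm (tail l y) \<le> e' + (e - e')"
    using e' by (intro cover_imp_tail[OF F(1,2) sub F(3)]) simp
  then show ?thesis
    by (rule eventually_mono) (auto intro!: tail_boundI[OF A])
qed

lemma gamma_le_bound: "op_bound M A \<Longrightarrow> \<gamma> A \<le> M"
proof -
  assume M: "op_bound M A"
  have "tail_bound 0 M A" using op_boundD[OF M] by (simp add: tail_bound_def tail_def)
  then show ?thesis using gamma_le op_bound_pos_op[OF M] M by (auto simp: op_bound_def)
qed

lemma tail_bound_mat_le:
  assumes "nonneg_mat R A" "A \<sqsubseteq> B" "pos_op B" "tail_bound l e B"
  shows "tail_bound l e A"
  unfolding tail_bound_def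
proof
  fix x assume x: "x \<in> L"
  have "nrm (tail l (ap A x)) \<le> nrm (tail l (ap B (modulus x)))"
    by (rule nrm_mono[OF tail_in[OF ap_in[OF assms(3) modulus_in[OF x]]]])
      (use cmod_ap_le_of_mat_le[OF assms(1-3) x] in \<open>auto simp: tail_def\<close>)
  also have "\<dots> \<le> e * nrm x"
    using tail_boundD[OF assms(4) modulus_in[OF x]] nrm_modulus[OF x] by simp
  finally show "nrm (tail l (ap A x)) \<le> e * nrm x" .
qed

lemma gamma_approx:
  assumes "\<And>e. e > b \<Longrightarrow> \<gamma> A \<le> e" shows "\<gamma> A \<le> b"
  using assms dense_ge by blast

lemma gamma_mono:
  assumes "nonneg_mat R A" "A \<sqsubseteq> B" "pos_op B"
  shows "\<gamma> A \<le> \<gamma> B"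
proof (rule gamma_approx)
  fix e assume e: "\<gamma> B < e"
  then obtain l where l: "tail_bound l e B"
    using gamma_less_tail_bound[OF assms(3)] eventually_happens' sequentially_bot by blast
  show "\<gamma> A \<le> e"
    using gamma_le[OF pos_op_mat_le[OF assms] tail_bound_mat_le[OF assms l]] gamma_nonneg[OF assms(3)] e by simp
qed

lemma nrm_tail_ap_head:
  assumes A: "pos_op A" and y: "y \<in> L"
  shows "nrm (tail l (ap A (y - tail k y))) \<le> nrm y * (\<Sum>j\<in>{..<k}\<inter>R. nrm (tail l (ap A (unit_vec j))))"
proof -
  let ?J = "{..<k} \<inter> R"
  have 1: "ap A (y - tail k y) = (\<Sum>j\<in>?J. (\<lambda>i. y j * ap A (unit_vec j) i))"
    unfolding head_expansion[OF y]
    by (subst ap_sum[OF A]) (auto intro: scale_in unit_in simp: ap_scale)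
  have 2: "tail l (\<Sum>j\<in>?J. (\<lambda>i. y j * ap A (unit_vec j) i)) = (\<Sum>j\<in>?J. (\<lambda>i. y j * tail l (ap A (unit_vec j)) i))"
    by (rule ext) (auto simp: tail_def sum_seq_apply)
  have "nrm (tail l (ap A (y - tail k y))) \<le> (\<Sum>j\<in>?J. nrm (\<lambda>i. y j * tail l (ap A (unit_vec j)) i))"
    unfolding 1 2 by (rule nrm_sum) (auto intro: scale_in tail_in ap_in A unit_in)
  also have "\<dots> = (\<Sum>j\<in>?J. cmod (y j) * nrm (tail l (ap A (unit_vec j))))"
    by (intro sum.cong refl nrm_scale) (auto intro: tail_in ap_in A unit_in)
  also have "\<dots> \<le> (\<Sum>j\<in>?J. nrm y * nrm (tail l (ap A (unit_vec j))))"
    by (intro sum_mono mult_right_mono coord_le y nrm_nonneg) (auto intro: tail_in ap_in A unit_in)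
  finally show ?thesis by (simp add: sum_distrib_left)
qed

text \<open>Split \<open>ap B x\<close> at an index \<open>k\<close> beyond which it is at most
  \<open>b\<close> in norm. \<open>A\<close> turns this tail into something with tail at most
  \<open>a * b\<close>, while the head meets only finitely many columns of \<open>A\<close>, whose
  tails vanish as \<open>l\<close> grows (\<open>nrm_tail_ap_head\<close>).\<close>

lemma gamma_mult:
  assumes A: "pos_op A" and B: "pos_op B"
  shows "\<gamma> (mat_mult R A B) \<le> \<gamma> A * \<gamma> B"
proof -
  have main: "\<gamma> (mat_mult R A B) \<le> a * b" if a: "a > \<gamma> A" and b: "b > \<gamma> B" for a b
  proof (rule field_le_epsilon)
    fix \<epsilon> :: real assume \<epsilon>: "\<epsilon> > 0"
    have a0: "a > 0" and b0: "b > 0" using a b gamma_nonneg[OF A] gamma_nonneg[OF B] by auto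
    obtain M where M: "op_bound M B" "0 \<le> M" using B by (rule pos_opE)
    obtain k where k: "tail_bound k b B"
      using gamma_less_tail_bound[OF B b] eventually_happens' sequentially_bot by blast
    let ?s = "\<lambda>l. M * (\<Sum>j\<in>{..<k}\<inter>R. nrm (tail l (ap A (unit_vec j))))"
    have "?s \<longlonglongrightarrow> M * (\<Sum>j\<in>{..<k}\<inter>R. 0)"
      by (intro tendsto_intros tail_tendsto ap_in[OF A] unit_in) auto
    then have "\<forall>\<^sub>F l in sequentially. ?s l < \<epsilon>"
      using \<epsilon> by (intro order_tendstoD(2)) auto
    then obtain l where l: "?s l < \<epsilon>" "tail_bound l a A"
      using eventually_conj[OF _ gamma_less_tail_bound[OF A a]] eventually_happens' sequentially_bot by blast
    have "tail_bound l (a * b + \<epsilon>) (mat_mult R A B)"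
      unfolding tail_bound_def
    proof
      fix x assume x: "x \<in> L"
      define y where "y = ap B x"
      have y: "y \<in> L" unfolding y_def by (rule ap_in[OF B x])
      have eq: "ap A y = ap A (tail k y) + ap A (y - tail k y)"
        using ap_add[OF A tail_in[OF y] diff_in[OF y tail_in[OF y]], of k k] by simp
      have "nrm (tail l (ap A y)) \<le> nrm (tail l (ap A (tail k y))) + nrm (tail l (ap A (y - tail k y)))"
        by (subst eq, subst tail_add) (intro nrm_add tail_in ap_in A diff_in y)
      also have "nrm (tail l (ap A (tail k y))) \<le> a * nrm (tail k y)"
        by (rule tail_boundD[OF l(2) tail_in[OF y]])
      also have "\<dots> \<le> a * (b * nrm x)"
        using a0 tail_boundD[OF k x] by (simp add: y_def)
      also have "nrm (tail l (ap A (y - tail k y))) \<le> nrm y * (\<Sum>j\<in>{..<k}\<inter>R. nrm (tail l (ap A (unit_vec j))))"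
        by (rule nrm_tail_ap_head[OF A y])
      also have "\<dots> \<le> (M * nrm x) * (\<Sum>j\<in>{..<k}\<inter>R. nrm (tail l (ap A (unit_vec j))))"
        unfolding y_def by (intro mult_right_mono op_boundD[OF M(1) x] sum_nonneg nrm_nonneg tail_in ap_in[OF A] unit_in) auto
      also have "\<dots> = ?s l * nrm x" by simp
      also have "\<dots> \<le> \<epsilon> * nrm x" using l nrm_nonneg[OF x] by (intro mult_right_mono) auto
      finally show "nrm (tail l (ap (mat_mult R A B) x)) \<le> (a * b + \<epsilon>) * nrm x"
        by (simp add: mult_apply(1)[OF A B x] y_def algebra_simps)
    qed
    then show "\<gamma> (mat_mult R A B) \<le> a * b + \<epsilon>"
      using gamma_le[OF pos_op_mult[OF A B]] a0 b0 \<epsilon> by simp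
  qed
  have "((\<lambda>t. (\<gamma> A + t) * (\<gamma> B + t)) \<longlongrightarrow> (\<gamma> A + 0) * (\<gamma> B + 0)) (at_right 0)"
    by (intro tendsto_intros)
  moreover have "\<forall>\<^sub>F t in at_right 0. \<gamma> (mat_mult R A B) \<le> (\<gamma> A + t) * (\<gamma> B + t)"
    unfolding eventually_at_right_field by (auto intro!: main exI[of _ 1])
  ultimately show ?thesis
    using tendsto_lowerbound[of _ "(\<gamma> A + 0) * (\<gamma> B + 0)" "at_right (0::real)"] by simp
qed

end

subsection \<open>Fredholm operators\<close>

definition csubspace :: "seq set \<Rightarrow> bool" where
  "csubspace W \<longleftrightarrow> 0 \<in> W \<and> (\<forall>x\<in>W. \<forall>y\<in>W. x + y \<in> W) \<and> (\<forall>c. \<forall>x\<in>W. (\<lambda>j. c * x j) \<in> W)"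

lemma csubspace_zero: "csubspace W \<Longrightarrow> 0 \<in> W"
  and csubspace_add: "csubspace W \<Longrightarrow> x \<in> W \<Longrightarrow> y \<in> W \<Longrightarrow> x + y \<in> W"
  and csubspace_scale: "csubspace W \<Longrightarrow> x \<in> W \<Longrightarrow> (\<lambda>j. c * x j) \<in> W"
  unfolding csubspace_def by blast+

lemma csubspace_uminus: assumes "csubspace W" "x \<in> W" shows "- x \<in> W"
proof -
  have "- x = (\<lambda>j. - 1 * x j)" by auto
  then show ?thesis using csubspace_scale[OF assms, of "- 1"] by metis
qed

lemma csubspace_diff: "csubspace W \<Longrightarrow> x \<in> W \<Longrightarrow> y \<in> W \<Longrightarrow> x - y \<in> W"
  using csubspace_add[of W x "- y"] csubspace_uminus[of W y] by simp

lemma csubspace_sum: "csubspace W \<Longrightarrow> (\<And>i. i \<in> I \<Longrightarrow> g i \<in> W) \<Longrightarrow> sum g I \<in> W"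
  by (induction I rule: infinite_finite_induct) (auto intro: csubspace_add csubspace_zero simp del: plus_fun_apply)

lemma csubspace_Int: "csubspace V \<Longrightarrow> csubspace W \<Longrightarrow> csubspace (V \<inter> W)"
  unfolding csubspace_def by (meson Int_iff)

lemma cspan_iff: "x \<in> cspan F \<longleftrightarrow> (\<exists>c. \<forall>j. x j = (\<Sum>f\<in>F. c f * f j))"
  unfolding cspan_def by (auto simp: fun_eq_iff sum_seq_apply)

lemma csubspace_cspan: "csubspace (cspan F)"
  unfolding csubspace_def
proof (intro conjI ballI allI)
  show "0 \<in> cspan F" unfolding cspan_iff by (rule exI[of _ "\<lambda>_. 0"]) simp
next
  fix x y assume "x \<in> cspan F" "y \<in> cspan F"
  then obtain c d where "\<forall>j. x j = (\<Sum>f\<in>F. c f * f j)" "\<forall>j. y j = (\<Sum>f\<in>F. d f * f j)"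
    unfolding cspan_iff by blast
  then show "x + y \<in> cspan F" unfolding cspan_iff
    by (intro exI[of _ "\<lambda>f. c f + d f"]) (simp add: distrib_right sum.distrib)
next
  fix a x assume "x \<in> cspan F"
  then obtain c where "\<forall>j. x j = (\<Sum>f\<in>F. c f * f j)" unfolding cspan_iff by blast
  then show "(\<lambda>j. a * x j) \<in> cspan F" unfolding cspan_iff
    by (intro exI[of _ "\<lambda>f. a * c f"]) (simp add: sum_distrib_left mult.assoc)
qed

lemma cspan_base: assumes "finite F" "f \<in> F" shows "f \<in> cspan F"
  unfolding cspan_iff
proof (intro exI[of _ "\<lambda>g. if g = f then 1 else 0"] allI)
  fix j
  have "(\<Sum>g\<in>F. (if g = f then 1 else 0) * g j) = (\<Sum>g\<in>F. if g = f then g j else 0)"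
    by (rule sum.cong) auto
  then show "f j = (\<Sum>g\<in>F. (if g = f then 1 else 0) * g j)"
    using assms by simp
qed

text \<open>Vectors of a finite-dimensional space of sequences depend linearly on finitely many of their
  coordinates; this replaces the equivalence of norms in finite dimension.\<close>
lemma finite_dim_coordinates:
  assumes "finite F" "csubspace W" "W \<subseteq> cspan F"
  shows "\<exists>J h. finite J \<and> (\<forall>j\<in>J. h j \<in> W) \<and> (\<forall>x\<in>W. \<forall>i. x i = (\<Sum>j\<in>J. x j * h j i))"
  using assms
proof (induction F arbitrary: W rule: finite_induct)
  case empty
  then have "x = 0" if "x \<in> W" for x using that by (auto simp: cspan_iff fun_eq_iff subset_iff)
  then have "x i = (\<Sum>j\<in>{}. x j * 0)" if "x \<in> W" for x i using that by (metis sum.empty zero_fun_apply)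
  then show ?case by (intro exI[of _ "{}"] exI[of _ "\<lambda>_ _. 0"]) simp
next
  case (insert g F)
  let ?W = "W \<inter> cspan F"
  have "csubspace ?W" by (rule csubspace_Int[OF insert.prems(1) csubspace_cspan])
  from insert.IH[OF this] obtain J h where J: "finite J" and h: "\<And>j. j \<in> J \<Longrightarrow> h j \<in> ?W"
    and rep: "\<And>x i. x \<in> ?W \<Longrightarrow> x i = (\<Sum>j\<in>J. x j * h j i)" by fast
  show ?case
  proof (cases "W \<subseteq> cspan F")
    case True
    then show ?thesis using J h rep by (intro exI[of _ J] exI[of _ h]) auto
  next
    case False
    then obtain w where w: "w \<in> W" "w \<notin> cspan F" by blast
    have dec: "\<exists>a. x - (\<lambda>i. a * g i) \<in> cspan F" if "x \<in> W" for x
    proof -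
      have "x \<in> cspan (insert g F)" using that insert.prems(2) by blast
      then obtain c where c: "\<forall>j. x j = (\<Sum>f\<in>insert g F. c f * f j)"
        unfolding cspan_iff by blast
      then have "x - (\<lambda>i. c g * g i) \<in> cspan F"
        unfolding cspan_iff using insert.hyps by (intro exI[of _ c]) simp
      then show ?thesis by blast
    qed
    obtain b where b: "w - (\<lambda>i. b * g i) \<in> cspan F" using dec[OF w(1)] by blast
    have b0: "b \<noteq> 0"
    proof
      assume "b = 0"
      then have "w - (\<lambda>i. b * g i) = w" by (auto simp: fun_eq_iff)
      then show False using b w by simp
    qed
    \<comment> \<open>Since \<open>w\<close> has a nonzero component \<open>b\<close> along
      \<open>g\<close>, a multiple of \<open>w\<close> removes the \<open>g\<close> component of any
      vector of \<open>W\<close>.\<close>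
    have dec': "\<exists>a. x - (\<lambda>i. a * w i) \<in> ?W" if x: "x \<in> W" for x
    proof -
      obtain a where a: "x - (\<lambda>i. a * g i) \<in> cspan F" using dec[OF x] by blast
      have "x - (\<lambda>i. a / b * w i) = (x - (\<lambda>i. a * g i)) - (\<lambda>i. a / b * (w - (\<lambda>i. b * g i)) i)"
        using b0 by (auto simp: fun_eq_iff field_simps)
      then have "x - (\<lambda>i. a / b * w i) \<in> cspan F"
        using csubspace_diff[OF csubspace_cspan a csubspace_scale[OF csubspace_cspan b]] by metis
      moreover have "x - (\<lambda>i. a / b * w i) \<in> W"
        by (rule csubspace_diff[OF insert.prems(1) x csubspace_scale[OF insert.prems(1) w(1)]])
      ultimately show ?thesis by blast
    qed
    \<comment> \<open>\<open>v\<close> is the error made when the formula valid on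
      \<open>W \<inter> cspan F\<close> is applied to \<open>w\<close>. It is nonzero since
      \<open>w\<close> lies outside \<open>cspan F\<close>, and an index \<open>p\<close> where it
      does not vanish becomes the additional coordinate.\<close>
    define v where "v = w - (\<Sum>j\<in>J. (\<lambda>i. w j * h j i))"
    have v: "v \<in> W" unfolding v_def
      using h by (intro csubspace_diff csubspace_sum csubspace_scale insert.prems(1) w) auto
    have "v \<noteq> 0"
    proof
      assume "v = 0"
      then have "w = (\<Sum>j\<in>J. (\<lambda>i. w j * h j i))" by (simp add: v_def)
      moreover have "(\<Sum>j\<in>J. (\<lambda>i. w j * h j i)) \<in> cspan F"
        using h by (intro csubspace_sum csubspace_scale csubspace_cspan) auto
      ultimately show False using w by metis
    qed
    then obtain p where p: "v p \<noteq> 0" by (auto simp: fun_eq_iff)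
    \<comment> \<open>The error of the old formula is linear in \<open>x\<close> and vanishes on
      \<open>W \<inter> cspan F\<close>, so it is a multiple of \<open>v\<close>; coordinate
      \<open>p\<close> determines the multiple.\<close>
    have rep': "x i = (\<Sum>j\<in>J. x j * h j i) + (x p - (\<Sum>j\<in>J. x j * h j p)) * (v i / v p)"
      if x: "x \<in> W" for x i
    proof -
      obtain a where a: "x - (\<lambda>i. a * w i) \<in> ?W" using dec'[OF x] by blast
      have *: "x i - a * w i = (\<Sum>j\<in>J. (x j - a * w j) * h j i)" for i
        using rep[OF a, of i] by simp
      have **: "x i - (\<Sum>j\<in>J. x j * h j i) = a * v i" for i
        using *[of i] by (simp add: v_def sum_seq_apply left_diff_distrib sum_subtractf
          sum_distrib_left right_diff_distrib mult.assoc) (simp add: algebra_simps)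
      show ?thesis using **[of i] **[of p] p by (simp add: field_simps)
    qed
    define h0 where "h0 j = (if j \<in> J then h j else 0)" for j
    \<comment> \<open>Collects the coefficient of \<open>x j\<close> in \<open>rep'\<close>. The
      index \<open>p\<close> may already belong to \<open>J\<close>, so its two contributions are
      added by means of conditionals.\<close>
    define h' where "h' j = h0 j - (\<lambda>i. (if j \<in> J then h j p else 0) / v p * v i)
        + (\<lambda>i. (if j = p then 1 / v p else 0) * v i)" for j
    have h0W: "h0 j \<in> W" for j using h csubspace_zero[OF insert.prems(1)] by (simp add: h0_def)
    have h'W: "h' j \<in> W" for j unfolding h'_def
      by (intro csubspace_add csubspace_diff csubspace_scale insert.prems(1) v h0W)
    have "x i = (\<Sum>j\<in>insert p J. x j * h' j i)" if x: "x \<in> W" for x i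
    proof -
      have restr: "(\<Sum>j\<in>insert p J. if j \<in> J then x j * h j q else 0) = (\<Sum>j\<in>J. x j * h j q)" for q
        using J by (intro sum.mono_neutral_cong_right) auto
      have "(\<Sum>j\<in>insert p J. x j * h' j i) =
         (\<Sum>j\<in>insert p J. (if j \<in> J then x j * h j i else 0)
            - (if j \<in> J then x j * h j p else 0) * (v i / v p) + (if j = p then x p * (v i / v p) else 0))"
        by (rule sum.cong) (auto simp: h'_def h0_def algebra_simps)
      also have "\<dots> = (\<Sum>j\<in>insert p J. if j \<in> J then x j * h j i else 0)
          - (\<Sum>j\<in>insert p J. if j \<in> J then x j * h j p else 0) * (v i / v p) + x p * (v i / v p)"
        using J by (simp add: sum.distrib sum_subtractf sum_distrib_right sum_divide_distrib)
      also have "\<dots> = x i" unfolding restr using rep'[OF x, of i] by (simp add: algebra_simps)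
      finally show ?thesis by simp
    qed
    then show ?thesis using J h'W by (intro exI[of _ "insert p J"] exI[of _ h']) auto
  qed
qed

context oc_seq_space begin

text \<open>Serves both the Neumann series and the successive approximation in
  \<open>open_mapping\<close>.\<close>

lemma geometric_series_converges:
  assumes g: "\<And>k. g k \<in> L" "\<And>k. nrm (g k) \<le> C * q ^ k" and q: "0 \<le> q" "q < 1"
  shows "\<exists>x\<in>L. (\<lambda>n. nrm ((\<Sum>k<n. g k) - x)) \<longlonglongrightarrow> 0 \<and> nrm x \<le> C / (1 - q)"
proof -
  have C: "0 \<le> C" using g(2)[of 0] nrm_nonneg[OF g(1)[of 0]] by simp
  define s where "s n = (\<Sum>k<n. g k)" for n
  have sL: "s n \<in> L" for n unfolding s_def by (intro sum_in g)
  have geo: "(\<Sum>k=a..<b. q ^ k) \<le> q ^ a / (1 - q)" for a b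
  proof (cases "a \<le> b")
    case True
    then have "(\<Sum>k=a..<b. q ^ k) * (1 - q) = q ^ a - q ^ b"
    proof (induction b rule: dec_induct)
      case (step n)
      then show ?case by (simp only: sum.atLeastLessThan_Suc distrib_right) (simp add: algebra_simps)
    qed simp
    then show ?thesis using q by (simp add: pos_le_divide_eq)
  qed (use q in auto)
  have sdiff: "nrm (s b - s a) \<le> C * (q ^ a / (1 - q))" if "a \<le> b" for a b
  proof -
    have "s b - s a = (\<Sum>k=a..<b. g k)" unfolding s_def lessThan_atLeast0
      using sum_diff_nat_ivl[OF _ that, of 0] by simp
    then have "nrm (s b - s a) \<le> (\<Sum>k=a..<b. nrm (g k))" using nrm_sum g by metis
    also have "\<dots> \<le> (\<Sum>k=a..<b. C * q ^ k)" by (intro sum_mono g)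
    also have "\<dots> = C * (\<Sum>k=a..<b. q ^ k)" by (simp add: sum_distrib_left)
    also have "\<dots> \<le> C * (q ^ a / (1 - q))" using geo C by (intro mult_left_mono) auto
    finally show ?thesis .
  qed
  have lim0: "(\<lambda>a. C * (q ^ a / (1 - q))) \<longlonglongrightarrow> 0"
    using q by (auto intro!: tendsto_eq_intros LIMSEQ_realpow_zero)
  have "\<exists>x\<in>L. (\<lambda>n. nrm (s n - x)) \<longlonglongrightarrow> 0"
  proof (rule complete[OF sL])
    fix e :: real assume "e > 0"
    then have "\<forall>\<^sub>F a in sequentially. C * (q ^ a / (1 - q)) < e" by (intro order_tendstoD(2)[OF lim0])
    then obtain K where K: "\<And>a. a \<ge> K \<Longrightarrow> C * (q ^ a / (1 - q)) < e" by (auto simp: eventually_sequentially)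
    have "nrm (s a - s b) < e" if "a \<ge> K" "b \<ge> K" for a b
    proof (cases "a \<le> b")
      case True
      then show ?thesis using sdiff[OF True] K[OF that(1)] nrm_diff_commute[OF sL sL, of a b] by simp
    next
      case False
      then show ?thesis using sdiff[of b a] K[OF that(2)] by simp
    qed
    then show "\<exists>K. \<forall>p\<ge>K. \<forall>q\<ge>K. nrm (s p - s q) < e" by blast
  qed
  then obtain x where x: "x \<in> L" and lim: "(\<lambda>n. nrm (s n - x)) \<longlonglongrightarrow> 0" by blast
  have "nrm x \<le> C / (1 - q) + 0"
  proof (rule tendsto_lowerbound)
    show "(\<lambda>n. C / (1 - q) + nrm (s n - x)) \<longlonglongrightarrow> C / (1 - q) + 0" by (intro tendsto_intros lim)
    show "\<forall>\<^sub>F n in sequentially. nrm x \<le> C / (1 - q) + nrm (s n - x)"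
    proof (intro always_eventually allI)
      fix n
      have "nrm x \<le> nrm (x - s n) + nrm (s n)" using nrm_add[OF diff_in[OF x sL] sL, of n n] by simp
      moreover have "nrm (s n) \<le> C / (1 - q)" using sdiff[of 0 n] by (simp add: s_def)
      ultimately show "nrm x \<le> C / (1 - q) + nrm (s n - x)" using nrm_diff_commute[OF x sL, of n] by simp
    qed
  qed simp
  then show ?thesis using x lim unfolding s_def by (intro bexI[of _ x]) simp_all
qed

text \<open>Formulated for an additive contraction rather than a matrix, because it is applied to a
  tail of a matrix divided by a complex number, which is in general not a nonnegative
  matrix.\<close>

lemma neumann:
  assumes add: "\<And>x y. x \<in> L \<Longrightarrow> y \<in> L \<Longrightarrow> B (x + y) = B x + B y"
    and inL: "\<And>x. x \<in> L \<Longrightarrow> B x \<in> L"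
    and q: "\<And>x. x \<in> L \<Longrightarrow> nrm (B x) \<le> q * nrm x" "0 \<le> q" "q < 1" and y: "y \<in> L"
  shows "\<exists>x\<in>L. x - B x = y"
proof -
  have B0: "B 0 = 0" using add[OF zero_in zero_in] by simp
  have Bdiff: "B (x - z) = B x - B z" if "x \<in> L" "z \<in> L" for x z
    using add[OF diff_in[OF that] that(2)] by (simp add: algebra_simps)
  define s where "s n = (\<Sum>k<n. (B ^^ k) y)" for n
  have pw: "(B ^^ k) y \<in> L \<and> nrm ((B ^^ k) y) \<le> nrm y * q ^ k" for k
  proof (induction k)
    case (Suc k)
    have "nrm (B ((B ^^ k) y)) \<le> q * nrm ((B ^^ k) y)" using q Suc by blast
    also have "\<dots> \<le> q * (nrm y * q ^ k)" using Suc q by (intro mult_left_mono) auto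
    finally show ?case using inL Suc by (simp add: mult.left_commute)
  qed (use y in auto)
  have sL: "s n \<in> L" for n unfolding s_def using pw by (intro sum_in) auto
  obtain x where x: "x \<in> L" and lim: "(\<lambda>n. nrm (s n - x)) \<longlonglongrightarrow> 0"
    using geometric_series_converges[of "\<lambda>k. (B ^^ k) y", OF _ _ q(2,3)] pw unfolding s_def by blast
  have sSuc: "s (Suc n) = y + B (s n)" for n
  proof (induction n)
    case 0
    have "s 0 = 0" "s (Suc 0) = y" unfolding s_def by (simp_all only: sum.lessThan_Suc) simp_all
    then show ?case by (simp only: B0 add_0_right)
  next
    case (Suc n)
    have "s (Suc (Suc n)) = s (Suc n) + B ((B ^^ n) y)" by (simp add: s_def)
    also have "\<dots> = y + (B (s n) + B ((B ^^ n) y))" by (simp only: Suc add.assoc)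
    also have "B (s n) + B ((B ^^ n) y) = B (s (Suc n))"
      using add[OF sL, of "(B ^^ n) y" n] pw by (simp add: s_def)
    finally show ?case .
  qed
  have "nrm (x - B x - y) \<le> 0"
  proof (rule tendsto_lowerbound)
    have "(\<lambda>n. nrm (s (Suc n) - x) + q * nrm (s n - x)) \<longlonglongrightarrow> 0 + q * 0"
      by (intro tendsto_intros lim LIMSEQ_Suc[OF lim])
    then show "(\<lambda>n. nrm (s (Suc n) - x) + q * nrm (s n - x)) \<longlonglongrightarrow> 0" by simp
    show "\<forall>\<^sub>F n in sequentially. nrm (x - B x - y) \<le> nrm (s (Suc n) - x) + q * nrm (s n - x)"
    proof (rule always_eventually, rule allI)
      fix n
      have "x - B x - y = B (s n - x) - (s (Suc n) - x)"
        unfolding sSuc Bdiff[OF sL x] by simp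
      then have "nrm (x - B x - y) \<le> nrm (B (s n - x)) + nrm (s (Suc n) - x)"
        using nrm_diff[OF inL[OF diff_in[OF sL x]] diff_in[OF sL x]] by metis
      then show "nrm (x - B x - y) \<le> nrm (s (Suc n) - x) + q * nrm (s n - x)"
        using q(1)[OF diff_in[OF sL x], of n] by simp
    qed
  qed simp
  then have "x - B x = y"
    using nrm_nonneg nrm_eq_0 diff_in inL x y by (metis antisym eq_iff_diff_eq_0)
  then show ?thesis using x by blast
qed

section \<open>Powers of a matrix and the operator z - A\<close>

primrec mat_pow :: "mat \<Rightarrow> nat \<Rightarrow> mat" where
  "mat_pow A 0 = ident_mat R"
| "mat_pow A (Suc k) = mat_mult R A (mat_pow A k)"

lemma set_pow_singleton: "set_pow R {A} k = {mat_pow A k}"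
  by (induction k) (auto simp: set_mult_def)

lemma pos_op_pow: "pos_op A \<Longrightarrow> pos_op (mat_pow A k)"
  by (induction k) (auto intro: pos_op_ident pos_op_mult)

abbreviation resolv :: "mat \<Rightarrow> complex \<Rightarrow> seq \<Rightarrow> seq" where
  "resolv A z \<equiv> (\<lambda>x. (\<lambda>j. z * x j) - ap A x)"

lemma resolv_in: "pos_op A \<Longrightarrow> x \<in> L \<Longrightarrow> resolv A z x \<in> L"
  by (intro diff_in scale_in ap_in)

lemma resolv_add: "pos_op A \<Longrightarrow> x \<in> L \<Longrightarrow> y \<in> L \<Longrightarrow> resolv A z (x + y) = resolv A z x + resolv A z y"
  by (subst ap_add) (auto simp: fun_eq_iff algebra_simps)

lemma resolv_diff: "pos_op A \<Longrightarrow> x \<in> L \<Longrightarrow> y \<in> L \<Longrightarrow> resolv A z (x - y) = resolv A z x - resolv A z y"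
  by (subst ap_diff) (auto simp: fun_eq_iff algebra_simps)

lemma resolv_scale: "resolv A z (\<lambda>j. c * x j) = (\<lambda>j. c * resolv A z x j)"
  by (subst ap_scale) (auto simp: fun_eq_iff algebra_simps)

lemma csubspace_range: assumes "pos_op A" shows "csubspace (resolv A z ` L)"
  unfolding csubspace_def
proof (intro conjI ballI allI)
  show "0 \<in> resolv A z ` L" by (rule image_eqI[OF _ zero_in]) (auto simp: fun_eq_iff)
next
  fix x y assume "x \<in> resolv A z ` L" "y \<in> resolv A z ` L"
  then obtain u v where "u \<in> L" "v \<in> L" "x = resolv A z u" "y = resolv A z v" by blast
  then show "x + y \<in> resolv A z ` L" 
    by (intro image_eqI[of _ _ "u + v"]) (auto simp: resolv_add[OF assms] simp del: plus_fun_apply intro: add_in)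
next
  fix c x assume "x \<in> resolv A z ` L"
  then obtain u where "u \<in> L" "x = resolv A z u" by blast
  then show "(\<lambda>j. c * x j) \<in> resolv A z ` L"
    by (intro image_eqI[OF _ scale_in[of u c]]) (simp_all add: resolv_scale)
qed

text \<open>z - A is a factor of z^k - A^k. The induction uses z^(k+1) - A^(k+1) = z (z^k - A^k) +
  (z - A) A^k, so the complex cofactor never has to be written down.\<close>

lemma pow_diff_in_range:
  assumes A: "pos_op A" and x: "x \<in> L"
  shows "(\<lambda>j. z ^ k * x j) - ap (mat_pow A k) x \<in> resolv A z ` L"
proof (induction k)
  case 0
  have "(\<lambda>j. z ^ 0 * x j) - ap (mat_pow A 0) x = 0" by (auto simp: ident_apply[OF x])
  then show ?case using csubspace_zero[OF csubspace_range[OF A]] by metis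
next
  case (Suc k)
  let ?y = "ap (mat_pow A k) x"
  have y: "?y \<in> L" by (rule ap_in[OF pos_op_pow[OF A] x])
  have "(\<lambda>j. z ^ Suc k * x j) - ap (mat_pow A (Suc k)) x
      = (\<lambda>j. z * ((\<lambda>j. z ^ k * x j) - ?y) j) + resolv A z ?y"
    by (auto simp: fun_eq_iff mult_apply[OF A pos_op_pow[OF A] x] algebra_simps)
  moreover have "\<dots> \<in> resolv A z ` L"
    using y by (intro csubspace_add[OF csubspace_range[OF A]] csubspace_scale[OF csubspace_range[OF A]] Suc) auto
  ultimately show ?case by metis
qed

lemma pow_eigen:
  assumes A: "pos_op A" and x: "x \<in> L" and z: "resolv A z x = 0"
  shows "ap (mat_pow A k) x = (\<lambda>j. z ^ k * x j)"
proof (induction k)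
  case 0
  then show ?case by (simp add: ident_apply[OF x])
next
  case (Suc k)
  have "ap A x = (\<lambda>j. z * x j)" using z by simp
  then show ?case
    by (simp add: mult_apply[OF A pos_op_pow[OF A] x] Suc ap_scale fun_eq_iff)
qed

text \<open>Put w = z^k and C = A^k. Cutting C at a suitable row splits C / w into \<open>B\<close>,
  of norm less than 1, and \<open>P\<close>, of finite rank. Since I - B is invertible, I - B - P
  has finite-dimensional kernel and finite codimension; the kernel of z - A lies in its kernel, and
  the range of z - A contains its range.\<close>

lemma fredholm_of_gamma_less:
  assumes A: "pos_op A" and g: "\<gamma> (mat_pow A k) < cmod z ^ k"
  shows "fredholm L nrm (resolv A z)"
proof -
  define C where "C = mat_pow A k"
  have C: "pos_op C" unfolding C_def by (rule pos_op_pow[OF A])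
  obtain M where M: "op_bound M C" "0 \<le> M" using C by (rule pos_opE)
  define w where "w = z ^ k"
  obtain e where e: "\<gamma> C < e" "e < cmod w" using g dense unfolding C_def w_def norm_power by blast
  have e0: "e > 0" using e gamma_nonneg[OF C] by simp
  have w: "w \<noteq> 0" using e e0 by auto
  obtain l where l: "tail_bound l e C"
    using gamma_less_tail_bound[OF C e(1)] eventually_happens' sequentially_bot by blast
  define q where "q = e / cmod w"
  have q: "0 \<le> q" "q < 1" using e e0 w by (auto simp: q_def)
  define B where "B x = (\<lambda>j. 1 / w * tail l (ap C x) j)" for x
  define P where "P x = (\<lambda>j. 1 / w * (ap C x - tail l (ap C x)) j)" for x
  define E where "E = unit_vec ` ({..<l} \<inter> R)"
  have E: "finite E" "E \<subseteq> L" using unit_in by (auto simp: E_def)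
  let ?T = "resolv A z"
  have Bin: "B x \<in> L" if "x \<in> L" for x unfolding B_def by (intro scale_in tail_in ap_in C that)
  have Badd: "B (x + y) = B x + B y" if "x \<in> L" "y \<in> L" for x y
    unfolding B_def ap_add[OF C that] tail_add by (auto simp: algebra_simps add_divide_distrib)
  have Bdiff: "B (x - y) = B x - B y" if "x \<in> L" "y \<in> L" for x y
    using Badd[OF diff_in[OF that] that(2)] by (simp add: algebra_simps)
  have Bbound: "nrm (B x) \<le> q * nrm x" if "x \<in> L" for x
    unfolding B_def nrm_scale[OF tail_in[OF ap_in[OF C that]]] q_def
    using tail_boundD[OF l that] w by (simp add: norm_divide field_simps)
  have sol: "\<exists>x\<in>L. x - B x = y" if "y \<in> L" for y
    using neumann[of B q y, OF Badd Bin Bbound q that] by blast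
  have lower: "nrm x * (1 - q) \<le> nrm (x - B x)" if x: "x \<in> L" for x
    using nrm_add[OF diff_in[OF x Bin[OF x]] Bin[OF x]] Bbound[OF x] by (simp add: algebra_simps)
  have PE: "P x \<in> cspan E" if x: "x \<in> L" for x
    unfolding P_def head_expansion[OF ap_in[OF C x]]
    using E by (intro csubspace_scale csubspace_sum csubspace_cspan cspan_base) (auto simp: E_def)
  have dec: "x - B x - P x \<in> ?T ` L" if x: "x \<in> L" for x
  proof -
    have "x - B x - P x = (\<lambda>j. 1 / w * ((\<lambda>j. z ^ k * x j) - ap C x) j)"
      using w by (auto simp: fun_eq_iff B_def P_def w_def field_simps)
    then show ?thesis
      using csubspace_scale[OF csubspace_range[OF A] pow_diff_in_range[OF A x], of "1 / w" z k]
      by (simp add: C_def)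
  qed
  have ker: "\<exists>F. finite F \<and> F \<subseteq> L \<and> {x\<in>L. ?T x = 0} \<subseteq> cspan F"
  proof -
    obtain v where v: "\<And>y. y \<in> L \<Longrightarrow> v y \<in> L \<and> v y - B (v y) = y" using sol by metis
    show ?thesis
    proof (intro exI[of _ "v ` E"] conjI subsetI)
      show "finite (v ` E)" using E by simp
      show "x \<in> L" if "x \<in> v ` E" for x using that v E by auto
      fix x assume "x \<in> {x\<in>L. ?T x = 0}"
      then have x: "x \<in> L" "?T x = 0" by auto
      let ?J = "{..<l} \<inter> R"
      have Cx: "ap C x = (\<lambda>j. w * x j)" unfolding C_def w_def by (rule pow_eigen[OF A x])
      define c where "c j = 1 / w * ap C x j" for j
      have Px: "P x = (\<Sum>j\<in>?J. (\<lambda>i. c j * unit_vec j i))"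
        unfolding P_def head_expansion[OF ap_in[OF C x(1)]] c_def
        by (rule ext) (simp add: sum_seq_apply sum_distrib_left mult.assoc)
      have xBx: "x - B x = P x"
        using w by (auto simp: fun_eq_iff B_def P_def Cx field_simps)
      \<comment> \<open>\<open>v\<close> inverts I - B on unit vectors, so \<open>u\<close> has the
        same image \<open>P x\<close> under I - B as \<open>x\<close>. Injectivity of I - B, from
        \<open>lower\<close>, then gives \<open>x = u\<close>, a combination of finitely many fixed
        vectors.\<close>
      define u where "u = (\<Sum>j\<in>?J. (\<lambda>i. c j * v (unit_vec j) i))"
      have u: "u \<in> L" unfolding u_def using v unit_in by (intro sum_in scale_in) auto
      have Bsum: "u - B u = P x"
      proof -
        have "ap C u = (\<Sum>j\<in>?J. (\<lambda>i. c j * ap C (v (unit_vec j)) i))"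
          unfolding u_def using v unit_in by (subst ap_sum[OF C]) (auto intro!: scale_in simp: ap_scale)
        then have "B u = (\<Sum>j\<in>?J. (\<lambda>i. c j * B (v (unit_vec j)) i))"
          by (auto simp: B_def tail_def fun_eq_iff sum_seq_apply sum_distrib_left sum_divide_distrib)
        then have "u - B u = (\<Sum>j\<in>?J. (\<lambda>i. c j * (v (unit_vec j) - B (v (unit_vec j))) i))"
          by (auto simp: u_def fun_eq_iff sum_seq_apply right_diff_distrib sum_subtractf)
        also have "\<dots> = P x"
          unfolding Px using v unit_in by (intro sum.cong refl) auto
        finally show ?thesis .
      qed
      have "(x - u) - B (x - u) = (x - B x) - (u - B u)"
        unfolding Bdiff[OF x(1) u] by (simp only: algebra_simps)
      then have "(x - u) - B (x - u) = 0" unfolding xBx Bsum by simp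
      then have "nrm (x - u) * (1 - q) \<le> 0" using lower[OF diff_in[OF x(1) u]] by simp
      then have "nrm (x - u) \<le> 0" using q by (simp add: mult_le_0_iff)
      then have "x = u" using nrm_eq_0 nrm_nonneg diff_in[OF x(1) u] by (metis antisym eq_iff_diff_eq_0)
      moreover have "u \<in> cspan (v ` E)"
        unfolding u_def using E by (intro csubspace_sum csubspace_scale csubspace_cspan cspan_base) (auto simp: E_def)
      ultimately show "x \<in> cspan (v ` E)" by simp
    qed
  qed
  have cok: "\<exists>F. finite F \<and> F \<subseteq> L \<and> L \<subseteq> {u + v | u v. u \<in> ?T ` L \<and> v \<in> cspan F}"
  proof (intro exI[of _ E] conjI subsetI)
    fix y assume "y \<in> L"
    then obtain x where x: "x \<in> L" "x - B x = y" using sol by blast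
    have "y = (x - B x - P x) + P x" using x by simp
    then show "y \<in> {u + v | u v. u \<in> ?T ` L \<and> v \<in> cspan E}" using dec[OF x(1)] PE[OF x(1)] by blast
  qed (use E in auto)
  \<comment> \<open>Closed range: pull \<open>s i\<close> and \<open>y\<close> back along I - B to
    \<open>u i\<close> and \<open>x\<close>. The vectors \<open>P (u i)\<close> lie in the range of
    z - A and in \<open>cspan E\<close>, and so does their limit \<open>P x\<close>; hence
    \<open>y\<close> is a sum of two elements of the range.\<close>
  have clo: "y \<in> ?T ` L" if s: "\<And>i. s i \<in> ?T ` L" and y: "y \<in> L" and lim: "(\<lambda>i. nrm (s i - y)) \<longlonglongrightarrow> 0" for s y
  proof -
    have "?T ` L \<subseteq> L" using resolv_in[OF A, of _ z] by (rule image_subsetI)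
    then have sL: "s i \<in> L" for i using s by (rule subsetD)
    obtain x where x: "x \<in> L" "x - B x = y" using sol[OF y] by blast
    have "\<forall>i. \<exists>v. v \<in> L \<and> v - B v = s i" using sol[OF sL] by blast
    then obtain u where u: "\<And>i. u i \<in> L" "\<And>i. u i - B (u i) = s i" by (elim choice[THEN exE]) blast
    have "nrm (u i - x) \<le> nrm (s i - y) / (1 - q)" for i
    proof -
      have "(u i - x) - B (u i - x) = s i - y"
        unfolding Bdiff[OF u(1) x(1)] u(2)[symmetric] x(2)[symmetric] by (simp add: algebra_simps)
      then have "nrm (u i - x) * (1 - q) \<le> nrm (s i - y)"
        using lower[OF diff_in[OF u(1) x(1)], of i] by (simp only:)
      then show ?thesis using q by (simp add: pos_le_divide_eq)
    qed
    then have Cb: "nrm (ap C (u i) - ap C x) \<le> M * (nrm (s i - y) / (1 - q))" for i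
      using op_boundD[OF M(1) diff_in[OF u(1) x(1)], of i] M(2)
      unfolding ap_diff[OF C u(1) x(1)] by (meson mult_left_mono order_trans)
    have "(\<lambda>i. M * (nrm (s i - y) / (1 - q))) \<longlonglongrightarrow> M * (0 / (1 - q))"
      using q by (intro tendsto_intros lim) auto
    then have lim0: "(\<lambda>i. M * (nrm (s i - y) / (1 - q))) \<longlonglongrightarrow> 0" by simp
    have "(\<lambda>i. nrm (ap C (u i) - ap C x)) \<longlonglongrightarrow> 0"
    proof (rule tendsto_sandwich[OF _ _ tendsto_const])
      show "\<forall>\<^sub>F i in sequentially. 0 \<le> nrm (ap C (u i) - ap C x)"
        by (intro always_eventually allI nrm_nonneg diff_in ap_in C u x)
      show "\<forall>\<^sub>F i in sequentially. nrm (ap C (u i) - ap C x) \<le> M * (nrm (s i - y) / (1 - q))"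
        by (intro always_eventually allI Cb)
    qed (rule lim0)
    then have Clim: "(\<lambda>i. ap C (u i) p) \<longlonglongrightarrow> ap C x p" for p
      by (intro nrm_tendsto_coord ap_in C u x)
    have Plim: "(\<lambda>i. P (u i) p) \<longlonglongrightarrow> P x p" for p
      unfolding P_def tail_def using Clim w by (auto intro!: tendsto_intros)
    \<comment> \<open>The intersection is finite-dimensional, so membership is expressed through
      finitely many coordinates and survives coordinatewise limits.\<close>
    let ?W = "?T ` L \<inter> cspan E"
    have W: "csubspace ?W" by (rule csubspace_Int[OF csubspace_range[OF A] csubspace_cspan])
    have PW: "P (u i) \<in> ?W" for i
    proof -
      have "P (u i) = s i - (u i - B (u i) - P (u i))" using u(2)[of i] by (simp add: algebra_simps)
      then have "P (u i) \<in> ?T ` L"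
        using csubspace_diff[OF csubspace_range[OF A] s dec[OF u(1)], of i] by metis
      then show ?thesis using PE[OF u(1)] by blast
    qed
    obtain J h where J: "finite J" "\<forall>j\<in>J. h j \<in> ?W" "\<forall>x\<in>?W. \<forall>p. x p = (\<Sum>j\<in>J. x j * h j p)"
      using finite_dim_coordinates[OF E(1) W inf_le2] by (elim exE conjE)
    note h = J(2)[rule_format] and rep = J(3)[rule_format]
    have "P x p = (\<Sum>j\<in>J. P x j * h j p)" for p
    proof (rule LIMSEQ_unique[OF Plim])
      have "(\<lambda>i. \<Sum>j\<in>J. P (u i) j * h j p) \<longlonglongrightarrow> (\<Sum>j\<in>J. P x j * h j p)"
        by (intro tendsto_intros Plim)
      then show "(\<lambda>i. P (u i) p) \<longlonglongrightarrow> (\<Sum>j\<in>J. P x j * h j p)"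
        by (rule tendsto_cong[THEN iffD1, OF always_eventually, rotated]) (rule allI, rule rep[OF PW, symmetric])
    qed
    then have "P x = (\<Sum>j\<in>J. (\<lambda>p. P x j * h j p))" unfolding fun_eq_iff sum_seq_apply by (rule allI)
    moreover have "\<dots> \<in> ?W" by (rule csubspace_sum[OF W]) (rule csubspace_scale[OF W h])
    ultimately have "P x \<in> ?W" by (simp only:)
    then have "P x \<in> ?T ` L" by (rule IntD1)
    then have "(x - B x - P x) + P x \<in> ?T ` L" by (intro csubspace_add[OF csubspace_range[OF A] dec[OF x(1)]])
    then show ?thesis by (simp only: x diff_add_cancel)
  qed
  show ?thesis unfolding fredholm_def
    by (intro conjI allI impI ker cok) (elim conjE, rule clo, auto)
qed

lemma ess_spectrum_le:
  assumes A: "pos_op A" and z: "z \<in> ess_spectrum R L nrm A"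
  shows "cmod z ^ k \<le> \<gamma> (mat_pow A k)"
proof (rule ccontr)
  assume "\<not> cmod z ^ k \<le> \<gamma> (mat_pow A k)"
  then have "fredholm L nrm (resolv A z)" by (intro fredholm_of_gamma_less[OF A, of k]) simp
  then show False using z unfolding ess_spectrum_def by blast
qed

end

subsection \<open>Points of the essential spectrum on the critical circle\<close>

context oc_seq_space begin

lemma resolv_bound:
  assumes "op_bound M A" "x \<in> L"
  shows "nrm (resolv A z x) \<le> (cmod z + M) * nrm x"
proof -
  have "nrm (resolv A z x) \<le> nrm (\<lambda>j. z * x j) + nrm (ap A x)"
    by (rule nrm_diff[OF scale_in[OF assms(2)] ap_in[OF op_bound_pos_op[OF assms(1)] assms(2)]])
  then show ?thesis
    using op_boundD[OF assms] by (simp add: nrm_scale[OF assms(2)] distrib_right)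
qed

text \<open>The Baire category half of the open mapping theorem. A closed range is complete and is
  covered by the closures of the images of the balls of radius n, one of which has an interior
  point. This lifts vectors only up to an error of half their norm.\<close>

lemma range_approx:
  assumes A: "pos_op A"
    and closed: "\<forall>s y. (\<forall>k. s k \<in> resolv A z ` L) \<and> y \<in> L \<and> (\<lambda>k. nrm (s k - y)) \<longlonglongrightarrow> 0 \<longrightarrow> y \<in> resolv A z ` L"
  shows "\<exists>K\<ge>0. \<forall>v\<in>resolv A z ` L. \<exists>x\<in>L. nrm x \<le> K * nrm v \<and> nrm (v - resolv A z x) \<le> nrm v / 2"
proof -
  let ?T = "resolv A z"
  define V where "V = ?T ` L"
  have VL: "v \<in> L" if "v \<in> V" for v using that resolv_in[OF A, of _ z] by (auto simp: V_def simp del: fun_diff_def)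
  have Vs: "csubspace V" unfolding V_def by (rule csubspace_range[OF A])
  \<comment> \<open>The value 0 off \<open>L\<close> makes nonnegativity and symmetry hold for all
    arguments, as \<open>Metric_space\<close> demands.\<close>
  define d where "d x y = (if x \<in> L \<and> y \<in> L then nrm (x - y) else 0)" for x y
  interpret Met: Metric_space V d
  proof
    show "0 \<le> d x y" for x y using nrm_nonneg diff_in by (simp add: d_def)
    show "d x y = d y x" for x y using nrm_diff_commute by (auto simp: d_def)
    show "d x y = 0 \<longleftrightarrow> x = y" if "x \<in> V" "y \<in> V" for x y
      using VL[OF that(1)] VL[OF that(2)] nrm_eq_0[OF diff_in] by (simp add: d_def)
    show "d x w \<le> d x y + d y w" if "x \<in> V" "y \<in> V" "w \<in> V" for x y w
      using nrm_triangle[OF VL[OF that(1)] VL[OF that(2)] VL[OF that(3)]] VL that by (simp add: d_def)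
  qed
  have d: "d x y = nrm (x - y)" if "x \<in> V" "y \<in> V" for x y using VL that by (simp add: d_def)
  have mc: "Met.mcomplete"
    unfolding Met.mcomplete_def
  proof (intro allI impI)
    fix s assume s: "Met.MCauchy s"
    then have sV: "s k \<in> V" for k by (auto simp: Met.MCauchy_def)
    have "\<exists>y\<in>L. (\<lambda>k. nrm (s k - y)) \<longlonglongrightarrow> 0"
    proof (rule complete)
      show "s k \<in> L" for k using VL sV by blast
      fix e :: real assume "e > 0"
      then show "\<exists>K. \<forall>p\<ge>K. \<forall>q\<ge>K. nrm (s p - s q) < e"
        using s d[OF sV sV] unfolding Met.MCauchy_def by metis
    qed
    then obtain y where y: "y \<in> L" "(\<lambda>k. nrm (s k - y)) \<longlonglongrightarrow> 0" by blast
    have yV: "y \<in> V" using closed[rule_format, of s y] sV y unfolding V_def by (simp del: fun_diff_def)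
    have "limitin Met.mtopology s y sequentially"
      unfolding Met.limit_metric_sequentially
    proof (intro conjI allI impI yV)
      fix e :: real assume "e > 0"
      then have "\<forall>\<^sub>F k in sequentially. nrm (s k - y) < e" by (rule order_tendstoD(2)[OF y(2)])
      then show "\<exists>N. \<forall>n\<ge>N. s n \<in> V \<and> d (s n) y < e"
        using sV d[OF sV yV] by (simp add: eventually_sequentially)
    qed
    then show "\<exists>x. limitin Met.mtopology s x sequentially" by blast
  qed
  define E where "E n = ?T ` {x\<in>L. nrm x \<le> real n}" for n
  define \<G> where "\<G> = range (\<lambda>n. Met.mtopology closure_of (E n))"
  have EV: "E n \<subseteq> V" for n by (auto simp: E_def V_def)
  have cover: "\<Union>\<G> = V"
  proof
    show "\<Union>\<G> \<subseteq> V" using closure_of_subset_topspace by (force simp: \<G>_def)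
    show "V \<subseteq> \<Union>\<G>"
    proof
      fix v assume "v \<in> V"
      then obtain x where x: "x \<in> L" "v = ?T x" by (auto simp: V_def simp del: fun_diff_def)
      obtain n where "nrm x \<le> real n" using real_arch_simple by blast
      then have "v \<in> E n" using x by (auto simp: E_def)
      then show "v \<in> \<Union>\<G>" using closure_of_subset[of "E n" Met.mtopology] EV by (auto simp: \<G>_def)
    qed
  qed
  have "Met.mtopology interior_of \<Union>\<G> = V"
    unfolding cover using interior_of_topspace[of Met.mtopology] by simp
  moreover have "0 \<in> V" by (rule csubspace_zero[OF Vs])
  ultimately have "Met.mtopology interior_of \<Union>\<G> \<noteq> {}" by blast
  then obtain T where T: "T \<in> \<G>" "\<not> (closedin Met.mtopology T \<and> Met.mtopology interior_of T = {})"
    using Met.metric_Baire_category_alt[OF mc, of \<G>] by (force simp: \<G>_def)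
  then obtain n where n: "Met.mtopology interior_of (Met.mtopology closure_of (E n)) \<noteq> {}"
    by (auto simp: \<G>_def)
  then obtain y where y: "y \<in> Met.mtopology interior_of (Met.mtopology closure_of (E n))" by blast
  then obtain r where r: "r > 0" "Met.mball y r \<subseteq> Met.mtopology interior_of (Met.mtopology closure_of (E n))"
    using openin_interior_of[of Met.mtopology] unfolding Met.openin_mtopology by blast
  then have ball: "Met.mball y r \<subseteq> Met.mtopology closure_of (E n)"
    using interior_of_subset[of Met.mtopology "Met.mtopology closure_of (E n)"] by (meson subset_trans)
  have yc: "y \<in> Met.mtopology closure_of (E n)"
    using y interior_of_subset[of Met.mtopology "Met.mtopology closure_of (E n)"] by (rule rev_subsetD)
  then have yV: "y \<in> V" by (simp add: Met.metric_closure_of)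
  have near: "\<exists>x\<in>L. nrm x \<le> real n \<and> nrm (w - ?T x) < \<delta>"
    if "w \<in> Met.mtopology closure_of (E n)" "\<delta> > 0" for w \<delta>
  proof -
    have "\<exists>e\<in>E n. e \<in> Met.mball w \<delta>" using that by (simp add: Met.metric_closure_of)
    then obtain e where "e \<in> E n" "w \<in> V" "e \<in> V" "d w e < \<delta>" unfolding Met.in_mball by blast
    then show ?thesis using d[of w e] unfolding E_def by auto
  qed
  \<comment> \<open>Moves the ball from \<open>y\<close> to 0: \<open>v\<close> is the difference of
    \<open>y + v\<close> and \<open>y\<close>, both approximated from the ball of radius n, so radii
    and errors add.\<close>
  have small: "\<exists>x\<in>L. nrm x \<le> 2 * real n \<and> nrm (v - ?T x) \<le> r / 4" if v: "v \<in> V" "nrm v < r" for v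
  proof -
    have yv: "y + v \<in> V" by (rule csubspace_add[OF Vs yV v(1)])
    have "y + v \<in> Met.mball y r"
      unfolding Met.in_mball using yV yv v d[OF yV yv] nrm_uminus[OF VL[OF v(1)]] by simp
    then obtain x1 where x1: "x1 \<in> L" "nrm x1 \<le> real n" "nrm (y + v - ?T x1) < r / 8"
      using near[OF subsetD[OF ball], of "y + v" "r / 8"] r(1) by auto
    obtain x2 where x2: "x2 \<in> L" "nrm x2 \<le> real n" "nrm (y - ?T x2) < r / 8"
      using near[OF yc, of "r / 8"] r by auto
    have eq: "v - ?T (x1 - x2) = (y + v - ?T x1) - (y - ?T x2)"
      unfolding resolv_diff[OF A x1(1) x2(1)] by (simp only: algebra_simps)
    have "nrm (v - ?T (x1 - x2)) \<le> nrm (y + v - ?T x1) + nrm (y - ?T x2)"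
      unfolding eq using x1 x2 VL yV v by (intro nrm_diff diff_in[of _ "?T _"] resolv_in A add_in) auto
    then have "nrm (v - ?T (x1 - x2)) \<le> r / 4" using x1 x2 by simp
    moreover have "nrm (x1 - x2) \<le> 2 * real n" using nrm_diff[OF x1(1) x2(1)] x1 x2 by simp
    ultimately show ?thesis using diff_in[OF x1(1) x2(1)] by blast
  qed
  show ?thesis
  proof (intro exI[of _ "4 * real n / r"] conjI ballI)
    show "0 \<le> 4 * real n / r" using r by simp
    fix v assume "v \<in> ?T ` L"
    then have v: "v \<in> V" by (simp add: V_def)
    show "\<exists>x\<in>L. nrm x \<le> 4 * real n / r * nrm v \<and> nrm (v - ?T x) \<le> nrm v / 2"
    proof (cases "nrm v = 0")
      case True
      have "?T 0 = 0" by (auto simp: fun_eq_iff)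
      then show ?thesis using True zero_in by (intro bexI[of _ 0]) auto
    next
      case False
      then have pos: "nrm v > 0" using nrm_nonneg[OF VL[OF v]] by simp
      \<comment> \<open>Scales \<open>v\<close> to norm \<open>r / 2\<close>, where the error
        \<open>r / 4\<close> is exactly half the norm; scaling back turns the radius
        \<open>2 * n\<close> into \<open>4 * n / r * nrm v\<close>.\<close>
      define c where "c = r / (2 * nrm v)"
      have c: "c > 0" using pos r by (simp add: c_def)
      let ?v = "\<lambda>j. complex_of_real c * v j"
      have "nrm ?v = c * nrm v" unfolding nrm_scale[OF VL[OF v]] using c by simp
      then have nv: "nrm ?v = r / 2" using pos by (simp add: c_def)
      have vV: "?v \<in> V" by (rule csubspace_scale[OF Vs v])
      obtain x where x: "x \<in> L" "nrm x \<le> 2 * real n" "nrm (?v - ?T x) \<le> r / 4"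
        using small[OF vV] nv r by auto
      let ?x = "\<lambda>j. complex_of_real (1 / c) * x j"
      have eq: "v - ?T ?x = (\<lambda>j. complex_of_real (1 / c) * (?v - ?T x) j)"
        unfolding resolv_scale using c by (auto simp: fun_eq_iff field_simps)
      have "nrm (v - ?T ?x) = 1 / c * nrm (?v - ?T x)"
        unfolding eq using c by (subst nrm_scale[OF diff_in[OF VL[OF vV] resolv_in[OF A x(1)]]]) (simp add: norm_divide)
      also have "\<dots> \<le> 1 / c * (r / 4)" using x c by (intro mult_left_mono) auto
      also have "\<dots> = nrm v / 2" using r pos by (simp add: c_def)
      finally have 1: "nrm (v - ?T ?x) \<le> nrm v / 2" .
      have "nrm ?x = 1 / c * nrm x" unfolding nrm_scale[OF x(1)] using c by (simp add: norm_divide)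
      also have "\<dots> \<le> 1 / c * (2 * real n)" using x c by (intro mult_left_mono) auto
      also have "\<dots> = 4 * real n / r * nrm v" using r pos by (simp add: c_def)
      finally show ?thesis using 1 scale_in[OF x(1)] by blast
    qed
  qed
qed

text \<open>Successive approximation: lifting the residual again and again halves it each time, and
  the corrections sum to a geometric series of ratio 1/2, which doubles the constant of
  \<open>range_approx\<close>.\<close>

lemma open_mapping:
  assumes A: "pos_op A"
    and closed: "\<forall>s y. (\<forall>k. s k \<in> resolv A z ` L) \<and> y \<in> L \<and> (\<lambda>k. nrm (s k - y)) \<longlonglongrightarrow> 0 \<longrightarrow> y \<in> resolv A z ` L"
  shows "\<exists>K\<ge>0. \<forall>v\<in>resolv A z ` L. \<exists>x\<in>L. resolv A z x = v \<and> nrm x \<le> K * nrm v"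
proof -
  let ?T = "resolv A z"
  obtain M where M: "op_bound M A" "0 \<le> M" using A by (rule pos_opE)
  obtain K where K: "K \<ge> 0" "\<forall>v\<in>?T ` L. \<exists>x\<in>L. nrm x \<le> K * nrm v \<and> nrm (v - ?T x) \<le> nrm v / 2"
    using range_approx[OF A closed] by (elim exE conjE)
  obtain \<phi> where \<phi>: "\<And>v. v \<in> ?T ` L \<Longrightarrow> \<phi> v \<in> L \<and> nrm (\<phi> v) \<le> K * nrm v \<and> nrm (v - ?T (\<phi> v)) \<le> nrm v / 2"
    using bchoice[OF K(2)[unfolded Bex_def]] by blast
  have Vs: "csubspace (?T ` L)" by (rule csubspace_range[OF A])
  show ?thesis
  proof (intro exI[of _ "2 * K"] conjI ballI)
    show "0 \<le> 2 * K" using K by simp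
    fix v assume v: "v \<in> ?T ` L"
    define u where "u k = ((\<lambda>w. w - ?T (\<phi> w)) ^^ k) v" for k
    have u0: "u 0 = v" and uSuc: "u (Suc k) = u k - ?T (\<phi> (u k))" for k by (simp_all add: u_def)
    have uV: "u k \<in> ?T ` L" for k
    proof (induction k)
      case 0 show ?case unfolding u0 by (rule v)
    next
      case (Suc k)
      then show ?case unfolding uSuc by (intro csubspace_diff[OF Vs] imageI \<phi>[THEN conjunct1])
    qed
    have un: "nrm (u k) \<le> nrm v * (1/2) ^ k" for k
    proof (induction k)
      case (Suc k)
      have "nrm (u (Suc k)) \<le> nrm (u k) / 2" unfolding uSuc using \<phi>[OF uV] by blast
      then show ?case using Suc by simp
    qed (simp add: u0)
    have g: "\<phi> (u k) \<in> L" for k using \<phi>[OF uV] by blast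
    have gn: "nrm (\<phi> (u k)) \<le> (K * nrm v) * (1/2) ^ k" for k
    proof -
      have "nrm (\<phi> (u k)) \<le> K * nrm (u k)" using \<phi>[OF uV] by blast
      also have "\<dots> \<le> K * (nrm v * (1/2) ^ k)" by (intro mult_left_mono un K)
      finally show ?thesis by simp
    qed
    obtain x where x: "x \<in> L" "(\<lambda>n. nrm ((\<Sum>k<n. \<phi> (u k)) - x)) \<longlonglongrightarrow> 0" "nrm x \<le> (K * nrm v) / (1 - 1/2)"
      using geometric_series_converges[of "\<lambda>k. \<phi> (u k)", OF g gn] by auto
    define s where "s n = (\<Sum>k<n. \<phi> (u k))" for n
    have sL: "s n \<in> L" for n unfolding s_def by (intro sum_in g)
    have Ts: "?T (s n) = v - u n" for n
    proof (induction n)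
      case 0
      have "?T 0 = 0" by (auto simp: fun_eq_iff)
      then show ?case by (simp add: s_def u0)
    next
      case (Suc n)
      have "s (Suc n) = s n + \<phi> (u n)" unfolding s_def by (rule sum.lessThan_Suc)
      then have "?T (s (Suc n)) = ?T (s n) + ?T (\<phi> (u n))" by (simp only: resolv_add[OF A sL g])
      also have "\<dots> = v - u (Suc n)" unfolding Suc uSuc by (simp only: algebra_simps)
      finally show ?case .
    qed
    have vL: "v \<in> L" and uL: "u n \<in> L" for n
      using v uV[of n] resolv_in[OF A, of _ z] by (auto simp del: fun_diff_def)
    have "nrm (?T x - v) \<le> 0"
    proof (rule tendsto_lowerbound)
      have "(\<lambda>n. (cmod z + M) * nrm (s n - x) + nrm v * (1/2) ^ n) \<longlonglongrightarrow> (cmod z + M) * 0 + nrm v * 0"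
        unfolding s_def by (intro tendsto_intros x LIMSEQ_realpow_zero) auto
      then show "(\<lambda>n. (cmod z + M) * nrm (s n - x) + nrm v * (1/2) ^ n) \<longlonglongrightarrow> 0" by simp
      show "\<forall>\<^sub>F n in sequentially. nrm (?T x - v) \<le> (cmod z + M) * nrm (s n - x) + nrm v * (1/2) ^ n"
      proof (intro always_eventually allI)
        fix n
        have "v - ?T x = ?T (s n - x) + u n"
          unfolding resolv_diff[OF A sL x(1)] Ts by (simp only: algebra_simps)
        then have "nrm (v - ?T x) \<le> nrm (?T (s n - x)) + nrm (u n)"
          using nrm_add[OF resolv_in[OF A diff_in[OF sL x(1)]] uL] by (simp only:)
        also have "\<dots> \<le> (cmod z + M) * nrm (s n - x) + nrm v * (1/2) ^ n"
          by (intro add_mono resolv_bound[OF M(1)] un diff_in sL x)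
        finally show "nrm (?T x - v) \<le> (cmod z + M) * nrm (s n - x) + nrm v * (1/2) ^ n"
          using nrm_diff_commute[OF resolv_in[OF A x(1), of z] vL] by (simp only:)
      qed
    qed simp
    then have "?T x = v"
      using nrm_nonneg nrm_eq_0 diff_in[OF resolv_in[OF A x(1)] vL] by (metis antisym eq_iff_diff_eq_0)
    then show "\<exists>x\<in>L. ?T x = v \<and> nrm x \<le> 2 * K * nrm v" using x by (intro bexI[of _ x]) auto
  qed
qed

text \<open>A Fredholm operator T is bounded below modulo compact perturbations. Two images under
  \<open>X\<close> whose T-images are close differ by a short lift plus an element of the kernel,
  and tails in a finite-dimensional kernel are uniformly small. The hypothesis is about vectors
  because T after \<open>X\<close> is in general not a nonnegative matrix; \<open>C\<close> is
  independent of \<open>X\<close>, \<open>e\<close> and \<open>l\<close>.\<close>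

lemma fredholm_gamma_le:
  assumes A: "pos_op A" and fr: "fredholm L nrm (resolv A z)"
  shows "\<exists>C>0. \<forall>X e l. pos_op X \<and> 0 \<le> e \<and> (\<forall>x\<in>L. nrm x \<le> 1 \<longrightarrow> nrm (tail l (resolv A z (ap X x))) \<le> e)
     \<longrightarrow> \<gamma> X \<le> C * e"
proof -
  let ?T = "resolv A z"
  obtain K where K: "K \<ge> 0" and lift: "\<forall>v\<in>?T ` L. \<exists>x\<in>L. ?T x = v \<and> nrm x \<le> K * nrm v"
    using open_mapping[OF A fr[unfolded fredholm_def, THEN conjunct2, THEN conjunct1]] by (elim exE conjE)
  obtain F0 where F0: "finite F0" "{x\<in>L. ?T x = 0} \<subseteq> cspan F0"
    using fr unfolding fredholm_def by (elim conjE exE)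
  obtain M0 where M0: "op_bound M0 A" "0 \<le> M0" using A by (rule pos_opE)
  let ?N = "{x\<in>L. ?T x = 0}"
  have N: "csubspace ?N"
    unfolding csubspace_def
  proof (intro conjI ballI allI)
    show "0 \<in> ?N" using zero_in by (auto simp: fun_eq_iff)
  next
    fix x y assume "x \<in> ?N" "y \<in> ?N"
    then have xy: "x \<in> L" "y \<in> L" "?T x = 0" "?T y = 0" by auto
    have "?T (x + y) = 0" unfolding resolv_add[OF A xy(1,2)] xy by simp
    then show "x + y \<in> ?N" using add_in[OF xy(1,2)] by blast
  next
    fix c x assume "x \<in> ?N"
    then have x: "x \<in> L" "?T x = 0" by auto
    have "?T (\<lambda>j. c * x j) = 0" unfolding resolv_scale x by (simp add: fun_eq_iff)
    then show "(\<lambda>j. c * x j) \<in> ?N" using scale_in[OF x(1)] by blast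
  qed
  obtain J h where J: "finite J" "\<forall>j\<in>J. h j \<in> ?N" "\<forall>x\<in>?N. \<forall>p. x p = (\<Sum>j\<in>J. x j * h j p)"
    using finite_dim_coordinates[OF F0(1) N F0(2)] by (elim exE conjE)
  have hL: "h j \<in> L" if "j \<in> J" for j using J(2) that by blast
  \<comment> \<open>A common rate for tails in the kernel: each kernel vector is a combination of
    the finitely many \<open>h j\<close> with coefficients among its own coordinates.\<close>
  define \<sigma> where "\<sigma> l = (\<Sum>j\<in>J. nrm (tail l (h j)))" for l
  have "\<sigma> \<longlonglongrightarrow> (\<Sum>j\<in>J. 0)" unfolding \<sigma>_def by (intro tendsto_intros tail_tendsto hL)
  then have \<sigma>: "\<sigma> \<longlonglongrightarrow> 0" by simp
  have ker_tail: "nrm (tail l x) \<le> nrm x * \<sigma> l" if x: "x \<in> ?N" for x l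
  proof -
    have xL: "x \<in> L" using x by blast
    have "tail l x = (\<Sum>j\<in>J. (\<lambda>i. x j * tail l (h j) i))"
    proof
      fix p
      have "x p = (\<Sum>j\<in>J. x j * h j p)" using J(3) x by blast
      then show "tail l x p = (\<Sum>j\<in>J. (\<lambda>i. x j * tail l (h j) i)) p"
        unfolding sum_seq_apply tail_def by auto
    qed
    then have "nrm (tail l x) \<le> (\<Sum>j\<in>J. nrm (\<lambda>i. x j * tail l (h j) i))"
      using nrm_sum[of J "\<lambda>j. (\<lambda>i. x j * tail l (h j) i)"] scale_in[OF tail_in[OF hL]] by simp
    also have "\<dots> = (\<Sum>j\<in>J. cmod (x j) * nrm (tail l (h j)))"
      by (intro sum.cong refl nrm_scale tail_in hL)
    also have "\<dots> \<le> (\<Sum>j\<in>J. nrm x * nrm (tail l (h j)))"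
      by (intro sum_mono mult_right_mono coord_le xL nrm_nonneg tail_in hL)
    finally show ?thesis by (simp add: \<sigma>_def sum_distrib_left)
  qed
  have main: "\<gamma> X \<le> (2 * K + 1) * e"
    if X: "pos_op X" and e: "0 \<le> e" and T: "\<forall>x\<in>L. nrm x \<le> 1 \<longrightarrow> nrm (tail l0 (?T (ap X x))) \<le> e" for X e l0
  proof -
    obtain M where M: "op_bound M X" "0 \<le> M" using X by (rule pos_opE)
    have Xb: "nrm (ap X x) \<le> M" if "x \<in> L" "nrm x \<le> 1" for x
      using op_boundD[OF M(1) that(1)] mult_left_mono[OF that(2) M(2)] by simp
    have "\<gamma> X \<le> 2 * K * e + (2 * K + 2) * \<epsilon>" if \<epsilon>: "\<epsilon> > 0" for \<epsilon>
    proof -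
      let ?Ba = "{x\<in>L. nrm x \<le> 1}"
      let ?f = "\<lambda>x. ?T (ap X x)"
      have fL: "?f x \<in> L" if "x \<in> L" for x by (rule resolv_in[OF A ap_in[OF X that]])
      have "\<exists>F. finite F \<and> F \<subseteq> L \<and> ?f ` ?Ba \<subseteq> (\<Union>c\<in>F. {x. nrm (x - c) \<le> e + \<epsilon>})"
      proof (rule tail_imp_cover[OF _ _ _ \<epsilon>])
        show "?f ` ?Ba \<subseteq> L" by (rule image_subsetI) (rule fL, blast)
        show "nrm y \<le> (cmod z + M0) * M" if "y \<in> ?f ` ?Ba" for y
        proof -
          obtain x where x: "y = ?f x" "x \<in> L" "nrm x \<le> 1" using \<open>y \<in> ?f ` ?Ba\<close> by (elim imageE) blast
          have "nrm y \<le> (cmod z + M0) * nrm (ap X x)" unfolding x by (rule resolv_bound[OF M0(1) ap_in[OF X x(2)]])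
          also have "\<dots> \<le> (cmod z + M0) * M" using Xb[OF x(2,3)] M0(2) by (intro mult_left_mono) auto
          finally show ?thesis .
        qed
        show "nrm (tail l0 y) \<le> e" if "y \<in> ?f ` ?Ba" for y
        proof -
          obtain x where x: "y = ?f x" "x \<in> L" "nrm x \<le> 1" using \<open>y \<in> ?f ` ?Ba\<close> by (elim imageE) blast
          show ?thesis unfolding x(1) using T x by blast
        qed
      qed
      then obtain F where F: "finite F" "F \<subseteq> L" "?f ` ?Ba \<subseteq> (\<Union>c\<in>F. {x. nrm (x - c) \<le> e + \<epsilon>})"
        by (elim exE conjE)
      \<comment> \<open>Balls that miss the image are discarded, so that every remaining centre can
        be replaced by the image of a point \<open>\<xi> c\<close> of the unit ball; this doubles
        the radius.\<close>
      define G where "G = {c\<in>F. \<exists>x\<in>?Ba. nrm (?f x - c) \<le> e + \<epsilon>}"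
      have G: "finite G" "G \<subseteq> L" using F by (auto simp: G_def)
      have "\<forall>c\<in>G. \<exists>x\<in>?Ba. nrm (?f x - c) \<le> e + \<epsilon>" by (simp add: G_def)
      from bchoice[OF this[unfolded Bex_def]]
      obtain \<xi> where \<xi>: "\<And>c. c \<in> G \<Longrightarrow> \<xi> c \<in> ?Ba" "\<And>c. c \<in> G \<Longrightarrow> nrm (?f (\<xi> c) - c) \<le> e + \<epsilon>" by blast
      have \<xi>L: "\<xi> c \<in> L" "nrm (\<xi> c) \<le> 1" if "c \<in> G" for c using \<xi>(1)[OF that] by auto
      \<comment> \<open>Bounds the norm of the kernel vector \<open>u\<close> below:
        \<open>M\<close> for each of the two images under \<open>X\<close>, and the rest for the
        lift \<open>w\<close>.\<close>
      define D where "D = 2 * M + 2 * K * (e + \<epsilon>)"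
      have "\<forall>\<^sub>F l in sequentially. \<forall>c\<in>G. nrm (tail l (ap X (\<xi> c))) < \<epsilon>"
        using G \<epsilon> by (intro eventually_ball_finite ballI order_tendstoD(2)[OF tail_tendsto] ap_in[OF X] \<xi>L) auto
      moreover have "(\<lambda>l. D * \<sigma> l) \<longlonglongrightarrow> D * 0" by (intro tendsto_intros \<sigma>)
      then have "\<forall>\<^sub>F l in sequentially. D * \<sigma> l < \<epsilon>" using \<epsilon> by (intro order_tendstoD(2)) auto
      ultimately obtain l where l: "\<forall>c\<in>G. nrm (tail l (ap X (\<xi> c))) < \<epsilon>" "D * \<sigma> l < \<epsilon>"
        using eventually_happens'[OF sequentially_bot eventually_conj] by blast
      have "tail_bound l (2 * K * e + (2 * K + 2) * \<epsilon>) X"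
      proof (rule tail_boundI[OF X])
        fix x assume x: "x \<in> L" "nrm x \<le> 1"
        have "?f x \<in> ?f ` ?Ba" using x by (intro imageI) simp
        then have "?f x \<in> (\<Union>c\<in>F. {x. nrm (x - c) \<le> e + \<epsilon>})" by (rule subsetD[OF F(3)])
        then obtain c where c: "c \<in> F" "nrm (?f x - c) \<le> e + \<epsilon>" by (elim UN_E CollectE)
        then have cG: "c \<in> G" using x unfolding G_def by blast
        have cL: "c \<in> L" using cG G by blast
        let ?y = "\<xi> c"
        note y = \<xi>L[OF cG]
        have XyL: "ap X ?y \<in> L" and XxL: "ap X x \<in> L" by (intro ap_in X y x)+
        define v where "v = ?f x - ?f ?y"
        have v_eq: "v = ?T (ap X x - ap X ?y)" unfolding v_def by (rule resolv_diff[OF A XxL XyL, symmetric])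
        have vr: "v \<in> ?T ` L" unfolding v_eq by (intro imageI diff_in XxL XyL)
        have "nrm v \<le> nrm (?f x - c) + nrm (c - ?f ?y)"
          unfolding v_def by (intro nrm_triangle fL x y cL)
        also have "\<dots> \<le> (e + \<epsilon>) + (e + \<epsilon>)"
          using c(2) \<xi>(2)[OF cG] unfolding nrm_diff_commute[OF cL fL[OF y(1)]] by (rule add_mono)
        also have "\<dots> = 2 * (e + \<epsilon>)" by simp
        finally have vn: "nrm v \<le> 2 * (e + \<epsilon>)" .
        obtain w where w: "w \<in> L" "?T w = v" "nrm w \<le> K * nrm v" using lift vr by blast
        have wn: "nrm w \<le> 2 * K * (e + \<epsilon>)"
          using w(3) mult_left_mono[OF vn K] by linarith
        define u where "u = ap X x - ap X ?y - w"
        have uL: "u \<in> L" unfolding u_def by (intro diff_in XxL XyL w)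
        have "?T u = 0" unfolding u_def resolv_diff[OF A diff_in[OF XxL XyL] w(1)] v_eq[symmetric] w(2) by simp
        then have uN: "u \<in> ?N" using uL by blast
        have "nrm u \<le> nrm (ap X x - ap X ?y) + nrm w" unfolding u_def by (intro nrm_diff diff_in XxL XyL w)
        also have "nrm (ap X x - ap X ?y) \<le> nrm (ap X x) + nrm (ap X ?y)" by (intro nrm_diff XxL XyL)
        finally have un: "nrm u \<le> D" using Xb[OF x] Xb[OF y] wn by (simp add: D_def)
        have s0: "0 \<le> \<sigma> l" unfolding \<sigma>_def by (intro sum_nonneg nrm_nonneg tail_in hL)
        have "tail l (ap X x) = tail l (ap X ?y) + (tail l u + tail l w)"
          unfolding tail_add[symmetric] u_def diff_add_cancel by (metis add.commute diff_add_cancel)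
        then have "nrm (tail l (ap X x)) \<le> nrm (tail l (ap X ?y)) + nrm (tail l u + tail l w)"
          using nrm_add[OF tail_in[OF XyL] add_in[OF tail_in[OF uL] tail_in[OF w(1)]]] by (simp only:)
        also have "nrm (tail l u + tail l w) \<le> nrm (tail l u) + nrm (tail l w)" by (intro nrm_add tail_in uL w)
        also have "nrm (tail l u) \<le> D * \<sigma> l"
          using ker_tail[OF uN, of l] mult_right_mono[OF un s0] by linarith
        also have "nrm (tail l w) \<le> 2 * K * (e + \<epsilon>)" using nrm_tail_le[OF w(1)] wn by (meson order_trans)
        finally have "nrm (tail l (ap X x)) \<le> nrm (tail l (ap X ?y)) + (D * \<sigma> l + 2 * K * (e + \<epsilon>))" by simp
        moreover have "nrm (tail l (ap X ?y)) < \<epsilon>" using l(1) cG by blast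
        ultimately have "nrm (tail l (ap X x)) \<le> \<epsilon> + \<epsilon> + 2 * K * (e + \<epsilon>)" using l(2) by linarith
        then show "nrm (tail l (ap X x)) \<le> 2 * K * e + (2 * K + 2) * \<epsilon>" by (simp add: algebra_simps)
      qed
      then show ?thesis using K e \<epsilon> by (intro gamma_le[OF X]) auto
    qed
    then have "\<gamma> X \<le> 2 * K * e + \<delta>" if "\<delta> > 0" for \<delta>
    proof -
      have "\<gamma> X \<le> 2 * K * e + (2 * K + 2) * (\<delta> / (2 * K + 2))"
        using \<open>\<And>\<epsilon>. 0 < \<epsilon> \<Longrightarrow> _\<close>[of "\<delta> / (2 * K + 2)"] that K by simp
      also have "(2 * K + 2) * (\<delta> / (2 * K + 2)) = \<delta>" using K by simp
      finally show ?thesis .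
    qed
    then have "\<gamma> X \<le> 2 * K * e" by (rule field_le_epsilon)
    then show ?thesis using e by (simp add: distrib_right)
  qed
  \<comment> \<open>\<open>2 * K\<close> already suffices as a factor; \<open>+ 1\<close> makes the
    constant positive when \<open>K = 0\<close>.\<close>
  show ?thesis
    using main K by (intro exI[of _ "2 * K + 1"]) auto
qed

section \<open>Nonnegative combinations and polynomials of a matrix\<close>

lemma op_bound_madd:
  assumes "op_bound M A" "op_bound N B"
  shows "op_bound (M + N) (\<lambda>i j. A i j + B i j)"
    and "x \<in> L \<Longrightarrow> ap (\<lambda>i j. A i j + B i j) x = ap A x + ap B x"
proof -
  have A: "pos_op A" and B: "pos_op B" using assms op_bound_pos_op by auto
  have eq: "ap (\<lambda>i j. A i j + B i j) x = ap A x + ap B x" if "x \<in> L" for x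
  proof
    fix i show "ap (\<lambda>i j. A i j + B i j) x i = (ap A x + ap B x) i"
      using infsum_add[OF pos_op_csummable[OF A that, of i] pos_op_csummable[OF B that, of i]]
      by (auto simp: mat_apply_def distrib_right)
  qed
  then show "x \<in> L \<Longrightarrow> ap (\<lambda>i j. A i j + B i j) x = ap A x + ap B x" .
  have bd: "nrm (ap A x + ap B x) \<le> (M + N) * nrm x" if "x \<in> L" for x
    using nrm_add[OF ap_in[OF A that] ap_in[OF B that]] op_boundD[OF assms(1) that] op_boundD[OF assms(2) that]
    by (simp add: distrib_right)
  have sm: "(\<lambda>j. (A i j + B i j) * cmod (x j)) summable_on R" if "x \<in> L" "i \<in> R" for x i
    using summable_on_add[OF pos_op_summable[OF A that] pos_op_summable[OF B that]] by (simp add: distrib_right)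
  show "op_bound (M + N) (\<lambda>i j. A i j + B i j)"
    unfolding op_bound_def defines_op_def nonneg_mat_def
    using assms(1,2)[unfolded op_bound_def] pos_op_nonneg[OF A] pos_op_nonneg[OF B]
    by (intro conjI ballI) (simp_all only: eq bd sm add_in ap_in[OF A] ap_in[OF B] add_nonneg_nonneg)
qed

lemma op_bound_mscale:
  assumes "op_bound M A" "0 \<le> c"
  shows "op_bound (c * M) (\<lambda>i j. c * A i j)"
    and "ap (\<lambda>i j. c * A i j) x = (\<lambda>i. complex_of_real c * ap A x i)"
proof -
  have A: "pos_op A" using assms op_bound_pos_op by auto
  have eq: "ap (\<lambda>i j. c * A i j) x = (\<lambda>i. complex_of_real c * ap A x i)" for x
  proof
    fix i show "ap (\<lambda>i j. c * A i j) x i = complex_of_real c * ap A x i"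
      using infsum_cmult_right'[of "complex_of_real c" "\<lambda>j. complex_of_real (A i j) * x j" R]
      by (auto simp: mat_apply_def mult.assoc)
  qed
  then show "ap (\<lambda>i j. c * A i j) x = (\<lambda>i. complex_of_real c * ap A x i)" .
  have bd: "nrm (\<lambda>i. complex_of_real c * ap A x i) \<le> c * M * nrm x" if "x \<in> L" for x
    unfolding nrm_scale[OF ap_in[OF A that]] using op_boundD[OF assms(1) that] assms(2)
    by (simp add: mult.assoc mult_left_mono)
  have sm: "(\<lambda>j. c * A i j * cmod (x j)) summable_on R" if "x \<in> L" "i \<in> R" for x i
    using summable_on_cmult_right[OF pos_op_summable[OF A that], of c] by (simp add: mult.assoc)
  have M: "0 \<le> M" using assms by (simp add: op_bound_def)
  show "op_bound (c * M) (\<lambda>i j. c * A i j)"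
    unfolding op_bound_def defines_op_def nonneg_mat_def
    by (intro conjI ballI)
      (simp_all only: eq bd sm scale_in ap_in[OF A] mult_nonneg_nonneg assms(2) M pos_op_nonneg[OF A])
qed

lemma pos_op_madd: "pos_op A \<Longrightarrow> pos_op B \<Longrightarrow> pos_op (\<lambda>i j. A i j + B i j)"
  and ap_madd: "pos_op A \<Longrightarrow> pos_op B \<Longrightarrow> x \<in> L \<Longrightarrow> ap (\<lambda>i j. A i j + B i j) x = ap A x + ap B x"
  unfolding pos_op_def using op_bound_madd by blast+

lemma pos_op_mscale: "pos_op A \<Longrightarrow> 0 \<le> c \<Longrightarrow> pos_op (\<lambda>i j. c * A i j)"
  and ap_mscale: "pos_op A \<Longrightarrow> 0 \<le> c \<Longrightarrow> ap (\<lambda>i j. c * A i j) x = (\<lambda>i. complex_of_real c * ap A x i)"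
  unfolding pos_op_def using op_bound_mscale by blast+

lemma gamma_mscale_ge:
  assumes A: "pos_op A" and c: "0 < c"
  shows "c * \<gamma> A \<le> \<gamma> (\<lambda>i j. c * A i j)"
proof (rule dense_ge)
  have cA: "pos_op (\<lambda>i j. c * A i j)" using pos_op_mscale[OF A] c by simp
  fix e assume e: "\<gamma> (\<lambda>i j. c * A i j) < e"
  then have e0: "0 < e" using gamma_nonneg[OF cA] by simp
  obtain l where l: "tail_bound l e (\<lambda>i j. c * A i j)"
    using gamma_less_tail_bound[OF cA e] eventually_happens' sequentially_bot by blast
  have "tail_bound l (e / c) A"
    unfolding tail_bound_def
  proof
    fix x assume x: "x \<in> L"
    have "c * nrm (tail l (ap A x)) \<le> e * nrm x"
      using tail_boundD[OF l x] c
      unfolding ap_mscale[OF A less_imp_le[OF c]] tail_scale nrm_scale[OF tail_in[OF ap_in[OF A x]]] by simp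
    then show "nrm (tail l (ap A x)) \<le> e / c * nrm x" using c by (simp add: field_simps)
  qed
  then have "\<gamma> A \<le> e / c" using c e0 by (intro gamma_le[OF A]) auto
  then show "c * \<gamma> A \<le> e" using c by (simp add: field_simps)
qed

text \<open>The zero matrix is written as a multiple of the identity so that the facts on scaled
  operators cover the base case.\<close>

primrec mat_poly :: "(nat \<Rightarrow> real) \<Rightarrow> mat \<Rightarrow> nat \<Rightarrow> mat" where
  "mat_poly c A 0 = (\<lambda>i j. 0 * ident_mat R i j)"
| "mat_poly c A (Suc N) = (\<lambda>i j. mat_poly c A N i j + c N * mat_pow A N i j)"

lemma pos_op_poly: assumes "pos_op A" "\<And>k. 0 \<le> c k" shows "pos_op (mat_poly c A N)"
proof (induction N)
  case 0 show ?case using pos_op_mscale[OF pos_op_ident, of 0] by simp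
next
  case (Suc N) show ?case
    using pos_op_madd[OF Suc pos_op_mscale[OF pos_op_pow[OF assms(1)] assms(2)], of N N] by simp
qed

lemma poly_apply:
  assumes A: "pos_op A" and c: "\<And>k. 0 \<le> c k" and x: "x \<in> L"
  shows "ap (mat_poly c A 0) x = 0"
    and "ap (mat_poly c A (Suc N)) x = ap (mat_poly c A N) x + (\<lambda>i. complex_of_real (c N) * ap (mat_pow A N) x i)"
proof -
  have "ap (mat_poly c A 0) x = (\<lambda>i. complex_of_real 0 * ap (ident_mat R) x i)"
    unfolding mat_poly.simps(1) by (rule ap_mscale[OF pos_op_ident order_refl])
  then show "ap (mat_poly c A 0) x = 0" by (simp add: fun_eq_iff)
  show "ap (mat_poly c A (Suc N)) x = ap (mat_poly c A N) x + (\<lambda>i. complex_of_real (c N) * ap (mat_pow A N) x i)"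
    unfolding mat_poly.simps(2) ap_mscale[OF pos_op_pow[OF A] c, symmetric]
    by (rule ap_madd[OF pos_op_poly[OF A c] pos_op_mscale[OF pos_op_pow[OF A] c] x])
qed

text \<open>The place where nonnegativity of the matrix matters: no cancellation occurs, so a single
  term bounds the polynomial from below.\<close>

lemma poly_ge:
  assumes A: "pos_op A" and c: "\<And>k. 0 \<le> c k" and k: "k < N"
  shows "(\<lambda>i j. c k * mat_pow A k i j) \<sqsubseteq> mat_poly c A N"
  using k
proof (induction N)
  case (Suc N)
  have p: "0 \<le> mat_poly c A N i j" "0 \<le> c N * mat_pow A N i j" if "i \<in> R" "j \<in> R" for i j
    using that pos_op_nonneg[OF pos_op_poly[OF A c]] pos_op_nonneg[OF pos_op_pow[OF A]] c by auto
  show ?case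
  proof (cases "k = N")
    case True
    then show ?thesis using p by (simp add: mat_le_def)
  next
    case False
    then have "(\<lambda>i j. c k * mat_pow A k i j) \<sqsubseteq> mat_poly c A N" using Suc by simp
    moreover have "mat_poly c A N \<sqsubseteq> mat_poly c A (Suc N)" using p(2) by (simp add: mat_le_def)
    ultimately show ?thesis by (rule mat_le_trans)
  qed
qed simp

text \<open>The two polynomials are truncations of the Neumann series of the resolvent at \<^term>\<open>r\<close> and of
  its square.\<close>
lemma poly_telescope:
  assumes A: "pos_op A" and r: "r > 0" and x: "x \<in> L"
  shows "resolv A (complex_of_real r) (ap (mat_poly (\<lambda>k. 1 / r ^ Suc k) A N) x)
           = x - (\<lambda>i. complex_of_real (1 / r ^ N) * ap (mat_pow A N) x i)"
    and "resolv A (complex_of_real r) (ap (mat_poly (\<lambda>k. real (Suc k) / r ^ Suc (Suc k)) A N) x)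
           = ap (mat_poly (\<lambda>k. 1 / r ^ Suc k) A N) x - (\<lambda>i. complex_of_real (real N / r ^ Suc N) * ap (mat_pow A N) x i)"
proof -
  let ?T = "resolv A (complex_of_real r)"
  have c1: "0 \<le> 1 / r ^ Suc k" and c2: "0 \<le> real (Suc k) / r ^ Suc (Suc k)" for k using r by auto
  note p1 = poly_apply[OF A c1 x] and p2 = poly_apply[OF A c2 x]
  have pL: "ap (mat_pow A k) x \<in> L" for k by (rule ap_in[OF pos_op_pow[OF A] x])
  have q1: "ap (mat_poly (\<lambda>k. 1 / r ^ Suc k) A N) x \<in> L" and q2: "ap (mat_poly (\<lambda>k. real (Suc k) / r ^ Suc (Suc k)) A N) x \<in> L" for N
    by (rule ap_in[OF pos_op_poly[OF A c1] x], rule ap_in[OF pos_op_poly[OF A c2] x])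
  have step: "?T (\<lambda>i. complex_of_real c * ap (mat_pow A k) x i)
      = (\<lambda>i. complex_of_real (c * r) * ap (mat_pow A k) x i) - (\<lambda>i. complex_of_real c * ap (mat_pow A (Suc k)) x i)" for c k
    unfolding mat_pow.simps mult_apply(1)[OF A pos_op_pow[OF A] x] ap_scale by (simp add: fun_eq_iff algebra_simps)
  have T0: "?T 0 = 0" by (simp add: fun_eq_iff)
  show "?T (ap (mat_poly (\<lambda>k. 1 / r ^ Suc k) A N) x) = x - (\<lambda>i. complex_of_real (1 / r ^ N) * ap (mat_pow A N) x i)"
  proof (induction N)
    case 0
    show ?case unfolding p1(1) T0 by (simp add: fun_eq_iff ident_apply[OF x])
  next
    case (Suc N)
    show ?case unfolding p1(2) resolv_add[OF A q1 scale_in[OF pL]] step Suc using r by (simp add: fun_eq_iff)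
  qed
  show "?T (ap (mat_poly (\<lambda>k. real (Suc k) / r ^ Suc (Suc k)) A N) x)
           = ap (mat_poly (\<lambda>k. 1 / r ^ Suc k) A N) x - (\<lambda>i. complex_of_real (real N / r ^ Suc N) * ap (mat_pow A N) x i)"
  proof (induction N)
    case 0
    show ?case unfolding p2(1) p1(1) T0 by (simp add: fun_eq_iff)
  next
    case (Suc N)
    have "real (Suc N) / r ^ Suc (Suc N) * r = real N / r ^ Suc N + 1 / r ^ Suc N"
      using r by (simp add: field_simps)
    then show ?case unfolding p2(2) p1(2) resolv_add[OF A q2 scale_in[OF pL]] step Suc
      by (simp only: fun_eq_iff) (simp add: algebra_simps)
  qed
qed

lemma not_fredholm_at_radius:
  assumes A: "pos_op A" and \<rho>: "\<rho> > 0" and lo: "\<And>k. 1 \<le> k \<Longrightarrow> \<rho> ^ k \<le> \<gamma> (mat_pow A k)"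
    and up: "\<And>e. e > \<rho> \<Longrightarrow> \<forall>\<^sub>F k in sequentially. \<gamma> (mat_pow A k) \<le> e ^ k"
  shows "\<not> fredholm L nrm (resolv A (complex_of_real \<rho>))"
proof
  assume "fredholm L nrm (resolv A (complex_of_real \<rho>))"
  then obtain C where C: "C > 0" and fred: "\<And>X e l. pos_op X \<Longrightarrow> 0 \<le> e \<Longrightarrow>
      (\<And>x. x \<in> L \<Longrightarrow> nrm x \<le> 1 \<Longrightarrow> nrm (tail l (resolv A (complex_of_real \<rho>) (ap X x))) \<le> e) \<Longrightarrow> \<gamma> X \<le> C * e"
    using fredholm_gamma_le[OF A] by meson
  \<comment> \<open>Replacing r by \<open>\<rho>\<close> in the equation for \<open>X\<close> adds
    the term (r - \<open>\<rho>\<close>) X. For r so close to \<open>\<rho>\<close> that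
    \<open>C * (r - \<rho>)\<close> is at most 1/2, it is absorbed into the left side, whence the
    factor 2.\<close>
  have step: "\<gamma> X \<le> 2 * C * (\<gamma> Y + t * \<gamma> (mat_pow A N))"
    if X: "pos_op X" and Y: "pos_op Y" and t: "0 \<le> t" and r: "\<rho> < r" "C * (r - \<rho>) \<le> 1/2"
      and eq: "\<And>x. x \<in> L \<Longrightarrow> resolv A (complex_of_real r) (ap X x)
          = ap Y x - (\<lambda>i. complex_of_real t * ap (mat_pow A N) x i)" for X Y t r N
  proof -
    let ?P = "mat_pow A N"
    have P: "pos_op ?P" by (rule pos_op_pow[OF A])
    have "\<gamma> X \<le> C * ((r - \<rho>) * (\<gamma> X + \<epsilon>) + ((\<gamma> Y + \<epsilon>) + t * (\<gamma> ?P + \<epsilon>)))" if \<epsilon>: "\<epsilon> > 0" for \<epsilon>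
    proof -
      have "\<forall>\<^sub>F l in sequentially. tail_bound l (\<gamma> X + \<epsilon>) X \<and> tail_bound l (\<gamma> Y + \<epsilon>) Y \<and> tail_bound l (\<gamma> ?P + \<epsilon>) ?P"
        using \<epsilon> by (intro eventually_conj gamma_less_tail_bound X Y P) auto
      then obtain l where l: "tail_bound l (\<gamma> X + \<epsilon>) X" "tail_bound l (\<gamma> Y + \<epsilon>) Y" "tail_bound l (\<gamma> ?P + \<epsilon>) ?P"
        using eventually_happens'[OF sequentially_bot] by blast
      have unit: "nrm (tail l (ap B x)) \<le> \<gamma> B + \<epsilon>" if "tail_bound l (\<gamma> B + \<epsilon>) B" "pos_op B" "x \<in> L" "nrm x \<le> 1" for B x
      proof -
        have "(\<gamma> B + \<epsilon>) * nrm x \<le> (\<gamma> B + \<epsilon>) * 1"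
          using gamma_nonneg[OF that(2)] \<epsilon> by (intro mult_left_mono that(4)) auto
        then show ?thesis using tail_boundD[OF that(1,3)] by simp
      qed
      show ?thesis
      proof (rule fred[OF X, of _ l])
        show "0 \<le> (r - \<rho>) * (\<gamma> X + \<epsilon>) + ((\<gamma> Y + \<epsilon>) + t * (\<gamma> ?P + \<epsilon>))"
          using r t \<epsilon> gamma_nonneg[OF X] gamma_nonneg[OF Y] gamma_nonneg[OF P] by (intro add_nonneg_nonneg mult_nonneg_nonneg) auto
        fix x assume x: "x \<in> L" "nrm x \<le> 1"
        let ?X = "tail l (ap X x)" and ?Y = "tail l (ap Y x)" and ?Q = "tail l (ap ?P x)"
        have XL: "?X \<in> L" "?Y \<in> L" "?Q \<in> L" by (intro tail_in ap_in X Y P x)+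
        have "resolv A (complex_of_real \<rho>) (ap X x) = resolv A (complex_of_real r) (ap X x) - (\<lambda>i. complex_of_real (r - \<rho>) * ap X x i)"
          by (simp add: fun_eq_iff algebra_simps)
        also have "\<dots> = (ap Y x - (\<lambda>i. complex_of_real t * ap ?P x i)) - (\<lambda>i. complex_of_real (r - \<rho>) * ap X x i)"
          by (simp only: eq[OF x(1)])
        finally have "tail l (resolv A (complex_of_real \<rho>) (ap X x)) = (?Y - (\<lambda>i. complex_of_real t * ?Q i)) - (\<lambda>i. complex_of_real (r - \<rho>) * ?X i)"
          by (simp only: tail_diff tail_scale)
        then have "nrm (tail l (resolv A (complex_of_real \<rho>) (ap X x)))
            \<le> nrm (?Y - (\<lambda>i. complex_of_real t * ?Q i)) + nrm (\<lambda>i. complex_of_real (r - \<rho>) * ?X i)"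
          using nrm_diff[OF diff_in[OF XL(2) scale_in[OF XL(3)]] scale_in[OF XL(1)]] by (simp only:)
        also have "nrm (?Y - (\<lambda>i. complex_of_real t * ?Q i)) \<le> nrm ?Y + nrm (\<lambda>i. complex_of_real t * ?Q i)"
          by (intro nrm_diff scale_in XL)
        also have "nrm (\<lambda>i. complex_of_real t * ?Q i) = t * nrm ?Q" unfolding nrm_scale[OF XL(3)] using t by simp
        also have "nrm (\<lambda>i. complex_of_real (r - \<rho>) * ?X i) = (r - \<rho>) * nrm ?X"
          unfolding nrm_scale[OF XL(1)] norm_of_real using r by simp
        also have "nrm ?Y + t * nrm ?Q + (r - \<rho>) * nrm ?X \<le> (\<gamma> Y + \<epsilon>) + t * (\<gamma> ?P + \<epsilon>) + (r - \<rho>) * (\<gamma> X + \<epsilon>)"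
          using r t by (intro add_mono mult_left_mono unit l X Y P x) auto
        finally show "nrm (tail l (resolv A (complex_of_real \<rho>) (ap X x))) \<le> (r - \<rho>) * (\<gamma> X + \<epsilon>) + ((\<gamma> Y + \<epsilon>) + t * (\<gamma> ?P + \<epsilon>))"
          by (simp only: add.commute)
      qed
    qed
    note le = this
    have "\<gamma> X \<le> C * ((r - \<rho>) * (\<gamma> X + 0) + ((\<gamma> Y + 0) + t * (\<gamma> ?P + 0)))"
    proof (rule tendsto_lowerbound)
      show "((\<lambda>\<epsilon>. C * ((r - \<rho>) * (\<gamma> X + \<epsilon>) + ((\<gamma> Y + \<epsilon>) + t * (\<gamma> ?P + \<epsilon>)))) \<longlongrightarrow>
         C * ((r - \<rho>) * (\<gamma> X + 0) + ((\<gamma> Y + 0) + t * (\<gamma> ?P + 0)))) (at_right 0)"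
        by (intro tendsto_intros)
      show "\<forall>\<^sub>F \<epsilon> in at_right 0. \<gamma> X \<le> C * ((r - \<rho>) * (\<gamma> X + \<epsilon>) + ((\<gamma> Y + \<epsilon>) + t * (\<gamma> ?P + \<epsilon>)))"
        unfolding eventually_at_right_field by (intro exI[of _ 1] conjI allI impI le) auto
    qed simp
    then have "\<gamma> X \<le> C * (r - \<rho>) * \<gamma> X + C * (\<gamma> Y + t * \<gamma> ?P)" by (simp add: algebra_simps)
    also have "C * (r - \<rho>) * \<gamma> X \<le> 1/2 * \<gamma> X" by (rule mult_right_mono[OF r(2) gamma_nonneg[OF X]])
    finally show ?thesis by simp
  qed
  \<comment> \<open>Two applications of \<open>step\<close>: first
    \<open>\<gamma> S <= 2 * C * (1 + 1)\<close>, the identity and the remainder contributing at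
    most 1 each, then \<open>\<gamma> D <= 2 * C * (\<gamma> S + 1)\<close>. The result does not
    depend on r, k or the truncation N.\<close>
  define Q where "Q = 2 * C * (2 * C * 2 + 1)"
  have bound: "real (Suc k) * \<rho> ^ k \<le> Q * r ^ (k + 2)" if k: "1 \<le> k" and r: "\<rho> < r" "C * (r - \<rho>) \<le> 1/2" for r k
  proof -
    have r0: "r > 0" using r \<rho> by simp
    \<comment> \<open>Strictly between \<open>\<rho>\<close> and r: the powers of \<open>A\<close>
      eventually satisfy the bound with \<open>e\<close>, and (e/r)^N tends to 0 even after
      multiplication by N, so both remainders are at most 1 for large N.\<close>
    define e where "e = (r + \<rho>) / 2"
    have e: "e > \<rho>" "e < r" "e > 0" using r \<rho> by (auto simp: e_def)
    have small: "(\<lambda>N. real N * (e / r) ^ N) \<longlonglongrightarrow> 0" "(\<lambda>N. (e / r) ^ N) \<longlonglongrightarrow> 0"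
      using powser_times_n_limit_0[of "e / r"] LIMSEQ_realpow_zero[of "e / r"] e r0 by auto
    have "\<forall>\<^sub>F N in sequentially. real N * (e / r) ^ N < r" "\<forall>\<^sub>F N in sequentially. (e / r) ^ N < 1"
      using r0 by (intro order_tendstoD(2)[OF small(1)] order_tendstoD(2)[OF small(2)]; simp)+
    then have "\<forall>\<^sub>F N in sequentially. real N * (e / r) ^ N < r \<and> (e / r) ^ N < 1 \<and> \<gamma> (mat_pow A N) \<le> e ^ N \<and> k < N"
      by (intro eventually_conj up e(1) eventually_gt_at_top)
    then obtain N where N: "real N * (e / r) ^ N < r" "(e / r) ^ N < 1" "\<gamma> (mat_pow A N) \<le> e ^ N" "k < N"
      using eventually_happens'[OF sequentially_bot] by blast
    let ?c1 = "\<lambda>k. 1 / r ^ Suc k" and ?c2 = "\<lambda>k. real (Suc k) / r ^ Suc (Suc k)"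
    have c1: "0 \<le> ?c1 k" and c2: "0 \<le> ?c2 k" for k using r0 by auto
    define S where "S = mat_poly ?c1 A N"
    define D where "D = mat_poly ?c2 A N"
    have S: "pos_op S" and D: "pos_op D" unfolding S_def D_def by (rule pos_op_poly[OF A c1], rule pos_op_poly[OF A c2])
    have "1 / r ^ N * \<gamma> (mat_pow A N) \<le> 1 / r ^ N * e ^ N" using r0 N(3) by (intro mult_left_mono) auto
    also have "\<dots> = (e / r) ^ N" by (simp add: power_divide)
    finally have t1: "1 / r ^ N * \<gamma> (mat_pow A N) \<le> 1" using N(2) by simp
    have "real N / r ^ Suc N * \<gamma> (mat_pow A N) \<le> real N / r ^ Suc N * e ^ N" using r0 N(3) by (intro mult_left_mono) auto
    also have "\<dots> = (real N * (e / r) ^ N) / r" by (simp add: power_divide)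
    also have "\<dots> \<le> 1" using N(1) r0 by simp
    finally have t2: "real N / r ^ Suc N * \<gamma> (mat_pow A N) \<le> 1" .
    have gI: "\<gamma> (ident_mat R) \<le> 1" by (rule gamma_le_bound[OF op_bound_ident])
    have "\<gamma> S \<le> 2 * C * (\<gamma> (ident_mat R) + 1 / r ^ N * \<gamma> (mat_pow A N))"
      unfolding S_def using r0
      by (intro step[OF pos_op_poly[OF A c1] pos_op_ident _ r]) (simp_all only: ident_apply poly_telescope(1)[OF A r0], simp)
    also have "\<dots> \<le> 2 * C * 2" using gI t1 C by (intro mult_left_mono) auto
    finally have gS: "\<gamma> S \<le> 2 * C * 2" .
    have "\<gamma> D \<le> 2 * C * (\<gamma> S + real N / r ^ Suc N * \<gamma> (mat_pow A N))"
      unfolding D_def S_def using r0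
      by (intro step[OF pos_op_poly[OF A c2] pos_op_poly[OF A c1] _ r]) (simp_all only: poly_telescope(2)[OF A r0], simp)
    also have "\<dots> \<le> Q" unfolding Q_def using gS t2 C by (intro mult_left_mono add_mono) auto
    finally have gD: "\<gamma> D \<le> Q" .
    have "?c2 k * \<rho> ^ k \<le> ?c2 k * \<gamma> (mat_pow A k)" by (intro mult_left_mono lo c2 k)
    also have "\<dots> \<le> \<gamma> (\<lambda>i j. ?c2 k * mat_pow A k i j)"
      using r0 by (intro gamma_mscale_ge pos_op_pow A) auto
    also have "\<dots> \<le> \<gamma> D"
    proof (rule gamma_mono[OF _ _ D])
      show "nonneg_mat R (\<lambda>i j. ?c2 k * mat_pow A k i j)"
        unfolding nonneg_mat_def by (intro ballI mult_nonneg_nonneg c2 pos_op_nonneg[OF pos_op_pow[OF A]])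
      show "(\<lambda>i j. ?c2 k * mat_pow A k i j) \<sqsubseteq> D" unfolding D_def by (rule poly_ge[OF A c2 N(4)])
    qed
    finally have "?c2 k * \<rho> ^ k \<le> Q" using gD by simp
    then show ?thesis using r0 by (simp add: field_simps)
  qed
  have lim: "real (Suc k) * \<rho> ^ k \<le> Q * \<rho> ^ (k + 2)" if k: "1 \<le> k" for k
  proof (rule tendsto_lowerbound)
    show "((\<lambda>r. Q * r ^ (k + 2)) \<longlongrightarrow> Q * \<rho> ^ (k + 2)) (at_right \<rho>)" by (intro tendsto_intros)
    show "\<forall>\<^sub>F r in at_right \<rho>. real (Suc k) * \<rho> ^ k \<le> Q * r ^ (k + 2)"
      unfolding eventually_at_right_field using C
      by (intro exI[of _ "\<rho> + 1 / (2 * C)"] conjI allI impI bound k) (auto simp: field_simps)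
  qed simp
  \<comment> \<open>Dividing by \<open>\<rho> ^ k\<close> leaves a bound on k + 1 that does not
    depend on k.\<close>
  have fin: "real (Suc k) \<le> Q * \<rho>\<^sup>2" if k: "1 \<le> k" for k
  proof -
    have "real (Suc k) * \<rho> ^ k \<le> (Q * \<rho>\<^sup>2) * \<rho> ^ k" using lim[OF k] by (simp add: power_add power2_eq_square mult_ac)
    then show ?thesis using \<rho> by (simp only: mult_le_cancel_right_pos zero_less_power)
  qed
  have "real (Suc (Suc k)) \<le> Q * \<rho>\<^sup>2" for k by (rule fin) simp
  moreover obtain k where "Q * \<rho>\<^sup>2 < real k" using reals_Archimedean2 by blast
  ultimately have "real (Suc (Suc k)) < real k" by (rule le_less_trans)
  then show False by simp
qed

end

subsection \<open>Hadamard products of operators\<close>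

text \<open>On the unit interval powers decrease with the exponent, so \<open>\<alpha>\<close> may
  be lowered to 1/m, where the arithmetic-geometric mean inequality applies.\<close>

lemma prod_powr_le_mean:
  fixes y :: "nat \<Rightarrow> real"
  assumes m: "1 \<le> m" and \<alpha>: "1 / real m \<le> \<alpha>" and y: "\<And>k. k \<in> {1..m} \<Longrightarrow> 0 \<le> y k \<and> y k \<le> 1"
  shows "(\<Prod>k=1..m. y k powr \<alpha>) \<le> (\<Sum>k=1..m. y k) / real m"
proof -
  have "(\<Prod>k=1..m. y k powr \<alpha>) \<le> (\<Prod>k=1..m. y k powr (1 / real m))"
    using y \<alpha> by (intro prod_mono conjI powr_mono') auto
  also have "\<dots> = (\<Prod>k=1..m. y k) powr (1 / real m)"
    by (rule prod_powr_distrib[symmetric])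
  also have "\<dots> \<le> (\<Sum>k=1..m. y k) / real m"
    using arith_geom_mean[of "{1..m}" y] y m by (simp add: sum_divide_distrib)
  finally show ?thesis .
qed

text \<open>The right side is linear in the \<open>x k\<close>, so an estimate of entries turns into
  an estimate of operators or of sums. When each \<open>x k\<close> contributes at most
  \<open>c k\<close>, the mean is at most 1 and exactly the product of the
  \<open>c k powr \<alpha>\<close> remains.\<close>

lemma prod_powr_le_scaled_mean:
  fixes x c :: "nat \<Rightarrow> real"
  assumes m: "1 \<le> m" and \<alpha>: "1 / real m \<le> \<alpha>"
    and x: "\<And>k. k \<in> {1..m} \<Longrightarrow> 0 \<le> x k \<and> x k \<le> c k" and c: "\<And>k. k \<in> {1..m} \<Longrightarrow> 0 < c k"
  shows "(\<Prod>k=1..m. x k powr \<alpha>) \<le> (\<Prod>k=1..m. c k powr \<alpha>) / real m * (\<Sum>k=1..m. 1 / c k * x k)"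
proof -
  have "(\<Prod>k=1..m. x k powr \<alpha>) = (\<Prod>k=1..m. c k powr \<alpha> * (x k / c k) powr \<alpha>)"
  proof (intro prod.cong refl)
    fix k assume "k \<in> {1..m}"
    then show "x k powr \<alpha> = c k powr \<alpha> * (x k / c k) powr \<alpha>"
      using x[of k] c[of k] by (simp add: powr_divide)
  qed
  also have "\<dots> = (\<Prod>k=1..m. c k powr \<alpha>) * (\<Prod>k=1..m. (x k / c k) powr \<alpha>)"
    by (rule prod.distrib)
  also have "\<dots> \<le> (\<Prod>k=1..m. c k powr \<alpha>) * ((\<Sum>k=1..m. x k / c k) / real m)"
    using x c by (intro mult_left_mono prod_powr_le_mean m \<alpha> prod_nonneg) (auto simp: less_imp_le)
  finally show ?thesis by (simp add: divide_inverse mult_ac)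
qed

lemma has_sum_finite_sum:
  fixes f :: "'k \<Rightarrow> 'a \<Rightarrow> real"
  assumes "finite K" "\<And>k. k \<in> K \<Longrightarrow> (f k has_sum s k) A"
  shows "((\<lambda>p. \<Sum>k\<in>K. f k p) has_sum (\<Sum>k\<in>K. s k)) A"
  using assms by (induction K rule: finite_induct) (auto intro: has_sum_add)

definition hadamard :: "nat \<Rightarrow> real \<Rightarrow> (nat \<Rightarrow> mat) \<Rightarrow> mat" where
  "hadamard m \<alpha> A = (\<lambda>i j. \<Prod>k=1..m. A k i j powr \<alpha>)"

context oc_seq_space begin

lemma op_bound_msum:
  assumes "finite K" "\<And>k. k \<in> K \<Longrightarrow> op_bound (M k) (A k)"
  shows "op_bound (\<Sum>k\<in>K. M k) (\<lambda>i j. \<Sum>k\<in>K. A k i j)"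
  using assms
proof (induction K rule: finite_induct)
  case empty
  show ?case using op_bound_mscale(1)[OF op_bound_ident, of 0] by simp
next
  case (insert k K)
  then have "op_bound (M k + (\<Sum>k\<in>K. M k)) (\<lambda>i j. A k i j + (\<Sum>k\<in>K. A k i j))"
    by (intro op_bound_madd(1)) auto
  then show ?case using insert.hyps by simp
qed

lemma op_bound_mono: "op_bound M A \<Longrightarrow> M \<le> N \<Longrightarrow> op_bound N A"
  unfolding op_bound_def by (meson mult_right_mono nrm_nonneg order_trans)

lemma hadamard_nonneg: "nonneg_mat R (hadamard m \<alpha> A)"
  by (auto simp: nonneg_mat_def hadamard_def intro!: prod_nonneg)

text \<open>By \<open>entry_le\<close> the entries of \<open>A k\<close> are at most
  \<open>c k\<close>. The Hadamard product is therefore entrywise below a multiple of the mean of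
  the contractions \<open>A k / c k\<close>.\<close>

lemma op_bound_hadamard:
  assumes m: "1 \<le> m" and \<alpha>: "1 / real m \<le> \<alpha>"
    and A: "\<And>k. k \<in> {1..m} \<Longrightarrow> op_bound (c k) (A k)" and c: "\<And>k. k \<in> {1..m} \<Longrightarrow> 0 < c k"
  shows "op_bound (\<Prod>k=1..m. c k powr \<alpha>) (hadamard m \<alpha> A)"
proof (rule op_bound_mat_le[OF hadamard_nonneg])
  let ?P = "\<Prod>k=1..m. c k powr \<alpha>"
  let ?D = "\<lambda>i j. ?P / real m * (\<Sum>k=1..m. 1 / c k * A k i j)"
  have "op_bound (?P / real m * (\<Sum>k=1..m. 1 / c k * c k)) ?D"
    using c by (intro op_bound_mscale(1) op_bound_msum A divide_nonneg_nonneg prod_nonneg) (auto simp: less_imp_le)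
  moreover have "(\<Sum>k=1..m. 1 / c k * c k) = (\<Sum>k=1..m. 1)"
    using c by (intro sum.cong refl) (auto simp: less_imp_neq[symmetric])
  ultimately show "op_bound ?P ?D" using m by simp
  show "hadamard m \<alpha> A \<sqsubseteq> ?D"
    unfolding mat_le_def hadamard_def
    using entry_le[OF A] pos_op_nonneg[OF op_bound_pos_op[OF A]]
    by (intro ballI prod_powr_le_scaled_mean m \<alpha> c conjI) auto
qed

lemma pos_op_hadamard:
  assumes m: "1 \<le> m" and \<alpha>: "1 / real m \<le> \<alpha>" and A: "\<And>k. k \<in> {1..m} \<Longrightarrow> pos_op (A k)"
  shows "pos_op (hadamard m \<alpha> A)"
proof -
  have "\<exists>c>0. op_bound c (A k)" if k: "k \<in> {1..m}" for k
  proof -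
    obtain M where M: "op_bound M (A k)" "0 \<le> M" using A[OF k] by (rule pos_opE)
    \<comment> \<open>\<open>op_bound_hadamard\<close> divides by the bounds, so they must be
      positive.\<close>
    then show ?thesis by (intro exI[of _ "M + 1"] conjI op_bound_mono[OF M(1)]) auto
  qed
  then obtain c where "\<And>k. k \<in> {1..m} \<Longrightarrow> 0 < c k \<and> op_bound (c k) (A k)" by metis
  then show ?thesis using op_bound_hadamard[OF m \<alpha>, of c A] op_bound_pos_op by blast
qed

text \<open>Turns a tail estimate into a norm estimate for another nonnegative matrix, to which
  \<open>op_bound_hadamard\<close> applies.\<close>

definition tail_mat :: "nat \<Rightarrow> mat \<Rightarrow> mat" where
  "tail_mat l A = (\<lambda>i j. if i < l then 0 else A i j)"

lemma tail_mat_apply: "ap (tail_mat l A) x = tail l (ap A x)"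
  by (auto simp: mat_apply_def tail_mat_def tail_def fun_eq_iff)

lemma tail_bound_iff:
  assumes A: "pos_op A" and e: "0 \<le> e"
  shows "tail_bound l e A \<longleftrightarrow> op_bound e (tail_mat l A)"
proof -
  have "pos_op (tail_mat l A)"
    by (rule pos_op_mat_le[OF _ _ A]) (use pos_op_nonneg[OF A] in \<open>auto simp: nonneg_mat_def mat_le_def tail_mat_def\<close>)
  then show ?thesis using e by (auto simp: pos_op_def op_bound_def tail_bound_def tail_mat_apply)
qed

text \<open>In the cleared rows both sides are 0 since \<open>0 powr \<alpha> = 0\<close>; for m = 0
  the empty product on the left would be 1 there.\<close>

lemma hadamard_tail_mat: "1 \<le> m \<Longrightarrow> hadamard m \<alpha> (\<lambda>k. tail_mat l (A k)) = tail_mat l (hadamard m \<alpha> A)"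
  by (auto simp: hadamard_def tail_mat_def fun_eq_iff)

text \<open>The norm inequality applied to row tails cut at a common index, with bounds
  \<open>\<gamma> (A k) + \<epsilon>\<close> that are positive; then \<open>\<epsilon>\<close> tends
  to 0.\<close>

lemma gamma_hadamard:
  assumes m: "1 \<le> m" and \<alpha>: "1 / real m \<le> \<alpha>" and A: "\<And>k. k \<in> {1..m} \<Longrightarrow> pos_op (A k)"
  shows "\<gamma> (hadamard m \<alpha> A) \<le> (\<Prod>k=1..m. \<gamma> (A k) powr \<alpha>)"
proof -
  have \<alpha>0: "\<alpha> > 0" using m \<alpha> by (meson less_le_trans of_nat_0_less_iff zero_less_divide_1_iff zero_less_one order_less_le_trans)
  have H: "pos_op (hadamard m \<alpha> A)" by (rule pos_op_hadamard[OF m \<alpha> A])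
  have le: "\<gamma> (hadamard m \<alpha> A) \<le> (\<Prod>k=1..m. (\<gamma> (A k) + \<epsilon>) powr \<alpha>)" if \<epsilon>: "\<epsilon> > 0" for \<epsilon>
  proof -
    let ?c = "\<lambda>k. \<gamma> (A k) + \<epsilon>"
    have c: "0 < ?c k" if "k \<in> {1..m}" for k using gamma_nonneg[OF A[OF that]] \<epsilon> by simp
    have "\<forall>\<^sub>F l in sequentially. \<forall>k\<in>{1..m}. tail_bound l (?c k) (A k)"
      using \<epsilon> by (intro eventually_ball_finite ballI gamma_less_tail_bound A) auto
    then obtain l where l: "\<forall>k\<in>{1..m}. tail_bound l (?c k) (A k)"
      using eventually_happens'[OF sequentially_bot] by blast
    have "op_bound (\<Prod>k=1..m. ?c k powr \<alpha>) (hadamard m \<alpha> (\<lambda>k. tail_mat l (A k)))"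
      using l c A by (intro op_bound_hadamard[OF m \<alpha>]) (auto simp: tail_bound_iff less_imp_le)
    then have "tail_bound l (\<Prod>k=1..m. ?c k powr \<alpha>) (hadamard m \<alpha> A)"
      unfolding hadamard_tail_mat[OF m] using tail_bound_iff[OF H] by (simp add: prod_nonneg)
    then show ?thesis by (rule gamma_le[OF H]) (simp add: prod_nonneg)
  qed
  have "\<gamma> (hadamard m \<alpha> A) \<le> (\<Prod>k=1..m. (\<gamma> (A k) + 0) powr \<alpha>)"
  proof (rule tendsto_lowerbound)
    show "((\<lambda>\<epsilon>. \<Prod>k=1..m. (\<gamma> (A k) + \<epsilon>) powr \<alpha>) \<longlongrightarrow> (\<Prod>k=1..m. (\<gamma> (A k) + 0) powr \<alpha>)) (at_right 0)"
    proof (intro tendsto_prod tendsto_powr2 tendsto_intros)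
      show "\<forall>\<^sub>F \<epsilon> in at_right 0. 0 \<le> \<gamma> (A k) + \<epsilon>" if "k \<in> {1..m}" for k
        using gamma_nonneg[OF A[OF that]] unfolding eventually_at_right_field by (intro exI[of _ 1]) auto
    qed (rule \<alpha>0)
    show "\<forall>\<^sub>F \<epsilon> in at_right 0. \<gamma> (hadamard m \<alpha> A) \<le> (\<Prod>k=1..m. (\<gamma> (A k) + \<epsilon>) powr \<alpha>)"
      unfolding eventually_at_right_field by (intro exI[of _ 1] conjI allI impI le) auto
  qed simp
  then show ?thesis by simp
qed

text \<open>Hoelder's inequality for the weights \<open>1 / m\<close>, with the surplus of the exponent absorbed by
  \<open>x powr \<alpha> \<le> x powr (1 / m)\<close> on the unit interval.\<close>
lemma hadamard_mult:
  assumes m: "1 \<le> m" and \<alpha>: "1 / real m \<le> \<alpha>"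
    and A: "\<And>k. k \<in> {1..m} \<Longrightarrow> pos_op (A k)" and B: "\<And>k. k \<in> {1..m} \<Longrightarrow> pos_op (B k)"
  shows "mat_mult R (hadamard m \<alpha> A) (hadamard m \<alpha> B) \<sqsubseteq> hadamard m \<alpha> (\<lambda>k. mat_mult R (A k) (B k))"
  unfolding mat_le_def
proof (intro ballI)
  fix i j assume ij: "i \<in> R" "j \<in> R"
  define t where "t k p = A k i p * B k p j" for k p
  define s where "s k = (\<Sum>\<^sub>\<infinity>p\<in>R. t k p)" for k
  have t0: "0 \<le> t k p" if "k \<in> {1..m}" "p \<in> R" for k p
    unfolding t_def using that ij by (intro mult_nonneg_nonneg pos_op_nonneg A B)
  have ts: "t k summable_on R" if "k \<in> {1..m}" for k
    using mat_mult_summable[OF A[OF that] B[OF that] ij] by (simp add: t_def[abs_def])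
  have tle: "t k p \<le> s k" if "k \<in> {1..m}" "p \<in> R" for k p
    using finite_sum_le_infsum[OF ts[OF that(1)], of "{p}"] that t0 by (simp add: s_def)
  have s0: "0 \<le> s k" if "k \<in> {1..m}" for k unfolding s_def using t0 that by (intro infsum_nonneg) auto
  have lhs: "mat_mult R (hadamard m \<alpha> A) (hadamard m \<alpha> B) i j = (\<Sum>\<^sub>\<infinity>p\<in>R. \<Prod>k=1..m. t k p powr \<alpha>)"
    unfolding mat_mult_def
  proof (rule infsum_cong)
    fix p assume p: "p \<in> R"
    have "(\<Prod>k=1..m. t k p powr \<alpha>) = (\<Prod>k=1..m. A k i p powr \<alpha> * B k p j powr \<alpha>)"
      unfolding t_def by (intro prod.cong refl powr_mult)
    then show "hadamard m \<alpha> A i p * hadamard m \<alpha> B p j = (\<Prod>k=1..m. t k p powr \<alpha>)"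
      by (simp add: hadamard_def prod.distrib)
  qed
  have rhs: "hadamard m \<alpha> (\<lambda>k. mat_mult R (A k) (B k)) i j = (\<Prod>k=1..m. s k powr \<alpha>)"
    by (simp add: hadamard_def mat_mult_def s_def t_def)
  have "(\<Sum>\<^sub>\<infinity>p\<in>R. \<Prod>k=1..m. t k p powr \<alpha>) \<le> (\<Prod>k=1..m. s k powr \<alpha>)"
  proof (cases "\<exists>k\<in>{1..m}. s k = 0")
    case True
    then obtain k where k: "k \<in> {1..m}" "s k = 0" by blast
    have "(\<Prod>k=1..m. t k p powr \<alpha>) = 0" if "p \<in> R" for p
    proof -
      have "t k p = 0" using tle[OF k(1) that] t0[OF k(1) that] k(2) by simp
      then show ?thesis using k(1) by (intro prod_zero) auto
    qed
    then have "(\<Sum>\<^sub>\<infinity>p\<in>R. \<Prod>k=1..m. t k p powr \<alpha>) = 0" by (auto intro: infsum_0)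
    then show ?thesis by (simp add: prod_nonneg)
  next
    case False
    then have spos: "0 < s k" if "k \<in> {1..m}" for k using s0[OF that] that by force
    let ?P = "\<Prod>k=1..m. s k powr \<alpha>"
    let ?g = "\<lambda>p. ?P / real m * (\<Sum>k=1..m. 1 / s k * t k p)"
    have le: "(\<Prod>k=1..m. t k p powr \<alpha>) \<le> ?g p" if "p \<in> R" for p
      using that by (intro prod_powr_le_scaled_mean m \<alpha> conjI t0 tle spos)
    have hs: "((\<lambda>p. \<Sum>k=1..m. 1 / s k * t k p) has_sum (\<Sum>k=1..m. 1 / s k * s k)) R"
      unfolding s_def using ts by (intro has_sum_finite_sum has_sum_cmult_right has_sum_infsum) auto
    have gs: "(?g has_sum (?P / real m * (\<Sum>k=1..m. 1 / s k * s k))) R"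
      by (rule has_sum_cmult_right[OF hs])
    have "(\<Sum>k=1..m. 1 / s k * s k) = (\<Sum>k=1..m. 1)"
      using spos by (intro sum.cong refl) (auto simp: less_imp_neq[symmetric])
    then have gs': "(?g has_sum ?P) R" using gs m by simp
    have "(\<lambda>p. \<Prod>k=1..m. t k p powr \<alpha>) summable_on R"
      by (rule summable_on_comparison_test[OF has_sum_imp_summable[OF gs'] le]) (auto intro: prod_nonneg)
    then have "(\<Sum>\<^sub>\<infinity>p\<in>R. \<Prod>k=1..m. t k p powr \<alpha>) \<le> (\<Sum>\<^sub>\<infinity>p\<in>R. ?g p)"
      by (rule infsum_mono[OF _ has_sum_imp_summable[OF gs'] le])
    then show ?thesis using infsumI[OF gs'] by simp
  qed
  then show "mat_mult R (hadamard m \<alpha> A) (hadamard m \<alpha> B) i j \<le> hadamard m \<alpha> (\<lambda>k. mat_mult R (A k) (B k)) i j"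
    by (simp add: lhs rhs)
qed

end

subsection \<open>Sets of operators and their radii\<close>

text \<open>Fekete's lemma in multiplicative form, without logarithms because \<open>u\<close> may
  vanish. The limit is the infimum of the roots; the two power estimates are what the radii need
  beyond convergence.\<close>

lemma fekete:
  fixes u :: "nat \<Rightarrow> real"
  assumes u0: "\<And>k. 0 \<le> u k" and sub: "\<And>a b. u (a + b) \<le> u a * u b"
  shows "\<exists>\<rho>\<ge>0. (\<lambda>k. u (Suc k) powr (1 / real (Suc k))) \<longlonglongrightarrow> \<rho> \<and> (\<forall>k\<ge>1. \<rho> ^ k \<le> u k)
     \<and> (\<forall>e>\<rho>. \<forall>\<^sub>F k in sequentially. u k \<le> e ^ k)"
proof -
  define v where "v k = u k powr (1 / real k)" for k
  have v0: "0 \<le> v k" for k by (simp add: v_def)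
  have vpow: "v k ^ k = u k" if "1 \<le> k" for k
  proof (cases "u k = 0")
    case True
    then show ?thesis using that by (simp add: v_def)
  next
    case False
    then have "u k > 0" using u0[of k] by simp
    then have "v k > 0" by (simp add: v_def)
    then have "v k ^ k = v k powr real k" by (simp add: powr_realpow)
    then show ?thesis using that \<open>u k > 0\<close> by (simp add: v_def powr_powr)
  qed
  define \<rho> where "\<rho> = Inf (v ` {1..})"
  have bdd: "bdd_below (v ` {1..})" using v0 by (intro bdd_belowI[of _ 0]) auto
  have \<rho>0: "0 \<le> \<rho>" unfolding \<rho>_def using v0 by (intro cInf_greatest) auto
  have \<rho>le: "\<rho> \<le> v k" if "1 \<le> k" for k unfolding \<rho>_def using that by (intro cInf_lower bdd) auto
  have lo: "\<rho> ^ k \<le> u k" if "1 \<le> k" for k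
    using power_mono[OF \<rho>le[OF that] \<rho>0, of k] vpow[OF that] by simp
  have up: "\<forall>\<^sub>F k in sequentially. u k \<le> e ^ k" if e: "e > \<rho>" for e
  proof -
    obtain p where p: "1 \<le> p" "v p < e"
      using e cInf_lessD[of "v ` {1..}" e] unfolding \<rho>_def by auto
    \<comment> \<open>The alternative \<open>e / 2\<close> keeps \<open>t\<close> positive when
      \<open>v p = 0\<close>, so that division by powers of \<open>t\<close> is possible.\<close>
    define t where "t = max (v p) (e / 2)"
    have e0: "e > 0" using e \<rho>0 by simp
    have t: "0 < t" "t < e" "v p \<le> t" using e0 p by (auto simp: t_def)
    have up: "u p \<le> t ^ p" using vpow[OF p(1)] power_mono[OF t(3) v0, of p] by simp
    \<comment> \<open>Absorbs the remainder \<open>s\<close> of the division of n by p, uniformly in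
      n.\<close>
    define D where "D = (\<Sum>s<p. u s / t ^ s)"
    have mult: "u (p * q + s) \<le> t ^ (p * q) * u s" for q s
    proof (induction q)
      case (Suc q)
      have "u (p * Suc q + s) = u (p + (p * q + s))" by (simp add: algebra_simps)
      also have "\<dots> \<le> u p * u (p * q + s)" by (rule sub)
      also have "\<dots> \<le> t ^ p * (t ^ (p * q) * u s)" using up Suc u0 t by (intro mult_mono) auto
      finally show ?case by (simp add: power_add mult_ac)
    qed simp
    have Dn: "u n \<le> D * t ^ n" for n
    proof -
      define q s where "q = n div p" and "s = n mod p"
      have n: "n = p * q + s" by (simp add: q_def s_def)
      have s: "s < p" using p by (simp add: s_def)
      have "u n \<le> t ^ (p * q) * u s" unfolding n by (rule mult)
      also have "\<dots> = (u s / t ^ s) * t ^ n" unfolding n using t by (simp add: power_add)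
      also have "\<dots> \<le> D * t ^ n"
        unfolding D_def using s t u0 by (intro mult_right_mono member_le_sum) auto
      finally show ?thesis .
    qed
    have "(\<lambda>n. D * (t / e) ^ n) \<longlonglongrightarrow> D * 0"
      using t by (intro tendsto_intros LIMSEQ_realpow_zero) auto
    then have "\<forall>\<^sub>F n in sequentially. D * (t / e) ^ n < 1" by (intro order_tendstoD(2)) auto
    then show ?thesis
    proof (rule eventually_mono)
      fix n assume "D * (t / e) ^ n < 1"
      then have "D * t ^ n \<le> e ^ n" using e0 by (simp add: power_divide field_simps)
      then show "u n \<le> e ^ n" using Dn[of n] by simp
    qed
  qed
  have "(\<lambda>k. v (Suc k)) \<longlonglongrightarrow> \<rho>"
  proof (rule order_tendstoI)
    fix a assume "a < \<rho>"
    then show "\<forall>\<^sub>F k in sequentially. a < v (Suc k)" 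
      by (intro always_eventually allI less_le_trans[OF _ \<rho>le]) auto
  next
    fix a assume a: "\<rho> < a"
    obtain e where e: "\<rho> < e" "e < a" using dense[OF a] by blast
    have e0: "e > 0" using e \<rho>0 by simp
    have "\<forall>\<^sub>F k in sequentially. u (Suc k) \<le> e ^ Suc k" 
      using up[OF e(1)] eventually_sequentially_Suc[of "\<lambda>k. u k \<le> e ^ k"] by simp
    then show "\<forall>\<^sub>F k in sequentially. v (Suc k) < a"
    proof (rule eventually_mono)
      fix k assume "u (Suc k) \<le> e ^ Suc k"
      then have "v (Suc k) \<le> (e ^ Suc k) powr (1 / real (Suc k))"
        unfolding v_def using u0 by (intro powr_mono2) auto
      also have "\<dots> = e" using e0 by (simp add: powr_realpow[symmetric] powr_powr del: power_Suc)
      finally show "v (Suc k) < a" using e by simp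
    qed
  qed
  then show ?thesis using \<rho>0 lo up unfolding v_def by blast
qed

context oc_seq_space begin

section \<open>Products and powers of sets of matrices up to entrywise domination\<close>

definition adm :: "mat set \<Rightarrow> bool" where
  "adm S \<longleftrightarrow> (\<exists>M\<ge>0. \<forall>A\<in>S. op_bound M A)"

lemma adm_pos_op: "adm S \<Longrightarrow> A \<in> S \<Longrightarrow> pos_op A"
  by (auto simp: adm_def pos_op_def)

lemma adm_singleton: "pos_op A \<Longrightarrow> adm {A}"
  using pos_opE by (fastforce simp: adm_def)

lemma adm_ident: "adm {ident_mat R}"
  by (intro adm_singleton pos_op_ident)

lemma adm_mult: assumes "adm S" "adm T" shows "adm (set_mult R S T)"
proof -
  obtain M N where "M \<ge> 0" "N \<ge> 0" "\<forall>A\<in>S. op_bound M A" "\<forall>A\<in>T. op_bound N A"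
    using assms by (auto simp: adm_def)
  then show ?thesis unfolding adm_def set_mult_def
    by (intro exI[of _ "M * N"]) (auto intro: op_bound_mult)
qed

lemma adm_pow: "adm S \<Longrightarrow> adm (set_pow R S k)"
  by (induction k) (auto intro: adm_mult adm_ident)

lemma adm_list: "(\<And>S. S \<in> set Ss \<Longrightarrow> adm S) \<Longrightarrow> adm (list_prod R Ss)"
  by (induction Ss) (auto intro: adm_mult adm_ident)

definition dominated :: "mat set \<Rightarrow> mat set \<Rightarrow> bool" (infix "\<preceq>" 50) where
  "S \<preceq> T \<longleftrightarrow> (\<forall>X\<in>S. \<exists>Y\<in>T. X \<sqsubseteq> Y)"

lemma dom_refl: "S \<preceq> S"
  unfolding dominated_def using mat_le_refl by blast

lemma dom_trans [trans]: "S \<preceq> T \<Longrightarrow> T \<preceq> U \<Longrightarrow> S \<preceq> U"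
  unfolding dominated_def using mat_le_trans by meson

lemma dom_mult:
  assumes "adm S" "adm T" "adm S'" "adm T'" "S \<preceq> S'" "T \<preceq> T'"
  shows "set_mult R S T \<preceq> set_mult R S' T'"
  unfolding dominated_def
proof
  fix X assume "X \<in> set_mult R S T"
  then obtain A B where X: "X = mat_mult R A B" "A \<in> S" "B \<in> T" by (auto simp: set_mult_def)
  obtain A' B' where Y: "A' \<in> S'" "A \<sqsubseteq> A'" "B' \<in> T'" "B \<sqsubseteq> B'" using assms(5,6) X unfolding dominated_def by meson
  have "X \<sqsubseteq> mat_mult R A' B'" unfolding X(1)
    using X Y assms by (intro mat_mult_mono) (auto intro: adm_pos_op)
  then show "\<exists>Y\<in>set_mult R S' T'. X \<sqsubseteq> Y" using Y by (auto simp: set_mult_def)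
qed

text \<open>Replaces equality of sets. Products that agree on R x R may differ as functions, for
  instance \<open>mat_mult R A (ident_mat R)\<close> and \<open>A\<close> in the columns outside
  \<open>R\<close>; the radii do not see this difference.\<close>

definition set_equiv :: "mat set \<Rightarrow> mat set \<Rightarrow> bool" (infix "\<doteq>" 50) where
  "S \<doteq> T \<longleftrightarrow> S \<preceq> T \<and> T \<preceq> S"

lemma set_equiv_refl: "S \<doteq> S" by (simp add: set_equiv_def dom_refl)

lemma set_equiv_sym: "S \<doteq> T \<Longrightarrow> T \<doteq> S" by (simp add: set_equiv_def)

lemma set_equiv_trans [trans]: "S \<doteq> T \<Longrightarrow> T \<doteq> U \<Longrightarrow> S \<doteq> U"
  unfolding set_equiv_def using dom_trans by blast

lemma set_equiv_mult:
  assumes "adm S" "adm T" "adm S'" "adm T'" "S \<doteq> S'" "T \<doteq> T'"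
  shows "set_mult R S T \<doteq> set_mult R S' T'"
  using assms by (simp add: set_equiv_def dom_mult)

lemma set_mult_assoc:
  assumes "adm S" "adm T" "adm U"
  shows "set_mult R (set_mult R S T) U \<doteq> set_mult R S (set_mult R T U)"
proof -
  have le: "mat_mult R (mat_mult R A B) C \<sqsubseteq> mat_mult R A (mat_mult R B C)"
    "mat_mult R A (mat_mult R B C) \<sqsubseteq> mat_mult R (mat_mult R A B) C"
    if "A \<in> S" "B \<in> T" "C \<in> U" for A B C
    unfolding mat_le_def using assms that mat_mult_assoc[of A B C] adm_pos_op by auto
  then show ?thesis unfolding set_equiv_def dominated_def set_mult_def by blast
qed

lemma set_mult_ident:
  shows "set_mult R S {ident_mat R} \<doteq> S" "set_mult R {ident_mat R} S \<doteq> S"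
proof -
  have le: "mat_mult R A (ident_mat R) \<sqsubseteq> A" "A \<sqsubseteq> mat_mult R A (ident_mat R)"
    "mat_mult R (ident_mat R) A \<sqsubseteq> A" "A \<sqsubseteq> mat_mult R (ident_mat R) A" for A
    unfolding mat_le_def by (auto simp: mat_mult_ident)
  then show "set_mult R S {ident_mat R} \<doteq> S" "set_mult R {ident_mat R} S \<doteq> S"
    unfolding set_equiv_def dominated_def set_mult_def by blast+
qed

lemma list_prod_append:
  assumes "\<And>S. S \<in> set xs \<union> set ys \<Longrightarrow> adm S"
  shows "list_prod R (xs @ ys) \<doteq> set_mult R (list_prod R xs) (list_prod R ys)"
  using assms
proof (induction xs)
  case Nil
  then show ?case using set_equiv_sym[OF set_mult_ident(2)] by simp
next
  case (Cons S xs)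
  have a: "adm S" "adm (list_prod R xs)" "adm (list_prod R ys)" "adm (list_prod R (xs @ ys))"
    using Cons.prems by (auto intro!: adm_list)
  have "list_prod R ((S # xs) @ ys) \<doteq> set_mult R S (set_mult R (list_prod R xs) (list_prod R ys))"
    using a Cons by (auto intro!: set_equiv_mult adm_mult set_equiv_refl)
  also have "\<dots> \<doteq> set_mult R (list_prod R (S # xs)) (list_prod R ys)"
    using set_equiv_sym[OF set_mult_assoc[OF a(1-3)]] by simp
  finally show ?case .
qed

lemma list_prod_concat:
  assumes "\<And>xs S. xs \<in> set Ls \<Longrightarrow> S \<in> set xs \<Longrightarrow> adm S"
  shows "list_prod R (concat Ls) \<doteq> list_prod R (map (list_prod R) Ls)"
  using assms
proof (induction Ls)
  case Nil
  then show ?case by (simp add: set_equiv_refl)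
next
  case (Cons xs Ls)
  have a: "adm (list_prod R xs)" "adm (list_prod R (concat Ls))" "adm (list_prod R (map (list_prod R) Ls))"
    using Cons.prems by (intro adm_list; fastforce intro: adm_list)+
  have "list_prod R (concat (xs # Ls)) \<doteq> set_mult R (list_prod R xs) (list_prod R (concat Ls))"
    using Cons.prems list_prod_append[of xs "concat Ls"] by auto
  also have "\<dots> \<doteq> set_mult R (list_prod R xs) (list_prod R (map (list_prod R) Ls))"
    using a Cons by (intro set_equiv_mult set_equiv_refl) auto
  finally show ?case by simp
qed

lemma set_pow_list: "set_pow R S k = list_prod R (replicate k S)"
  by (induction k) auto

lemma set_pow_add:
  assumes "adm S" shows "set_pow R S (a + b) \<doteq> set_mult R (set_pow R S a) (set_pow R S b)"
  unfolding set_pow_list replicate_add using assms by (intro list_prod_append) auto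

lemma set_pow_pow:
  assumes "adm S" shows "set_pow R (set_pow R S n) k \<doteq> set_pow R S (n * k)"
proof -
  have "concat (replicate k (replicate n S)) = replicate (n * k) S"
    by (induction k) (auto simp: replicate_add[symmetric])
  then show ?thesis
    using list_prod_concat[of "replicate k (replicate n S)"] assms set_equiv_sym
    unfolding set_pow_list by (fastforce simp: map_replicate)
qed

text \<open>Regroups the alternating word in \<open>S\<close> and \<open>T\<close>. It is the source
  of r(ST) <= r(TS) for both radii.\<close>

lemma set_pow_rotate:
  assumes S: "adm S" and T: "adm T"
  shows "set_pow R (set_mult R S T) (Suc k) \<doteq> set_mult R S (set_mult R (set_pow R (set_mult R T S) k) T)"
proof (induction k)
  case 0
  have "set_mult R (set_mult R S T) {ident_mat R} \<doteq> set_mult R S T" by (rule set_mult_ident)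
  also have "\<dots> \<doteq> set_mult R S (set_mult R {ident_mat R} T)"
    by (intro set_equiv_mult S T adm_mult adm_ident set_equiv_refl set_equiv_sym[OF set_mult_ident(2)])
  finally show ?case by simp
next
  case (Suc k)
  let ?P = "set_pow R (set_mult R T S) k"
  have P: "adm ?P" by (intro adm_pow adm_mult S T)
  have "set_pow R (set_mult R S T) (Suc (Suc k)) = set_mult R (set_mult R S T) (set_pow R (set_mult R S T) (Suc k))" by simp
  also have "\<dots> \<doteq> set_mult R (set_mult R S T) (set_mult R S (set_mult R ?P T))"
    by (intro set_equiv_mult Suc set_equiv_refl adm_mult adm_pow P S T)
  also have "\<dots> \<doteq> set_mult R S (set_mult R T (set_mult R S (set_mult R ?P T)))"
    by (intro set_mult_assoc adm_mult P S T)
  also have "\<dots> \<doteq> set_mult R S (set_mult R (set_mult R T S) (set_mult R ?P T))"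
    by (intro set_equiv_mult set_equiv_refl set_equiv_sym[OF set_mult_assoc] adm_mult P S T)
  also have "\<dots> \<doteq> set_mult R S (set_mult R (set_mult R (set_mult R T S) ?P) T)"
    by (intro set_equiv_mult set_equiv_refl set_equiv_sym[OF set_mult_assoc] adm_mult P S T)
  finally show ?case by simp
qed

lemma set_pow_dom:
  assumes "adm S" "adm T" "S \<preceq> T"
  shows "set_pow R S k \<preceq> set_pow R T k"
  by (induction k) (auto intro!: dom_refl dom_mult adm_pow assms)

lemma set_pow_mono: "S \<subseteq> T \<Longrightarrow> set_pow R S k \<subseteq> set_pow R T k"
proof (induction k)
  case (Suc k)
  then show ?case unfolding set_pow.simps set_mult_def by blast
qed simp

text \<open>The inserted 0 is the value for the empty set, as in the definition of the radii; it
  leaves other suprema unchanged because \<open>\<gamma>\<close> is nonnegative on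
  operators.\<close>

definition gsup :: "mat set \<Rightarrow> real" where
  "gsup S = Sup (insert 0 (\<gamma> ` S))"

lemma gsup_bdd: assumes "adm S" shows "bdd_above (insert 0 (\<gamma> ` S))"
proof -
  obtain M where "\<forall>A\<in>S. op_bound M A" "M \<ge> 0" using assms by (auto simp: adm_def)
  then show ?thesis by (intro bdd_aboveI[of _ M]) (auto intro: gamma_le_bound)
qed

lemma gsup_nonneg: "adm S \<Longrightarrow> 0 \<le> gsup S"
  unfolding gsup_def by (intro cSup_upper gsup_bdd) auto

lemma gsup_upper: "adm S \<Longrightarrow> A \<in> S \<Longrightarrow> \<gamma> A \<le> gsup S"
  unfolding gsup_def by (intro cSup_upper gsup_bdd) auto

lemma gsup_least: "0 \<le> c \<Longrightarrow> (\<And>A. A \<in> S \<Longrightarrow> \<gamma> A \<le> c) \<Longrightarrow> gsup S \<le> c"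
  unfolding gsup_def by (intro cSup_least) auto

lemma gsup_dom: assumes "adm S" "adm T" "S \<preceq> T" shows "gsup S \<le> gsup T"
proof (rule gsup_least)
  fix X assume X: "X \<in> S"
  then obtain Y where Y: "Y \<in> T" "X \<sqsubseteq> Y" using assms(3) unfolding dominated_def by blast
  have "nonneg_mat R X" using adm_pos_op[OF assms(1) X] pos_op_nonneg by (auto simp: nonneg_mat_def)
  then have "\<gamma> X \<le> \<gamma> Y" using Y adm_pos_op[OF assms(2)] by (intro gamma_mono) auto
  then show "\<gamma> X \<le> gsup T" using gsup_upper[OF assms(2) Y(1)] by simp
qed (rule gsup_nonneg[OF assms(2)])

lemma gsup_equiv: "adm S \<Longrightarrow> adm T \<Longrightarrow> S \<doteq> T \<Longrightarrow> gsup S = gsup T"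
  using gsup_dom unfolding set_equiv_def by (meson antisym)

lemma gsup_mult: assumes "adm S" "adm T" shows "gsup (set_mult R S T) \<le> gsup S * gsup T"
proof (rule gsup_least)
  show "0 \<le> gsup S * gsup T" using assms gsup_nonneg by simp
  fix X assume "X \<in> set_mult R S T"
  then obtain A B where X: "X = mat_mult R A B" "A \<in> S" "B \<in> T" by (auto simp: set_mult_def)
  have "\<gamma> X \<le> \<gamma> A * \<gamma> B" unfolding X(1) using X assms adm_pos_op by (intro gamma_mult) auto
  also have "\<dots> \<le> gsup S * gsup T"
    using X assms by (intro mult_mono gsup_upper gamma_nonneg gsup_nonneg adm_pos_op) auto
  finally show "\<gamma> X \<le> gsup S * gsup T" .
qed

section \<open>The joint radius defined by the measure of noncompactness\<close>

abbreviation rh :: "mat set \<Rightarrow> real" where "rh \<equiv> rho_hat_ess_set R L nrm"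

text \<open>\<open>fekete\<close> for the submultiplicative sequence \<open>gsup\<close> of the
  powers of \<open>S\<close>. In particular the \<open>lim\<close> in the definition of the radius
  is a genuine limit.\<close>

lemma rh_facts:
  assumes S: "adm S"
  shows "0 \<le> rh S" "(\<lambda>k. gsup (set_pow R S (Suc k)) powr (1 / real (Suc k))) \<longlonglongrightarrow> rh S"
    "1 \<le> k \<Longrightarrow> rh S ^ k \<le> gsup (set_pow R S k)"
    "rh S < e \<Longrightarrow> \<forall>\<^sub>F k in sequentially. gsup (set_pow R S k) \<le> e ^ k"
proof -
  have sub: "gsup (set_pow R S (a + b)) \<le> gsup (set_pow R S a) * gsup (set_pow R S b)" for a b
    using gsup_mult[OF adm_pow[OF S] adm_pow[OF S], of a b]
      gsup_equiv[OF adm_pow[OF S] adm_mult[OF adm_pow[OF S] adm_pow[OF S]] set_pow_add[OF S], of a b] by simp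
  have n: "0 \<le> gsup (set_pow R S k)" for k by (rule gsup_nonneg[OF adm_pow[OF S]])
  obtain \<rho> where \<rho>: "\<rho> \<ge> 0" "(\<lambda>k. gsup (set_pow R S (Suc k)) powr (1 / real (Suc k))) \<longlonglongrightarrow> \<rho>"
    "\<forall>k\<ge>1. \<rho> ^ k \<le> gsup (set_pow R S k)" "\<forall>e>\<rho>. \<forall>\<^sub>F k in sequentially. gsup (set_pow R S k) \<le> e ^ k"
    using fekete[of "\<lambda>k. gsup (set_pow R S k)", OF n sub] by blast
  have "rh S = \<rho>"
    unfolding rho_hat_ess_set_def gsup_def[symmetric] by (rule limI[OF \<rho>(2)])
  then show "0 \<le> rh S" "(\<lambda>k. gsup (set_pow R S (Suc k)) powr (1 / real (Suc k))) \<longlonglongrightarrow> rh S"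
    "1 \<le> k \<Longrightarrow> rh S ^ k \<le> gsup (set_pow R S k)"
    "rh S < e \<Longrightarrow> \<forall>\<^sub>F k in sequentially. gsup (set_pow R S k) \<le> e ^ k"
    using \<rho> by auto
qed

lemma rh_dom:
  assumes "adm S" "adm T" "S \<preceq> T" shows "rh S \<le> rh T"
proof (rule LIMSEQ_le[OF rh_facts(2)[OF assms(1)] rh_facts(2)[OF assms(2)]])
  show "\<exists>N. \<forall>k\<ge>N. gsup (set_pow R S (Suc k)) powr (1 / real (Suc k)) \<le> gsup (set_pow R T (Suc k)) powr (1 / real (Suc k))"
    by (intro exI[of _ 0] allI impI powr_mono2 gsup_dom gsup_nonneg adm_pow set_pow_dom assms) auto
qed

lemma rh_pow:
  assumes S: "adm S" and n: "1 \<le> n" shows "rh (set_pow R S n) = rh S ^ n"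
proof (rule LIMSEQ_unique[OF rh_facts(2)[OF adm_pow[OF S]]])
  let ?v = "\<lambda>k. gsup (set_pow R S (Suc k)) powr (1 / real (Suc k))"
  \<comment> \<open>The roots are indexed with a shift by one, so the subsequence of exponents
    divisible by n is \<open>Suc (f k) = n * Suc k\<close>.\<close>
  define f where "f k = n * Suc k - 1" for k
  have "strict_mono f" using n by (intro strict_monoI_Suc) (auto simp: f_def algebra_simps)
  then have "(\<lambda>k. ?v (f k)) \<longlonglongrightarrow> rh S" using LIMSEQ_subseq_LIMSEQ[OF rh_facts(2)[OF S]] by (simp add: o_def)
  then have "(\<lambda>k. ?v (f k) ^ n) \<longlonglongrightarrow> rh S ^ n" by (intro tendsto_intros)
  moreover have "?v (f k) ^ n = gsup (set_pow R (set_pow R S n) (Suc k)) powr (1 / real (Suc k))" for k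
  proof -
    have f: "Suc (f k) = n * Suc k" using n by (simp add: f_def)
    have eq: "gsup (set_pow R S (n * Suc k)) = gsup (set_pow R (set_pow R S n) (Suc k))"
      by (rule gsup_equiv[OF adm_pow[OF S] adm_pow[OF adm_pow[OF S]] set_equiv_sym[OF set_pow_pow[OF S]]])
    let ?g = "gsup (set_pow R S (n * Suc k))"
    have "(?g powr (1 / real (n * Suc k))) ^ n = ?g powr (1 / real (Suc k))"
    proof (cases "?g = 0")
      case True then show ?thesis using n by (simp del: set_pow.simps)
    next
      case False
      then have "?g > 0" using gsup_nonneg[OF adm_pow[OF S], of "n * Suc k"] by simp
      then show ?thesis using n by (subst powr_realpow[symmetric]) (simp_all add: powr_powr del: set_pow.simps mult_Suc_right)
    qed
    then show ?thesis unfolding f eq .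
  qed
  ultimately show "(\<lambda>k. gsup (set_pow R (set_pow R S n) (Suc k)) powr (1 / real (Suc k))) \<longlonglongrightarrow> rh S ^ n" by simp
qed

text \<open>\<open>set_pow_rotate\<close> bounds \<open>gsup\<close> of (ST)^(k+1) by
  \<open>gsup S * gsup T\<close> times \<open>gsup\<close> of (TS)^k; the constant factor is
  negligible against exponential growth in k.\<close>

lemma rh_swap_le:
  assumes S: "adm S" and T: "adm T" shows "rh (set_mult R S T) \<le> rh (set_mult R T S)"
proof (rule dense_ge)
  let ?ST = "set_mult R S T" and ?TS = "set_mult R T S"
  have ST: "adm ?ST" and TS: "adm ?TS" by (intro adm_mult S T)+
  fix e assume e: "rh ?TS < e"
  then have e0: "e > 0" using rh_facts(1)[OF TS] by simp
  let ?C = "gsup S * gsup T"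
  have C0: "?C \<ge> 0" using gsup_nonneg S T by simp
  show "rh ?ST \<le> e"
  proof (rule ccontr)
    assume "\<not> rh ?ST \<le> e"
    then have r: "rh ?ST > e" by simp
    have "(\<lambda>k. ?C * (e / rh ?ST) ^ k) \<longlonglongrightarrow> ?C * 0"
      using r e0 by (intro tendsto_intros LIMSEQ_realpow_zero) auto
    then have "\<forall>\<^sub>F k in sequentially. ?C * (e / rh ?ST) ^ k < rh ?ST"
      by (rule order_tendstoD(2)) (use r e0 in simp)
    then obtain k where k: "?C * (e / rh ?ST) ^ k < rh ?ST" "gsup (set_pow R ?TS k) \<le> e ^ k"
      using eventually_happens'[OF sequentially_bot eventually_conj[OF _ rh_facts(4)[OF TS e]]] by blast
    let ?P = "set_pow R ?TS k"
    have P: "adm ?P" by (rule adm_pow[OF TS])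
    have "rh ?ST ^ Suc k \<le> gsup (set_pow R ?ST (Suc k))" by (rule rh_facts(3)[OF ST]) simp
    also have "\<dots> = gsup (set_mult R S (set_mult R ?P T))"
      by (intro gsup_equiv set_pow_rotate adm_pow adm_mult S T ST P)
    also have "\<dots> \<le> gsup S * gsup (set_mult R ?P T)" by (intro gsup_mult adm_mult S T P)
    also have "\<dots> \<le> gsup S * (gsup ?P * gsup T)" by (intro mult_left_mono gsup_mult gsup_nonneg S T P)
    also have "\<dots> = ?C * gsup ?P" by simp
    also have "\<dots> \<le> ?C * e ^ k" by (rule mult_left_mono[OF k(2) C0])
    finally have "rh ?ST * rh ?ST ^ k \<le> ?C * e ^ k" by simp
    then have "rh ?ST \<le> ?C * (e / rh ?ST) ^ k" using r e0 by (simp add: power_divide field_simps)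
    then show False using k(1) by simp
  qed
qed

text \<open>The essential spectrum lies in the disc of radius \<open>rh {A}\<close> by
  \<open>ess_spectrum_le\<close>. If the radius is positive, it is itself a point of the essential
  spectrum; if not, the 0 inserted in \<open>rho_ess\<close> attains it.\<close>

lemma rho_ess_eq: assumes A: "pos_op A" shows "rho_ess R L nrm A = rh {A}"
proof -
  have S: "adm {A}" by (rule adm_singleton[OF A])
  have g: "gsup (set_pow R {A} k) = \<gamma> (mat_pow A k)" for k
  proof -
    have "0 \<le> \<gamma> (mat_pow A k)" by (rule gamma_nonneg[OF pos_op_pow[OF A]])
    then show ?thesis unfolding set_pow_singleton gsup_def by (intro cSup_eq_maximum) auto
  qed
  note rf = rh_facts[OF S, unfolded g]
  have le: "cmod z \<le> rh {A}" if z: "z \<in> ess_spectrum R L nrm A" for z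
  proof (rule LIMSEQ_le_const[OF rf(2)], intro exI[of _ 0] allI impI)
    fix k
    have "cmod z ^ Suc k \<le> \<gamma> (mat_pow A (Suc k))" by (rule ess_spectrum_le[OF A z])
    then have "(cmod z ^ Suc k) powr (1 / real (Suc k)) \<le> \<gamma> (mat_pow A (Suc k)) powr (1 / real (Suc k))"
      by (intro powr_mono2) auto
    moreover have "(cmod z ^ Suc k) powr (1 / real (Suc k)) = cmod z"
      by (cases "z = 0") (simp_all add: powr_realpow[symmetric] powr_powr del: power_Suc)
    ultimately show "cmod z \<le> \<gamma> (mat_pow A (Suc k)) powr (1 / real (Suc k))" by simp
  qed
  show ?thesis
  proof (rule antisym)
    show "rho_ess R L nrm A \<le> rh {A}"
      unfolding rho_ess_def using le rf(1) by (intro cSup_least) auto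
    show "rh {A} \<le> rho_ess R L nrm A"
      unfolding rho_ess_def
    proof (rule cSup_upper)
      show "bdd_above (insert 0 (cmod ` ess_spectrum R L nrm A))"
        using le rf(1) by (intro bdd_aboveI[of _ "rh {A}"]) auto
      show "rh {A} \<in> insert 0 (cmod ` ess_spectrum R L nrm A)"
      proof (cases "rh {A} = 0")
        case False
        then have pos: "rh {A} > 0" using rf(1) by simp
        have "\<not> fredholm L nrm (resolv A (complex_of_real (rh {A})))"
          by (rule not_fredholm_at_radius[OF A pos rf(3) rf(4)])
        then have "complex_of_real (rh {A}) \<in> ess_spectrum R L nrm A" by (simp add: ess_spectrum_def)
        then show ?thesis using pos by (intro insertI2 image_eqI[of _ cmod "complex_of_real (rh {A})"]) auto
      qed simp
    qed
  qed
qed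

end

subsection \<open>Hadamard products of sets of operators\<close>

abbreviation (input) hadamard_pow :: "nat \<Rightarrow> real \<Rightarrow> (nat \<Rightarrow> mat set) \<Rightarrow> mat set" where
  "hadamard_pow m \<alpha> \<Theta> \<equiv> hadamard_set m (\<lambda>j. hpow_set \<alpha> (\<Theta> j))"

lemma hadamard_pow_eq:
  "hadamard_pow m \<alpha> \<Theta> = {hadamard m \<alpha> A | A. \<forall>k\<in>{1..m}. A k \<in> \<Theta> k}"
proof (intro set_eqI iffI)
  fix X assume "X \<in> hadamard_pow m \<alpha> \<Theta>"
  then obtain B where X: "X = (\<lambda>i j. \<Prod>k=1..m. B k i j)" and B: "\<forall>k\<in>{1..m}. B k \<in> hpow \<alpha> ` \<Theta> k"
    by (auto simp: hadamard_set_def hpow_set_def)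
  have "\<forall>k\<in>{1..m}. \<exists>A. A \<in> \<Theta> k \<and> B k = hpow \<alpha> A" using B by blast
  from bchoice[OF this] obtain A where A: "\<forall>k\<in>{1..m}. A k \<in> \<Theta> k \<and> B k = hpow \<alpha> (A k)" by blast
  have "X = hadamard m \<alpha> A"
    unfolding X hadamard_def using A by (intro ext prod.cong refl) (simp add: hpow_def)
  then show "X \<in> {hadamard m \<alpha> A | A. \<forall>k\<in>{1..m}. A k \<in> \<Theta> k}" using A by blast
next
  fix X assume "X \<in> {hadamard m \<alpha> A | A. \<forall>k\<in>{1..m}. A k \<in> \<Theta> k}"
  then obtain A where "X = hadamard m \<alpha> A" "\<forall>k\<in>{1..m}. A k \<in> \<Theta> k" by blast
  then show "X \<in> hadamard_pow m \<alpha> \<Theta>"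
    unfolding hadamard_set_def hpow_set_def
    by (intro CollectI exI[of _ "\<lambda>k. hpow \<alpha> (A k)"]) (auto simp: hadamard_def hpow_def)
qed

lemma hadamard_pow_one: "hadamard_pow 1 \<alpha> \<Theta> = hpow_set \<alpha> (\<Theta> 1)"
  by (auto simp: hadamard_set_def)

lemma hpow_set_hpow_set: "hpow_set a (hpow_set b S) = hpow_set (b * a) S"
  by (simp add: hpow_set_def image_image hpow_def powr_powr)

lemma hadamard_pow_reindex:
  assumes \<sigma>: "bij_betw \<sigma> {1..m} {1..m}"
  shows "hadamard_pow m \<alpha> (\<lambda>j. \<Theta> (\<sigma> j)) = hadamard_pow m \<alpha> \<Theta>"
proof -
  obtain \<tau> where \<tau>: "bij_betw \<tau> {1..m} {1..m}" "\<And>k. k \<in> {1..m} \<Longrightarrow> \<sigma> (\<tau> k) = k"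
    using \<sigma> by (metis bij_betw_inv_into bij_betw_inv_into_right)
  have re: "hadamard m \<alpha> (\<lambda>k. A (\<pi> k)) = hadamard m \<alpha> A" if "bij_betw \<pi> {1..m} {1..m}" for \<pi> A
    unfolding hadamard_def by (intro ext) (rule prod.reindex_bij_betw[OF that])
  show ?thesis unfolding hadamard_pow_eq
  proof (intro set_eqI iffI)
    fix X assume "X \<in> {hadamard m \<alpha> A | A. \<forall>k\<in>{1..m}. A k \<in> \<Theta> (\<sigma> k)}"
    then obtain A where A: "X = hadamard m \<alpha> A" "\<forall>k\<in>{1..m}. A k \<in> \<Theta> (\<sigma> k)" by blast
    have "A (\<tau> k) \<in> \<Theta> k" if "k \<in> {1..m}" for k
      using A(2) \<tau>(2)[OF that] bij_betw_apply[OF \<tau>(1) that] by metis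
    then show "X \<in> {hadamard m \<alpha> A | A. \<forall>k\<in>{1..m}. A k \<in> \<Theta> k}"
      using re[OF \<tau>(1), of A] A(1) by (intro CollectI exI[of _ "\<lambda>k. A (\<tau> k)"]) auto
  next
    fix X assume "X \<in> {hadamard m \<alpha> A | A. \<forall>k\<in>{1..m}. A k \<in> \<Theta> k}"
    then obtain A where A: "X = hadamard m \<alpha> A" "\<forall>k\<in>{1..m}. A k \<in> \<Theta> k" by blast
    then show "X \<in> {hadamard m \<alpha> A | A. \<forall>k\<in>{1..m}. A k \<in> \<Theta> (\<sigma> k)}"
      using re[OF \<sigma>, of A] bij_betw_apply[OF \<sigma>] by (intro CollectI exI[of _ "\<lambda>k. A (\<sigma> k)"]) auto
  qed
qed

lemma power_powr_commute:
  assumes "0 \<le> (x::real)" shows "(x ^ k) powr a = (x powr a) ^ k"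
proof (cases "x = 0")
  case True
  then show ?thesis by (cases k) auto
next
  case False
  then have "x > 0" using assms by simp
  then show ?thesis by (simp add: powr_realpow[symmetric] powr_powr mult.commute)
qed

lemma le_powr_inverse_of_power_le:
  assumes "x ^ n \<le> y" "0 \<le> x" "1 \<le> n"
  shows "x \<le> y powr (1 / real n)"
proof -
  have "(x ^ n) powr (1 / real n) \<le> y powr (1 / real n)" using assms by (intro powr_mono2) auto
  moreover have "(x ^ n) powr (1 / real n) = x"
    using assms by (cases "x = 0") (simp_all add: powr_realpow[symmetric] powr_powr)
  ultimately show ?thesis by simp
qed

context oc_seq_space begin

lemma adm_hadamard_pow:
  assumes m: "1 \<le> m" and \<alpha>: "1 / real m \<le> \<alpha>" and \<Theta>: "\<And>j. j \<in> {1..m} \<Longrightarrow> adm (\<Theta> j)"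
  shows "adm (hadamard_pow m \<alpha> \<Theta>)"
proof -
  have "\<forall>j\<in>{1..m}. \<exists>M. 0 \<le> M \<and> (\<forall>A\<in>\<Theta> j. op_bound M A)"
    by (intro ballI) (rule \<Theta>[unfolded adm_def])
  from bchoice[OF this] obtain M where M: "\<And>j. j \<in> {1..m} \<Longrightarrow> 0 \<le> M j \<and> (\<forall>A\<in>\<Theta> j. op_bound (M j) A)" by blast
  have "op_bound (\<Prod>k=1..m. (M k + 1) powr \<alpha>) (hadamard m \<alpha> A)" if A: "\<forall>k\<in>{1..m}. A k \<in> \<Theta> k" for A
  proof (rule op_bound_hadamard[OF m \<alpha>])
    fix k assume k: "k \<in> {1..m}"
    have "A k \<in> \<Theta> k" using A k by (rule bspec)
    with M[OF k] have "op_bound (M k) (A k)" by blast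
    then show "op_bound (M k + 1) (A k)" by (rule op_bound_mono) simp
    show "0 < M k + 1" using M[OF k] by simp
  qed
  then show ?thesis unfolding adm_def hadamard_pow_eq
    by (intro exI[of _ "\<Prod>k=1..m. (M k + 1) powr \<alpha>"]) (auto intro!: prod_nonneg)
qed

lemma hadamard_pow_mult:
  assumes m: "1 \<le> m" and \<alpha>: "1 / real m \<le> \<alpha>"
    and \<Theta>: "\<And>j. j \<in> {1..m} \<Longrightarrow> adm (\<Theta> j)" and \<Xi>: "\<And>j. j \<in> {1..m} \<Longrightarrow> adm (\<Xi> j)"
  shows "set_mult R (hadamard_pow m \<alpha> \<Theta>) (hadamard_pow m \<alpha> \<Xi>) \<preceq> hadamard_pow m \<alpha> (\<lambda>j. set_mult R (\<Theta> j) (\<Xi> j))"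
  unfolding dominated_def
proof
  fix X assume "X \<in> set_mult R (hadamard_pow m \<alpha> \<Theta>) (hadamard_pow m \<alpha> \<Xi>)"
  then obtain A B where X: "X = mat_mult R (hadamard m \<alpha> A) (hadamard m \<alpha> B)"
    and A: "\<forall>k\<in>{1..m}. A k \<in> \<Theta> k" and B: "\<forall>k\<in>{1..m}. B k \<in> \<Xi> k"
    unfolding set_mult_def hadamard_pow_eq by blast
  have "X \<sqsubseteq> hadamard m \<alpha> (\<lambda>k. mat_mult R (A k) (B k))"
    unfolding X using A B by (intro hadamard_mult[OF m \<alpha>] adm_pos_op[OF \<Theta>] adm_pos_op[OF \<Xi>]) auto
  moreover have "hadamard m \<alpha> (\<lambda>k. mat_mult R (A k) (B k)) \<in> hadamard_pow m \<alpha> (\<lambda>j. set_mult R (\<Theta> j) (\<Xi> j))"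
    unfolding hadamard_pow_eq set_mult_def using A B by blast
  ultimately show "\<exists>Y\<in>hadamard_pow m \<alpha> (\<lambda>j. set_mult R (\<Theta> j) (\<Xi> j)). X \<sqsubseteq> Y" by blast
qed

text \<open>\<open>hadamard_mult\<close> iterated over an array: a product of Hadamard products lies
  below the Hadamard product of the column products. For \<open>m = 1\<close> it compares products
  of Hadamard powers with Hadamard powers of products.\<close>

lemma list_prod_hadamard_pow:
  assumes m: "1 \<le> m" and \<alpha>: "1 / real m \<le> \<alpha>"
    and Hs: "\<And>\<Theta> j. \<Theta> \<in> set Hs \<Longrightarrow> j \<in> {1..m} \<Longrightarrow> adm (\<Theta> j)"
  shows "list_prod R (map (hadamard_pow m \<alpha>) Hs) \<preceq> hadamard_pow m \<alpha> (\<lambda>j. list_prod R (map (\<lambda>\<Theta>. \<Theta> j) Hs))"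
  using Hs
proof (induction Hs)
  case Nil
  have "ident_mat R \<sqsubseteq> hadamard m \<alpha> (\<lambda>_. ident_mat R)"
    using m unfolding mat_le_def hadamard_def by (auto simp: ident_mat_def)
  then show ?case unfolding dominated_def hadamard_pow_eq by auto
next
  case (Cons \<Theta> Hs)
  have aH: "adm (hadamard_pow m \<alpha> \<Theta>)" by (intro adm_hadamard_pow m \<alpha> Cons.prems) auto
  have aL: "adm (list_prod R (map (hadamard_pow m \<alpha>) Hs))"
    using Cons.prems by (intro adm_list) (auto intro!: adm_hadamard_pow m \<alpha>)
  have aj: "adm (list_prod R (map (\<lambda>\<Theta>. \<Theta> j) Hs))" if "j \<in> {1..m}" for j
    using Cons.prems that by (intro adm_list) auto
  have aR: "adm (hadamard_pow m \<alpha> (\<lambda>j. list_prod R (map (\<lambda>\<Theta>. \<Theta> j) Hs)))"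
    by (intro adm_hadamard_pow m \<alpha> aj)
  have "list_prod R (map (hadamard_pow m \<alpha>) (\<Theta> # Hs))
      \<preceq> set_mult R (hadamard_pow m \<alpha> \<Theta>) (hadamard_pow m \<alpha> (\<lambda>j. list_prod R (map (\<lambda>\<Theta>. \<Theta> j) Hs)))"
    using Cons by (simp, intro dom_mult aH aL aR dom_refl) auto
  also have "\<dots> \<preceq> hadamard_pow m \<alpha> (\<lambda>j. set_mult R (\<Theta> j) (list_prod R (map (\<lambda>\<Theta>. \<Theta> j) Hs)))"
    using Cons.prems by (intro hadamard_pow_mult m \<alpha> aj) auto
  finally show ?case by simp
qed

lemma set_pow_hadamard_pow:
  assumes m: "1 \<le> m" and \<alpha>: "1 / real m \<le> \<alpha>" and \<Theta>: "\<And>j. j \<in> {1..m} \<Longrightarrow> adm (\<Theta> j)"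
  shows "set_pow R (hadamard_pow m \<alpha> \<Theta>) n \<preceq> hadamard_pow m \<alpha> (\<lambda>j. set_pow R (\<Theta> j) n)"
proof -
  have "adm (\<Xi> j)" if "\<Xi> \<in> set (replicate n \<Theta>)" "j \<in> {1..m}" for \<Xi> j
    using that \<Theta> by (simp add: set_replicate_conv_if split: if_splits)
  then have "list_prod R (map (hadamard_pow m \<alpha>) (replicate n \<Theta>))
      \<preceq> hadamard_pow m \<alpha> (\<lambda>j. list_prod R (map (\<lambda>\<Theta>. \<Theta> j) (replicate n \<Theta>)))"
    by (rule list_prod_hadamard_pow[OF m \<alpha>])
  then show ?thesis unfolding set_pow_list by simp
qed

lemma gsup_hadamard_pow:
  assumes m: "1 \<le> m" and \<alpha>: "1 / real m \<le> \<alpha>" and \<Theta>: "\<And>j. j \<in> {1..m} \<Longrightarrow> adm (\<Theta> j)"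
  shows "gsup (hadamard_pow m \<alpha> \<Theta>) \<le> (\<Prod>j=1..m. gsup (\<Theta> j) powr \<alpha>)"
proof (rule gsup_least)
  have \<alpha>0: "0 \<le> \<alpha>" using \<alpha> by (meson divide_nonneg_nonneg of_nat_0_le_iff order_trans zero_le_one)
  fix X assume "X \<in> hadamard_pow m \<alpha> \<Theta>"
  then obtain A where X: "X = hadamard m \<alpha> A" and A: "\<forall>k\<in>{1..m}. A k \<in> \<Theta> k" unfolding hadamard_pow_eq by blast
  have pos: "pos_op (A k)" if "k \<in> {1..m}" for k using A \<Theta> that adm_pos_op by blast
  have "\<gamma> X \<le> (\<Prod>k=1..m. \<gamma> (A k) powr \<alpha>)" unfolding X by (rule gamma_hadamard[OF m \<alpha> pos])
  also have "\<dots> \<le> (\<Prod>j=1..m. gsup (\<Theta> j) powr \<alpha>)"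
    using A \<Theta> \<alpha>0 pos by (intro prod_mono conjI powr_mono2 gsup_upper gamma_nonneg) auto
  finally show "\<gamma> X \<le> (\<Prod>j=1..m. gsup (\<Theta> j) powr \<alpha>)" .
qed (auto intro: prod_nonneg)

lemma rh_hadamard_pow:
  assumes m: "1 \<le> m" and \<alpha>: "1 / real m \<le> \<alpha>" and \<Theta>: "\<And>j. j \<in> {1..m} \<Longrightarrow> adm (\<Theta> j)"
  shows "rh (hadamard_pow m \<alpha> \<Theta>) \<le> (\<Prod>j=1..m. rh (\<Theta> j) powr \<alpha>)"
proof -
  let ?H = "hadamard_pow m \<alpha> \<Theta>"
  have "0 < 1 / real m" using m by simp
  then have \<alpha>0: "0 < \<alpha>" using \<alpha> by (rule less_le_trans)
  have H: "adm ?H" by (rule adm_hadamard_pow[OF m \<alpha> \<Theta>])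
  let ?v = "\<lambda>S k. gsup (set_pow R S (Suc k)) powr (1 / real (Suc k))"
  have lim: "(\<lambda>k. \<Prod>j=1..m. ?v (\<Theta> j) k powr \<alpha>) \<longlonglongrightarrow> (\<Prod>j=1..m. rh (\<Theta> j) powr \<alpha>)"
    using \<alpha>0 by (intro tendsto_prod tendsto_powr2 rh_facts(2) \<Theta> tendsto_const) (auto intro: always_eventually)
  show ?thesis
  proof (rule LIMSEQ_le[OF rh_facts(2)[OF H] lim], intro exI[of _ 0] allI impI)
    fix k
    have g0: "0 \<le> gsup (set_pow R ?H (Suc k))" by (rule gsup_nonneg[OF adm_pow[OF H]])
    have "gsup (set_pow R ?H (Suc k)) \<le> gsup (hadamard_pow m \<alpha> (\<lambda>j. set_pow R (\<Theta> j) (Suc k)))"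
      by (intro gsup_dom set_pow_hadamard_pow m \<alpha> \<Theta> adm_pow H adm_hadamard_pow)
    also have "\<dots> \<le> (\<Prod>j=1..m. gsup (set_pow R (\<Theta> j) (Suc k)) powr \<alpha>)"
      by (intro gsup_hadamard_pow m \<alpha> adm_pow \<Theta>)
    finally have "?v ?H k \<le> (\<Prod>j=1..m. gsup (set_pow R (\<Theta> j) (Suc k)) powr \<alpha>) powr (1 / real (Suc k))"
      using g0 by (intro powr_mono2) auto
    also have "\<dots> = (\<Prod>j=1..m. ?v (\<Theta> j) k powr \<alpha>)"
      unfolding prod_powr_distrib by (simp add: powr_powr mult.commute)
    finally show "?v ?H k \<le> (\<Prod>j=1..m. ?v (\<Theta> j) k powr \<alpha>)" .
  qed
qed

lemma hadamard_pow_singleton: "hadamard_pow m \<alpha> (\<lambda>j. {A j}) = {hadamard m \<alpha> A}"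
  unfolding hadamard_pow_eq by (auto simp: hadamard_def intro!: exI[of _ A] ext prod.cong)

section \<open>The joint essential spectral radius\<close>

abbreviation re :: "mat set \<Rightarrow> real" where "re \<equiv> rho_ess_set R L nrm"

lemma op_bound_set_pow:
  "(\<And>A. A \<in> S \<Longrightarrow> op_bound M A) \<Longrightarrow> X \<in> set_pow R S k \<Longrightarrow> op_bound (M ^ k) X"
proof (induction k arbitrary: X)
  case (Suc k)
  from Suc.prems(2) obtain A B where "X = mat_mult R A B" "A \<in> S" "B \<in> set_pow R S k"
    by (auto simp: set_mult_def)
  then show ?case using Suc.IH[OF Suc.prems(1)] Suc.prems(1) by (auto intro: op_bound_mult)
qed (auto simp: op_bound_ident)

lemma rh_singleton_le: assumes "op_bound M X" shows "rh {X} \<le> M"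
proof -
  have X: "pos_op X" using assms by (rule op_bound_pos_op)
  have "rh {X} ^ 1 \<le> gsup (set_pow R {X} 1)" by (rule rh_facts(3)[OF adm_singleton[OF X]]) simp
  also have "\<dots> \<le> M"
  proof (rule gsup_least)
    show "0 \<le> M" using assms by (simp add: op_bound_def)
    show "\<gamma> A \<le> M" if "A \<in> set_pow R {X} 1" for A
      using that gamma_le_bound[OF op_bound_mult[OF assms op_bound_ident]] by (simp add: set_pow_singleton del: set_pow.simps)
  qed
  finally show ?thesis by simp
qed

text \<open>Characterizes \<open>re S\<close> as the least \<open>c >= 0\<close> with
  \<open>rh {X} <= c ^ k\<close> for all \<open>X\<close> in the k-th power, k >= 1. The suprema and
  roots of the definition do not reappear, and \<open>rho_ess\<close> is replaced by
  \<open>rh\<close> on singletons.\<close>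

lemma re_facts:
  assumes S: "adm S"
  shows "0 \<le> re S" "1 \<le> k \<Longrightarrow> X \<in> set_pow R S k \<Longrightarrow> rh {X} \<le> re S ^ k"
    "0 \<le> c \<Longrightarrow> (\<And>k X. 1 \<le> k \<Longrightarrow> X \<in> set_pow R S k \<Longrightarrow> rh {X} \<le> c ^ k) \<Longrightarrow> re S \<le> c"
proof -
  obtain M where M: "0 \<le> M" "\<And>A. A \<in> S \<Longrightarrow> op_bound M A" using S unfolding adm_def by blast
  have eq: "rho_ess R L nrm X = rh {X}" if "X \<in> set_pow R S k" for X k
    using rho_ess_eq adm_pos_op[OF adm_pow[OF S] that] .
  have r0: "0 \<le> rh {X}" if "X \<in> set_pow R S k" for X k
    using rh_facts(1) adm_singleton adm_pos_op[OF adm_pow[OF S] that] by blast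
  define h where "h k = Sup (insert 0 (rho_ess R L nrm ` set_pow R S k))" for k
  have re: "re S = (SUP k\<in>{1..}. h k powr (1 / real k))" by (simp add: rho_ess_set_def h_def)
  have bd: "bdd_above (insert 0 (rho_ess R L nrm ` set_pow R S k))" for k
    using M rh_singleton_le[OF op_bound_set_pow[OF M(2)]] eq by (intro bdd_aboveI[of _ "M ^ k"]) auto
  have hup: "rh {X} \<le> h k" if "X \<in> set_pow R S k" for X k
    unfolding h_def using eq[OF that] that by (intro cSup_upper bd) (auto intro!: image_eqI[of _ _ X])
  have h0: "0 \<le> h k" for k unfolding h_def by (intro cSup_upper bd) auto
  have hle: "h k \<le> c" if "0 \<le> c" "\<And>X. X \<in> set_pow R S k \<Longrightarrow> rh {X} \<le> c" for c k
    unfolding h_def using that eq by (intro cSup_least) auto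
  have root: "(c ^ k) powr (1 / real k) = c" if "1 \<le> k" "0 \<le> c" for c k
    using that by (cases "c = 0") (simp_all add: powr_realpow[symmetric] powr_powr)
  have hroot: "h k powr (1 / real k) \<le> c" if "1 \<le> k" "0 \<le> c" "\<And>X. X \<in> set_pow R S k \<Longrightarrow> rh {X} \<le> c ^ k" for c k
  proof -
    have "h k \<le> c ^ k" using that by (intro hle) auto
    then have "h k powr (1 / real k) \<le> (c ^ k) powr (1 / real k)" using h0 by (intro powr_mono2) auto
    then show ?thesis using root[OF that(1,2)] by simp
  qed
  have bdd: "bdd_above ((\<lambda>k. h k powr (1 / real k)) ` {1..})"
    using M rh_singleton_le[OF op_bound_set_pow[OF M(2)]] by (intro bdd_aboveI[of _ M]) (auto intro!: hroot)
  have up: "h k powr (1 / real k) \<le> re S" if "1 \<le> k" for k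
    unfolding re using that by (intro cSUP_upper bdd) auto
  show re0: "0 \<le> re S" using up[of 1] order_trans[OF powr_ge_zero] by blast
  show "rh {X} \<le> re S ^ k" if k: "1 \<le> k" and X: "X \<in> set_pow R S k"
  proof -
    have "h k = (h k powr (1 / real k)) ^ k"
      using k h0[of k] by (cases "h k = 0") (simp_all add: powr_realpow[symmetric] powr_powr)
    also have "\<dots> \<le> re S ^ k" using up[OF k] by (intro power_mono) auto
    finally show ?thesis using hup[OF X] by simp
  qed
  show "re S \<le> c" if "0 \<le> c" "\<And>k X. 1 \<le> k \<Longrightarrow> X \<in> set_pow R S k \<Longrightarrow> rh {X} \<le> c ^ k"
    unfolding re using that by (intro cSUP_least hroot) auto
qed

lemma rh_singleton_mono:
  assumes "pos_op X" "pos_op Y" "X \<sqsubseteq> Y" shows "rh {X} \<le> rh {Y}"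
  using assms by (intro rh_dom adm_singleton) (auto simp: dominated_def)

lemma re_dominated_pow:
  assumes S: "adm S" and X: "pos_op X" and T: "{X} \<preceq> set_pow R S k" and k: "1 \<le> k"
  shows "rh {X} \<le> re S ^ k"
proof -
  obtain Y where Y: "Y \<in> set_pow R S k" "X \<sqsubseteq> Y" using T by (auto simp: dominated_def)
  have "rh {X} \<le> rh {Y}" by (rule rh_singleton_mono[OF X adm_pos_op[OF adm_pow[OF S] Y(1)] Y(2)])
  also have "\<dots> \<le> re S ^ k" by (rule re_facts(2)[OF S k Y(1)])
  finally show ?thesis .
qed

lemma dominated_singleton: "X \<in> S \<Longrightarrow> S \<preceq> T \<Longrightarrow> {X} \<preceq> T"
  by (auto simp: dominated_def)

lemma re_dom:
  assumes "adm S" "adm T" "S \<preceq> T" shows "re S \<le> re T"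
proof (rule re_facts(3)[OF assms(1) re_facts(1)[OF assms(2)]])
  fix k X assume k: "1 \<le> k" and X: "X \<in> set_pow R S k"
  show "rh {X} \<le> re T ^ k"
    using X adm_pos_op[OF adm_pow[OF assms(1)] X] k
    by (intro re_dominated_pow assms dominated_singleton[OF X set_pow_dom[OF assms]])
qed

text \<open>For the direction that is not immediate: if X is in S^k, then X^n is dominated in
  (S^n)^k, so \<open>rh {X}\<close> to the power n is at most \<open>re\<close> of S^n to the power
  k, and n-th roots can be taken.\<close>

lemma re_pow:
  assumes S: "adm S" and n: "1 \<le> n" shows "re (set_pow R S n) = re S ^ n"
proof (rule antisym)
  have Sn: "adm (set_pow R S n)" by (rule adm_pow[OF S])
  have eqv: "set_pow R (set_pow R S a) b \<preceq> set_pow R S (a * b)" "set_pow R S (a * b) \<preceq> set_pow R (set_pow R S a) b" for a b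
    using set_pow_pow[OF S] unfolding set_equiv_def by auto
  show "re (set_pow R S n) \<le> re S ^ n"
  proof (rule re_facts(3)[OF Sn])
    show "0 \<le> re S ^ n" using re_facts(1)[OF S] by simp
    fix k X assume k: "1 \<le> k" and X: "X \<in> set_pow R (set_pow R S n) k"
    have "rh {X} \<le> re S ^ (n * k)"
      by (rule re_dominated_pow[OF S adm_pos_op[OF adm_pow[OF Sn] X] dominated_singleton[OF X eqv(1)]]) (use n k in simp)
    then show "rh {X} \<le> (re S ^ n) ^ k" by (simp add: power_mult)
  qed
  define c where "c = re (set_pow R S n) powr (1 / real n)"
  have c0: "0 \<le> c" by (simp add: c_def)
  have cn: "c ^ n = re (set_pow R S n)"
    using n re_facts(1)[OF Sn] unfolding c_def
    by (cases "re (set_pow R S n) = 0") (simp_all add: powr_realpow[symmetric] powr_powr)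
  have "re S \<le> c"
  proof (rule re_facts(3)[OF S c0])
    fix k X assume k: "1 \<le> k" and X: "X \<in> set_pow R S k"
    have pX: "pos_op X" by (rule adm_pos_op[OF adm_pow[OF S] X])
    let ?Y = "mat_pow X n"
    have "?Y \<in> set_pow R (set_pow R S k) n" using set_pow_mono[of "{X}" "set_pow R S k" n] X by (simp add: set_pow_singleton)
    then have "{?Y} \<preceq> set_pow R S (k * n)" using eqv(1) by (rule dominated_singleton)
    also have "set_pow R S (k * n) \<preceq> set_pow R (set_pow R S n) k" using eqv(2)[of n k] by (simp add: mult.commute)
    finally have "rh {?Y} \<le> re (set_pow R S n) ^ k" by (rule re_dominated_pow[OF Sn pos_op_pow[OF pX] _ k])
    moreover have "rh {?Y} = rh {X} ^ n" using rh_pow[OF adm_singleton[OF pX] n] by (simp add: set_pow_singleton)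
    ultimately have "rh {X} ^ n \<le> (c ^ k) ^ n" unfolding cn[symmetric] by (simp add: power_mult[symmetric] mult.commute)
    moreover have "0 \<le> c ^ k" using c0 by simp
    ultimately show "rh {X} \<le> c ^ k" using n by (metis power_le_imp_le_base Suc_pred' less_le_trans zero_less_one)
  qed
  then show "re S ^ n \<le> re (set_pow R S n)" using power_mono[OF _ re_facts(1)[OF S], of c n] cn by simp
qed

text \<open>A word X in (ST)^k is dominated by A Q with A in \<open>S\<close> and Q in (TS)^(k-1) T.
  Swapping these two matrices, by the result for \<open>rh\<close> on singletons, gives Q A, which
  is dominated in (TS)^k.\<close>

lemma re_swap_le:
  assumes S: "adm S" and T: "adm T" shows "re (set_mult R S T) \<le> re (set_mult R T S)"
proof -
  let ?ST = "set_mult R S T" and ?TS = "set_mult R T S"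
  have ST: "adm ?ST" and TS: "adm ?TS" by (intro adm_mult S T)+
  show ?thesis
  proof (rule re_facts(3)[OF ST re_facts(1)[OF TS]])
    fix k X assume k: "1 \<le> k" and X: "X \<in> set_pow R ?ST k"
    obtain l where l: "k = Suc l" using k by (cases k) auto
    let ?P = "set_pow R ?TS l"
    have P: "adm ?P" by (rule adm_pow[OF TS])
    obtain Y where Y: "Y \<in> set_mult R S (set_mult R ?P T)" "X \<sqsubseteq> Y"
      using set_pow_rotate[OF S T, of l] X unfolding l set_equiv_def dominated_def by blast
    obtain A Q where A: "A \<in> S" "Q \<in> set_mult R ?P T" "Y = mat_mult R A Q" using Y(1) by (auto simp: set_mult_def)
    have pA: "pos_op A" and pQ: "pos_op Q" and pX: "pos_op X"
      using adm_pos_op[OF S A(1)] adm_pos_op[OF adm_mult[OF P T] A(2)] adm_pos_op[OF adm_pow[OF ST] X] by auto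
    have "rh {X} \<le> rh {Y}" using pX pA pQ Y(2) A(3) by (auto intro!: rh_singleton_mono pos_op_mult)
    also have "{Y} = set_mult R {A} {Q}" using A(3) by (auto simp: set_mult_def)
    also have "rh (set_mult R {A} {Q}) \<le> rh (set_mult R {Q} {A})" by (intro rh_swap_le adm_singleton pA pQ)
    also have "set_mult R {Q} {A} = {mat_mult R Q A}" by (auto simp: set_mult_def)
    also have "rh {mat_mult R Q A} \<le> re ?TS ^ k"
    proof (rule re_dominated_pow[OF TS pos_op_mult[OF pQ pA] _ k])
      have QA: "mat_mult R Q A \<in> set_mult R (set_mult R ?P T) S" using A by (auto simp: set_mult_def)
      have "set_mult R (set_mult R ?P T) S \<doteq> set_mult R ?P ?TS" by (intro set_mult_assoc P T S)
      also have "set_mult R ?P ?TS \<doteq> set_mult R ?P (set_pow R ?TS 1)"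
        using set_equiv_sym[OF set_mult_ident(1)[of ?TS]]
        by (intro set_equiv_mult P TS adm_pow set_equiv_refl) simp
      also have "\<dots> \<doteq> set_pow R ?TS (l + 1)" by (rule set_equiv_sym[OF set_pow_add[OF TS]])
      finally have "set_mult R (set_mult R ?P T) S \<preceq> set_pow R ?TS k" by (simp add: set_equiv_def l)
      then show "{mat_mult R Q A} \<preceq> set_pow R ?TS k" by (rule dominated_singleton[OF QA])
    qed
    finally show "rh {X} \<le> re ?TS ^ k" .
  qed
qed

text \<open>A product of k members of the Hadamard set is dominated by one Hadamard product of
  members of the k-th powers; the inequality for \<open>rh\<close> is then applied to
  singletons.\<close>

lemma re_hadamard_pow:
  assumes m: "1 \<le> m" and \<alpha>: "1 / real m \<le> \<alpha>" and \<Theta>: "\<And>j. j \<in> {1..m} \<Longrightarrow> adm (\<Theta> j)"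
  shows "re (hadamard_pow m \<alpha> \<Theta>) \<le> (\<Prod>j=1..m. re (\<Theta> j) powr \<alpha>)"
proof -
  have "0 < 1 / real m" using m by simp
  then have \<alpha>0: "0 < \<alpha>" using \<alpha> by (rule less_le_trans)
  have H: "adm (hadamard_pow m \<alpha> \<Theta>)" by (rule adm_hadamard_pow[OF m \<alpha> \<Theta>])
  show ?thesis
  proof (rule re_facts(3)[OF H])
    show "0 \<le> (\<Prod>j=1..m. re (\<Theta> j) powr \<alpha>)" by (intro prod_nonneg) auto
    fix k X assume k: "1 \<le> k" and X: "X \<in> set_pow R (hadamard_pow m \<alpha> \<Theta>) k"
    obtain Y where Y: "Y \<in> hadamard_pow m \<alpha> (\<lambda>j. set_pow R (\<Theta> j) k)" "X \<sqsubseteq> Y"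
      using set_pow_hadamard_pow[of m \<alpha> \<Theta> k, OF m \<alpha> \<Theta>] X unfolding dominated_def by blast
    obtain A where A: "Y = hadamard m \<alpha> A" "\<forall>j\<in>{1..m}. A j \<in> set_pow R (\<Theta> j) k" using Y(1) unfolding hadamard_pow_eq by blast
    have pA: "pos_op (A j)" if "j \<in> {1..m}" for j using adm_pos_op[OF adm_pow[OF \<Theta>[OF that]]] A(2) that by blast
    have pY: "pos_op Y" unfolding A(1) by (rule pos_op_hadamard[OF m \<alpha> pA])
    have "rh {X} \<le> rh {Y}" by (rule rh_singleton_mono[OF adm_pos_op[OF adm_pow[OF H] X] pY Y(2)])
    also have "\<dots> \<le> (\<Prod>j=1..m. rh {A j} powr \<alpha>)"
      using rh_hadamard_pow[OF m \<alpha> adm_singleton[OF pA]] unfolding A(1) hadamard_pow_singleton .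
    also have "\<dots> \<le> (\<Prod>j=1..m. (re (\<Theta> j) ^ k) powr \<alpha>)"
      using A(2) k \<alpha>0 \<Theta> pA
      by (intro prod_mono conjI powr_mono2 re_facts(2) rh_facts(1) adm_singleton) auto
    also have "\<dots> = (\<Prod>j=1..m. re (\<Theta> j) powr \<alpha>) ^ k"
      using re_facts(1)[OF \<Theta>] unfolding prod_power_distrib by (intro prod.cong refl power_powr_commute) auto
    finally show "rh {X} \<le> (\<Prod>j=1..m. re (\<Theta> j) powr \<alpha>) ^ k" .
  qed
qed

end

subsection \<open>The chains of inequalities\<close>

lemma map_cyclic_shift:
  assumes "j \<in> {1..m}"
  shows "map (\<lambda>i. if j + i \<le> m then j + i else j + i - m) [0..<m] = [j..<m+1] @ [1..<j]"
  using assms by (intro nth_equalityI) (auto simp: nth_append)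

lemma bij_cyclic_shift:
  fixes i m :: nat
  assumes "i < m"
  shows "bij_betw (\<lambda>j. if j + i \<le> m then j + i else j + i - m) {1..m} {1..m}"
proof -
  let ?\<sigma> = "\<lambda>j. if j + i \<le> m then j + i else j + i - m"
  have inj: "inj_on ?\<sigma> {1..m}" using assms by (auto simp: inj_on_def split: if_splits)
  have "?\<sigma> ` {1..m} \<subseteq> {1..m}" using assms by auto
  then have "?\<sigma> ` {1..m} = {1..m}" using inj by (intro endo_inj_surj) auto
  then show ?thesis using inj by (simp add: bij_betw_def)
qed

lemma powr_of_power:
  assumes "0 \<le> (x::real)" "1 \<le> k" shows "(x ^ k) powr a = x powr (real k * a)"
proof (cases "x = 0")
  case True
  then show ?thesis using assms by simp
next
  case False
  then show ?thesis using assms by (simp add: powr_realpow[symmetric] powr_powr)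
qed

locale ess_radius = oc_seq_space +
  fixes r :: "mat set \<Rightarrow> real"
  assumes r_nonneg: "adm S \<Longrightarrow> 0 \<le> r S"
    and r_dom: "adm S \<Longrightarrow> adm T \<Longrightarrow> S \<preceq> T \<Longrightarrow> r S \<le> r T"
    and r_pow: "adm S \<Longrightarrow> 1 \<le> k \<Longrightarrow> r (set_pow R S k) = r S ^ k"
    and r_swap_le: "adm S \<Longrightarrow> adm T \<Longrightarrow> r (set_mult R S T) \<le> r (set_mult R T S)"
    and r_hadamard: "1 \<le> m \<Longrightarrow> 1 / real m \<le> \<alpha> \<Longrightarrow> (\<And>j. j \<in> {1..m} \<Longrightarrow> adm (\<Theta> j))
      \<Longrightarrow> r (hadamard_pow m \<alpha> \<Theta>) \<le> (\<Prod>j=1..m. r (\<Theta> j) powr \<alpha>)"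
begin

lemma r_equiv: "adm S \<Longrightarrow> adm T \<Longrightarrow> S \<doteq> T \<Longrightarrow> r S = r T"
  unfolding set_equiv_def using r_dom by (intro antisym) auto

lemma adm_cyc:
  assumes "\<And>k. k \<in> {1..m} \<Longrightarrow> adm (Psi k)" "j \<in> {1..m}"
  shows "adm (cyc_prod R Psi m j)"
  unfolding cyc_prod_def using assms by (intro adm_list) auto

text \<open>With Q the product of the first j - 1 factors and P that of the others, the two cyclic
  products are P Q and Q P up to equivalence, so two swaps give equality.\<close>

lemma r_cyc:
  assumes Psi: "\<And>k. k \<in> {1..m} \<Longrightarrow> adm (Psi k)" and j: "j \<in> {1..m}"
  shows "r (cyc_prod R Psi m j) = r (cyc_prod R Psi m 1)"
proof -
  let ?A = "map Psi [j..<m+1]" and ?B = "map Psi [1..<j]"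
  let ?P = "list_prod R ?A" and ?Q = "list_prod R ?B"
  have adm: "\<And>S. S \<in> set ?A \<union> set ?B \<Longrightarrow> adm S" using Psi j by auto
  have P: "adm ?P" and Q: "adm ?Q" by (intro adm_list adm; simp)+
  have "[1..<m+1] = [1..<j] @ [j..<m+1]" using j upt_add_eq_append[of 1 j "m + 1 - j"] by simp
  then have 1: "cyc_prod R Psi m 1 = list_prod R (?B @ ?A)" by (simp add: cyc_prod_def)
  have 2: "cyc_prod R Psi m j = list_prod R (?A @ ?B)" by (simp add: cyc_prod_def)
  have "r (list_prod R (?A @ ?B)) = r (set_mult R ?P ?Q)"
    using adm by (intro r_equiv list_prod_append adm_mult P Q adm_list) auto
  also have "\<dots> = r (set_mult R ?Q ?P)" by (intro antisym r_swap_le P Q)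
  also have "\<dots> = r (list_prod R (?B @ ?A))"
    using adm by (intro r_equiv set_equiv_sym[OF list_prod_append] adm_mult P Q adm_list) auto
  finally show ?thesis unfolding 1 2 .
qed

text \<open>Combines \<open>r_pow\<close> with the domination of a power of the Hadamard set by the
  Hadamard set of the powers. It is also used with \<open>m = 1\<close>, for plain Hadamard
  powers.\<close>

lemma r_hadamard_set_pow:
  assumes m: "1 \<le> m" and \<alpha>: "1 / real m \<le> \<alpha>" and \<Theta>: "\<And>j. j \<in> {1..m} \<Longrightarrow> adm (\<Theta> j)" and n: "1 \<le> n"
  shows "r (hadamard_pow m \<alpha> \<Theta>) \<le> r (hadamard_pow m \<alpha> (\<lambda>j. set_pow R (\<Theta> j) n)) powr (1 / real n)"
proof (rule le_powr_inverse_of_power_le[OF _ _ n])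
  have H: "adm (hadamard_pow m \<alpha> \<Theta>)" by (rule adm_hadamard_pow[OF m \<alpha> \<Theta>])
  show "0 \<le> r (hadamard_pow m \<alpha> \<Theta>)" by (rule r_nonneg[OF H])
  have "r (hadamard_pow m \<alpha> \<Theta>) ^ n = r (set_pow R (hadamard_pow m \<alpha> \<Theta>) n)" by (rule r_pow[OF H n, symmetric])
  also have "\<dots> \<le> r (hadamard_pow m \<alpha> (\<lambda>j. set_pow R (\<Theta> j) n))"
    by (intro r_dom adm_pow[OF H] adm_hadamard_pow m \<alpha> adm_pow \<Theta> set_pow_hadamard_pow)
  finally show "r (hadamard_pow m \<alpha> \<Theta>) ^ n \<le> r (hadamard_pow m \<alpha> (\<lambda>j. set_pow R (\<Theta> j) n))" .
qed

text \<open>In the \<open>m\<close>-th power of the Hadamard product the factors can be permuted cyclically, the \<open>i\<close>-th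
  factor by \<open>i\<close> places, so that the \<open>j\<close>-th column reads off the cyclic product starting at \<open>j\<close>.\<close>
lemma r_hadamard_cyc:
  assumes m: "1 \<le> m" and \<alpha>: "1 / real m \<le> \<alpha>" and Psi: "\<And>j. j \<in> {1..m} \<Longrightarrow> adm (Psi j)"
  shows "r (hadamard_pow m \<alpha> Psi) \<le> r (hadamard_pow m \<alpha> (cyc_prod R Psi m)) powr (1 / real m)"
proof (rule le_powr_inverse_of_power_le[OF _ _ m])
  let ?H = "hadamard_pow m \<alpha> Psi"
  have H: "adm ?H" by (rule adm_hadamard_pow[OF m \<alpha> Psi])
  show "0 \<le> r ?H" by (rule r_nonneg[OF H])
  let ?\<sigma> = "\<lambda>i j. if j + i \<le> m then j + i else j + i - m"
  let ?Hs = "map (\<lambda>i j. Psi (?\<sigma> i j)) [0..<m]"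
  have "map (hadamard_pow m \<alpha>) ?Hs = map (\<lambda>_. ?H) [0..<m]"
    unfolding map_map using hadamard_pow_reindex[OF bij_cyclic_shift] by (intro map_cong refl) auto
  then have eq: "set_pow R ?H m = list_prod R (map (hadamard_pow m \<alpha>) ?Hs)"
    by (simp only: set_pow_list map_replicate_const length_upt) simp
  have "list_prod R (map (hadamard_pow m \<alpha>) ?Hs) \<preceq> hadamard_pow m \<alpha> (\<lambda>j. list_prod R (map (\<lambda>\<Theta>. \<Theta> j) ?Hs))"
  proof (rule list_prod_hadamard_pow[OF m \<alpha>])
    fix \<Theta> j assume "\<Theta> \<in> set ?Hs" "j \<in> {1..m}"
    then obtain i where "i < m" "\<Theta> = (\<lambda>j. Psi (?\<sigma> i j))" by auto
    moreover have "?\<sigma> i j \<in> {1..m}" if "i < m" using that \<open>j \<in> {1..m}\<close> by auto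
    ultimately show "adm (\<Theta> j)" using Psi by simp
  qed
  also have "hadamard_pow m \<alpha> (\<lambda>j. list_prod R (map (\<lambda>\<Theta>. \<Theta> j) ?Hs)) = hadamard_pow m \<alpha> (cyc_prod R Psi m)"
  proof -
    have "list_prod R (map (\<lambda>\<Theta>. \<Theta> j) ?Hs) = cyc_prod R Psi m j" if "j \<in> {1..m}" for j
    proof -
      have "map (\<lambda>\<Theta>. \<Theta> j) ?Hs = map Psi (map (\<lambda>i. ?\<sigma> i j) [0..<m])" by simp
      then show ?thesis unfolding map_cyclic_shift[OF that] cyc_prod_def by (simp only:)
    qed
    then show ?thesis by (simp add: hadamard_pow_eq)
  qed
  finally have "r (set_pow R ?H m) \<le> r (hadamard_pow m \<alpha> (cyc_prod R Psi m))"
    unfolding eq[symmetric] by (intro r_dom adm_pow[OF H] adm_hadamard_pow m \<alpha> adm_cyc Psi)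
  then show "r ?H ^ m \<le> r (hadamard_pow m \<alpha> (cyc_prod R Psi m))" using r_pow[OF H m] by simp
qed

lemma radius_chain_cyclic:
  assumes m: "1 \<le> m" and n: "1 \<le> n" and \<alpha>: "1 / real m \<le> \<alpha>" and Psi: "\<And>j. j \<in> {1..m} \<Longrightarrow> adm (Psi j)"
  defines "H \<equiv> hadamard_pow m \<alpha> (\<lambda>j. set_pow R (cyc_prod R Psi m j) n)"
  shows "r (hadamard_pow m \<alpha> Psi) \<le> r (hadamard_pow m \<alpha> (cyc_prod R Psi m)) powr (1 / real m)"
    and "r (hadamard_pow m \<alpha> (cyc_prod R Psi m)) powr (1 / real m) \<le> r H powr (1 / real (m * n))"
    and "r H powr (1 / real (m * n)) \<le> r (cyc_prod R Psi m 1) powr \<alpha>"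
proof -
  have C: "adm (cyc_prod R Psi m j)" if "j \<in> {1..m}" for j by (rule adm_cyc[OF Psi that])
  have H: "adm H" unfolding H_def by (intro adm_hadamard_pow m \<alpha> adm_pow C)
  show "r (hadamard_pow m \<alpha> Psi) \<le> r (hadamard_pow m \<alpha> (cyc_prod R Psi m)) powr (1 / real m)"
    by (rule r_hadamard_cyc[OF m \<alpha> Psi])
  have "r (hadamard_pow m \<alpha> (cyc_prod R Psi m)) powr (1 / real m) \<le> (r H powr (1 / real n)) powr (1 / real m)"
    unfolding H_def by (intro powr_mono2 r_hadamard_set_pow r_nonneg adm_hadamard_pow m \<alpha> C n) auto
  then show "r (hadamard_pow m \<alpha> (cyc_prod R Psi m)) powr (1 / real m) \<le> r H powr (1 / real (m * n))"
    by (simp add: powr_powr mult.commute)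
  let ?\<rho> = "r (cyc_prod R Psi m 1)"
  have \<rho>: "0 \<le> ?\<rho>" using m by (intro r_nonneg C) auto
  have "r H \<le> (\<Prod>j=1..m. r (set_pow R (cyc_prod R Psi m j) n) powr \<alpha>)"
    unfolding H_def by (intro r_hadamard m \<alpha> adm_pow C)
  also have "\<dots> = (\<Prod>j=1..m. (?\<rho> ^ n) powr \<alpha>)"
    by (intro prod.cong refl) (simp only: r_pow[OF C n] r_cyc[OF Psi])
  also have "\<dots> = ?\<rho> powr (real (m * n) * \<alpha>)"
    using m n \<rho> by (simp add: power_powr_commute[symmetric] power_mult[symmetric] powr_of_power mult_ac)
  finally have "r H powr (1 / real (m * n)) \<le> (?\<rho> powr (real (m * n) * \<alpha>)) powr (1 / real (m * n))"
    using r_nonneg[OF H] by (intro powr_mono2) auto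
  then show "r H powr (1 / real (m * n)) \<le> ?\<rho> powr \<alpha>"
    using m n by (simp add: powr_powr)
qed

text \<open>The facts on Hadamard products for a single factor, whose exponent must then be at least
  1; this holds for \<open>t\<close> because \<open>\<alpha>\<close> is at least 1/m.\<close>

lemma radius_chain_power:
  assumes m: "1 \<le> m" and n: "1 \<le> n" and \<alpha>: "1 / real m \<le> \<alpha>" and Psi: "\<And>j. j \<in> {1..m} \<Longrightarrow> adm (Psi j)"
  defines "\<Phi> \<equiv> cyc_prod R Psi m 1" and "t \<equiv> \<alpha> * real m"
  shows "r (cyc_prod R (\<lambda>k. hpow_set t (Psi k)) m 1) powr (1 / real m) \<le> r (hpow_set t \<Phi>) powr (1 / real m)"
    and "r (hpow_set t \<Phi>) powr (1 / real m) \<le> r (hpow_set t (set_pow R \<Phi> n)) powr (1 / real (n * m))"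
    and "r (hpow_set t (set_pow R \<Phi> n)) powr (1 / real (n * m)) \<le> r \<Phi> powr \<alpha>"
proof -
  have t: "1 / real 1 \<le> t" using m \<alpha> by (simp add: t_def field_simps)
  have hadm: "adm (hpow_set t S)" if "adm S" for S
    using adm_hadamard_pow[of 1 t "\<lambda>_. S"] t that unfolding hadamard_pow_one by simp
  have \<Phi>: "adm \<Phi>" unfolding \<Phi>_def using m by (intro adm_cyc Psi) auto
  have mu: "[1..<m+1] @ [1..<1] = [1..<m+1]" by simp
  let ?Hs = "map (\<lambda>k. (\<lambda>_::nat. Psi k)) [1..<m+1]"
  have "list_prod R (map (hadamard_pow 1 t) ?Hs) \<preceq> hadamard_pow 1 t (\<lambda>j. list_prod R (map (\<lambda>\<Theta>. \<Theta> j) ?Hs))"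
    using Psi t by (intro list_prod_hadamard_pow) auto
  then have "cyc_prod R (\<lambda>k. hpow_set t (Psi k)) m 1 \<preceq> hpow_set t \<Phi>"
    unfolding hadamard_pow_one \<Phi>_def cyc_prod_def mu map_map o_def .
  then show "r (cyc_prod R (\<lambda>k. hpow_set t (Psi k)) m 1) powr (1 / real m) \<le> r (hpow_set t \<Phi>) powr (1 / real m)"
    using m by (intro powr_mono2 r_dom r_nonneg adm_cyc hadm Psi \<Phi>) auto
  have "r (hpow_set t \<Phi>) \<le> r (hpow_set t (set_pow R \<Phi> n)) powr (1 / real n)"
    using r_hadamard_set_pow[of 1 t "\<lambda>_. \<Phi>" n] t \<Phi> n unfolding hadamard_pow_one by simp
  then have "r (hpow_set t \<Phi>) powr (1 / real m) \<le> (r (hpow_set t (set_pow R \<Phi> n)) powr (1 / real n)) powr (1 / real m)"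
    by (intro powr_mono2 r_nonneg hadm \<Phi>) auto
  then show "r (hpow_set t \<Phi>) powr (1 / real m) \<le> r (hpow_set t (set_pow R \<Phi> n)) powr (1 / real (n * m))"
    by (simp add: powr_powr)
  have "r (hpow_set t (set_pow R \<Phi> n)) \<le> r (set_pow R \<Phi> n) powr t"
    using r_hadamard[of 1 t "\<lambda>_. set_pow R \<Phi> n"] t adm_pow[OF \<Phi>] unfolding hadamard_pow_one by simp
  also have "\<dots> = r \<Phi> powr (real n * t)"
    unfolding r_pow[OF \<Phi> n] using r_nonneg[OF \<Phi>] n by (simp add: powr_of_power)
  finally have "r (hpow_set t (set_pow R \<Phi> n)) powr (1 / real (n * m)) \<le> (r \<Phi> powr (real n * t)) powr (1 / real (n * m))"
    by (intro powr_mono2 r_nonneg hadm adm_pow \<Phi>) auto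
  then show "r (hpow_set t (set_pow R \<Phi> n)) powr (1 / real (n * m)) \<le> r \<Phi> powr \<alpha>"
    using m n by (simp add: powr_powr t_def)
qed

text \<open>Writes the Hadamard power \<open>\<alpha>\<close> as the power
  \<open>\<alpha> / m\<close> of the power m and applies the Hadamard inequality with exponent
  \<open>\<alpha> / m\<close>. That exponent must be at least 1/m, which is where
  \<open>\<alpha> >= 1\<close> comes from.\<close>

lemma radius_chain_product:
  assumes m: "1 \<le> m" and n: "1 \<le> n" and \<alpha>: "1 \<le> \<alpha>" and Psi: "\<And>j. j \<in> {1..m} \<Longrightarrow> adm (Psi j)"
  defines "\<Theta> \<equiv> \<lambda>j. set_pow R (cyc_prod R Psi m j) n"
  shows "r (hadamard_pow m \<alpha> \<Theta>) powr (1 / real (m * n)) \<le> (\<Prod>j=1..m. r (hpow_set (real m) (\<Theta> j))) powr (\<alpha> / real (m\<^sup>2 * n))"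
    and "(\<Prod>j=1..m. r (hpow_set (real m) (\<Theta> j))) powr (\<alpha> / real (m\<^sup>2 * n)) \<le> r (cyc_prod R Psi m 1) powr \<alpha>"
proof -
  have C: "adm (cyc_prod R Psi m j)" if "j \<in> {1..m}" for j by (rule adm_cyc[OF Psi that])
  have \<Theta>: "adm (\<Theta> j)" if "j \<in> {1..m}" for j unfolding \<Theta>_def by (rule adm_pow[OF C[OF that]])
  have m1: "1 / real 1 \<le> real m" using m by simp
  have hadm: "adm (hpow_set (real m) S)" if "adm S" for S
    using adm_hadamard_pow[of 1 "real m" "\<lambda>_. S"] m1 that unfolding hadamard_pow_one by simp
  have \<alpha>m: "1 / real m \<le> \<alpha>" and \<alpha>m': "1 / real m \<le> \<alpha> / real m"
    using m \<alpha> by (auto simp: field_simps intro: order_trans[OF \<alpha>])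
  let ?P = "\<Prod>j=1..m. r (hpow_set (real m) (\<Theta> j))"
  have eq: "hadamard_pow m \<alpha> \<Theta> = hadamard_pow m (\<alpha> / real m) (\<lambda>j. hpow_set (real m) (\<Theta> j))"
    using m by (simp add: hpow_set_hpow_set)
  have "r (hadamard_pow m \<alpha> \<Theta>) \<le> (\<Prod>j=1..m. r (hpow_set (real m) (\<Theta> j)) powr (\<alpha> / real m))"
    unfolding eq by (intro r_hadamard m \<alpha>m' hadm \<Theta>)
  also have "\<dots> = ?P powr (\<alpha> / real m)" by (rule prod_powr_distrib[symmetric])
  finally have "r (hadamard_pow m \<alpha> \<Theta>) powr (1 / real (m * n)) \<le> (?P powr (\<alpha> / real m)) powr (1 / real (m * n))"
    by (intro powr_mono2 r_nonneg adm_hadamard_pow m \<alpha>m \<Theta>) auto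
  then show "r (hadamard_pow m \<alpha> \<Theta>) powr (1 / real (m * n)) \<le> ?P powr (\<alpha> / real (m\<^sup>2 * n))"
    by (simp add: powr_powr power2_eq_square mult_ac)
  let ?\<rho> = "r (cyc_prod R Psi m 1)"
  have \<rho>: "0 \<le> ?\<rho>" using m by (intro r_nonneg C) auto
  have "r (hpow_set (real m) (\<Theta> j)) \<le> ?\<rho> powr (real n * real m)" if j: "j \<in> {1..m}" for j
  proof -
    have "r (hpow_set (real m) (\<Theta> j)) \<le> r (\<Theta> j) powr real m"
      using r_hadamard[of 1 "real m" "\<lambda>_. \<Theta> j"] m1 \<Theta>[OF j] unfolding hadamard_pow_one by simp
    also have "\<dots> = (?\<rho> ^ n) powr real m"
      by (simp only: \<Theta>_def r_pow[OF C[OF j] n] r_cyc[OF Psi j])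
    also have "\<dots> = ?\<rho> powr (real n * real m)" by (rule powr_of_power[OF \<rho> n])
    finally show ?thesis .
  qed
  then have "?P \<le> (\<Prod>j=1..m. ?\<rho> powr (real n * real m))"
    by (intro prod_mono conjI r_nonneg hadm \<Theta>) auto
  also have "\<dots> = ?\<rho> powr (real (m\<^sup>2 * n))"
  proof -
    have "(?\<rho> powr (real n * real m)) ^ m = ?\<rho> powr (real n * real m * real m)"
      using m \<rho> by (simp add: power_powr_commute[symmetric] powr_of_power mult_ac)
    then show ?thesis by (simp add: power2_eq_square mult_ac)
  qed
  finally have "?P powr (\<alpha> / real (m\<^sup>2 * n)) \<le> (?\<rho> powr (real (m\<^sup>2 * n))) powr (\<alpha> / real (m\<^sup>2 * n))"
    using \<alpha> by (intro powr_mono2 prod_nonneg r_nonneg hadm \<Theta>) auto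
  then show "?P powr (\<alpha> / real (m\<^sup>2 * n)) \<le> ?\<rho> powr \<alpha>" using m n by (simp add: powr_powr)
qed

end

lemma (in oc_seq_space) ess_radius_rho_hat: "ess_radius R L nrm (rho_hat_ess_set R L nrm)"
  by unfold_locales (intro rh_facts(1) rh_dom rh_pow rh_swap_le rh_hadamard_pow; assumption)+

lemma (in oc_seq_space) ess_radius_rho_ess: "ess_radius R L nrm (rho_ess_set R L nrm)"
  by unfold_locales (intro re_facts(1) re_dom re_pow re_swap_le re_hadamard_pow; assumption)+

text \<open>Order continuity is applied to the decreasing sequence of the tails of \<open>modulus x\<close>.\<close>
lemma oc_seq_space_intro:
  assumes L: "class_L R L nrm" and oc: "order_continuous L seq_pos nrm"
  shows "oc_seq_space R L nrm"
proof -
  interpret seq_space R L nrm by unfold_locales (rule L)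
  show ?thesis
  proof unfold_locales
    fix x assume x: "x \<in> L"
    define f where "f l = tail l (modulus x)" for l
    have fL: "f l \<in> L" for l unfolding f_def by (intro tail_in modulus_in x)
    have nf: "nrm (f l) = nrm (tail l x)" for l
      by (rule antisym; rule nrm_mono) (auto simp: f_def tail_def intro: tail_in modulus_in x solid_in[OF x])
    have "(INF g\<in>range f. nrm g) = 0"
      using oc[unfolded order_continuous_def]
    proof (elim allE impE)
      show "range f \<subseteq> L \<and> range f \<noteq> {} \<and> (\<forall>g\<in>range f. seq_pos g) \<and>
          (\<forall>g\<in>range f. \<forall>g'\<in>range f. \<exists>h\<in>range f. seq_pos (g - h) \<and> seq_pos (g' - h)) \<and>
          (\<forall>h\<in>L. (\<forall>g\<in>range f. seq_pos (g - h)) \<longrightarrow> seq_pos (0 - h))"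
      proof (intro conjI ballI impI)
        show "range f \<subseteq> L" using fL by auto
        show "range f \<noteq> {}" by simp
        show "seq_pos g" if "g \<in> range f" for g using that by (auto simp: seq_pos_def f_def tail_def)
        fix g g' assume "g \<in> range f" "g' \<in> range f"
        then obtain a b where g: "g = f a" "g' = f b" by blast
        show "\<exists>h\<in>range f. seq_pos (g - h) \<and> seq_pos (g' - h)"
          by (intro bexI[of _ "f (max a b)"]) (auto simp: g seq_pos_def f_def tail_def)
      next
        fix h assume h: "\<forall>g\<in>range f. seq_pos (g - h)"
        have "Im (h j) = 0 \<and> Re (h j) \<le> 0" for j
        proof -
          have "seq_pos (f (Suc j) - h)" using h by blast
          then show ?thesis unfolding seq_pos_def f_def tail_def by (auto dest!: spec[of _ j])
        qed
        then show "seq_pos (0 - h)" by (auto simp: seq_pos_def)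
      qed
    qed
    then have inf: "(INF l. nrm (f l)) = 0" by (simp add: image_image)
    have bdd: "bdd_below (range (\<lambda>l. nrm (f l)))" using nrm_nonneg[OF fL] by (intro bdd_belowI[of _ 0]) auto
    have "decseq (\<lambda>l. nrm (f l))"
      unfolding nf by (intro decseq_SucI nrm_tail_antimono x) simp
    from LIMSEQ_decseq_INF[OF bdd this] show "(\<lambda>l. nrm (tail l x)) \<longlonglongrightarrow> 0"
      unfolding inf by (simp add: nf)
  qed
qed

lemma (in oc_seq_space) adm_of_bounded:
  assumes "bounded_mat_set R L nrm S" "\<forall>A\<in>S. nonneg_mat R A \<and> defines_op R L A"
  shows "adm S"
proof -
  obtain M where M: "\<forall>A\<in>S. \<forall>x\<in>L. nrm (ap A x) \<le> M * nrm x" using assms(1) by (auto simp: bounded_mat_set_def)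
  \<comment> \<open>The constant in \<open>bounded_mat_set\<close> may be negative, for instance for
    an empty set, hence the absolute value.\<close>
  have "nrm (ap A x) \<le> \<bar>M\<bar> * nrm x" if "A \<in> S" "x \<in> L" for A x
    using M that mult_right_mono[OF abs_ge_self nrm_nonneg[OF that(2)], of M] by fastforce
  then show ?thesis unfolding adm_def op_bound_def using assms(2) by (intro exI[of _ "\<bar>M\<bar>"]) auto
qed

theorem theorem4p6:
  fixes R :: "nat set" and L :: "seq set" and nrm :: "seq \<Rightarrow> real"
    and m n :: nat and Psi :: "nat \<Rightarrow> mat set" and \<alpha> :: real
    and r :: "mat set \<Rightarrow> real"
  assumes L: "class_L R L nrm"
    and ocL: "order_continuous L seq_pos nrm"
    and ocLd: "order_continuous (dual L nrm) (dual_pos L) (dual_norm L nrm)"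
    and m: "m \<ge> 1" and n: "n \<ge> 1"
    and Psi: "\<forall>j\<in>{1..m}. bounded_mat_set R L nrm (Psi j) \<and>
                (\<forall>A\<in>Psi j. nonneg_mat R A \<and> defines_op R L A)"
    and alpha: "\<alpha> \<ge> 1 / real m"
    and r: "r = rho_ess_set R L nrm \<or> r = rho_hat_ess_set R L nrm"
  shows
   "sorted
      [ r (hadamard_set m (\<lambda>k. hpow_set \<alpha> (Psi k))),
        r (hadamard_set m (\<lambda>j. hpow_set \<alpha> (cyc_prod R Psi m j))) powr (1 / real m),
        r (hadamard_set m (\<lambda>j. hpow_set \<alpha> (set_pow R (cyc_prod R Psi m j) n))) powr (1 / real (m * n)),
        r (cyc_prod R Psi m 1) powr \<alpha> ]
    \<and> sorted
      [ r (hadamard_set m (\<lambda>k. hpow_set \<alpha> (Psi k))),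
        r (cyc_prod R (\<lambda>k. hpow_set (\<alpha> * m) (Psi k)) m 1) powr (1 / real m),
        r (hpow_set (\<alpha> * m) (cyc_prod R Psi m 1)) powr (1 / real m),
        r (hpow_set (\<alpha> * m) (set_pow R (cyc_prod R Psi m 1) n)) powr (1 / real (n * m)),
        r (cyc_prod R Psi m 1) powr \<alpha> ]
    \<and> (\<alpha> \<ge> 1 \<longrightarrow>
       sorted
        [ r (hadamard_set m (\<lambda>k. hpow_set \<alpha> (Psi k))),
          r (hadamard_set m (\<lambda>j. hpow_set \<alpha> (cyc_prod R Psi m j))) powr (1 / real m),
          r (hadamard_set m (\<lambda>j. hpow_set \<alpha> (set_pow R (cyc_prod R Psi m j) n))) powr (1 / real (m * n)),
          (\<Prod>j=1..m. r (hpow_set (real m) (set_pow R (cyc_prod R Psi m j) n))) powr (\<alpha> / real (m^2 * n)),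
          r (cyc_prod R Psi m 1) powr \<alpha> ]
     \<and> sorted
        [ r (hadamard_set m (\<lambda>k. hpow_set \<alpha> (Psi k))),
          r (hadamard_set m (\<lambda>j. hpow_set (1 / real m) (cyc_prod R (\<lambda>k. hpow_set (\<alpha> * m) (Psi k)) m j))) powr (1 / real m),
          r (hadamard_set m (\<lambda>j. hpow_set (1 / real m) (set_pow R (cyc_prod R (\<lambda>k. hpow_set (\<alpha> * m) (Psi k)) m j) n))) powr (1 / real (m * n)),
          r (cyc_prod R (\<lambda>k. hpow_set (\<alpha> * m) (Psi k)) m 1) powr (1 / real m),
          r (hpow_set (\<alpha> * m) (cyc_prod R Psi m 1)) powr (1 / real m),
          r (hpow_set (\<alpha> * m) (set_pow R (cyc_prod R Psi m 1) n)) powr (1 / real (n * m)),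
          r (cyc_prod R Psi m 1) powr \<alpha> ])"
proof -
  interpret oc_seq_space R L nrm by (rule oc_seq_space_intro[OF L ocL])
  interpret ess_radius R L nrm r using r ess_radius_rho_hat ess_radius_rho_ess by auto
  have adm: "adm (Psi j)" if "j \<in> {1..m}" for j
    using Psi that by (intro adm_of_bounded) auto
  have t: "1 / real 1 \<le> \<alpha> * real m" using m alpha by (simp add: field_simps)
  have adm': "adm (hpow_set (\<alpha> * real m) (Psi j))" if "j \<in> {1..m}" for j
    using adm_hadamard_pow[of 1 "\<alpha> * real m" "\<lambda>_. Psi j"] t adm[OF that] unfolding hadamard_pow_one by simp
  \<comment> \<open>Writes the Hadamard power \<open>\<alpha>\<close> as the power 1/m of the power
    \<open>\<alpha> * m\<close>, so that the cyclic chain also applies to the sets of Hadamard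
    powers, with exponent 1/m.\<close>
  have split: "hadamard_pow m \<alpha> Psi = hadamard_pow m (1 / real m) (\<lambda>k. hpow_set (\<alpha> * real m) (Psi k))"
    using m by (simp add: hpow_set_hpow_set)
  note c1 = radius_chain_cyclic[OF m n alpha adm]
  note c1' = radius_chain_cyclic[of m n "1 / real m" "\<lambda>k. hpow_set (\<alpha> * real m) (Psi k)", OF m n order_refl adm']
  note c2 = radius_chain_power[OF m n alpha adm]
  note c3 = radius_chain_product[OF m n _ adm]
  \<comment> \<open>Reduces sortedness to comparisons of neighbours instead of all pairs.\<close>
  have s: "sorted (x # y # zs) \<longleftrightarrow> x \<le> y \<and> sorted (y # zs)" for x y :: real and zs
    by (auto simp: sorted_simps(2))
  have s1: "sorted [x]" for x :: real by simp
  \<comment> \<open>The first step of the second chain is the whole cyclic chain \<open>c1'\<close>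
    for the powered sets contracted to one inequality; the same chain, uncontracted, opens the
    fourth one.\<close>
  show ?thesis
    unfolding s
    by (intro conjI impI s1 c1 c1'(2,3) c2 c3 c1'(1)[folded split]
      order_trans[OF order_trans[OF c1'(1) c1'(2)] c1'(3), folded split])
qed

end
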